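(* Let $\Lambda$ be an artin algebra and let $M$ be an indecomposable non-projective $\Lambda$-module. Let $m,n\in\mathbb N\cup\{\infty\}$ with $m\neq 0$. Then there is both a path of length $m$ starting at $[M]$ and a path of length $n$ ending at $[M]$ in the $\mho$-quiver of $\Lambda$ if and only if $$M\in{}^{\perp_1}(\mathcal T_{m-1}\cup\mathcal S_n).$$ In particular, there is both an arrow starting at $[M]$ and an arrow ending at $[M]$ if and only if $$M\in{}^{\perp_1}(\Lambda\oplus K_1).$$
   Context: $\Lambda$ is an artin algebra over a commutative artin ring $R$. "Module" means finitely generated left $\Lambda$-module; their category is $\Lambda\text{-mod}$. $D$ is the canonical duality between $\Lambda\text{-mod}$ and $\Lambda^{\mathrm{op}}\text{-mod}$. $\mathcal P$ is the full subcategory of projective modules. $\mathbb N=\{0,1,2,\dots\}$. A left $\mathcal P$-approximation of $M$ is a morphism $f:M\to Q$ with $Q\in\mathcal P$ such that every morphism from $M$ to a projective module factors through $f$; it is minimal if every $t:Q\to Q$ with $tf=f$ is an automorphism. Every $M$ has a minimal left $\mathcal P$-approximation $f:M\to Q$, and $\mho M:=\operatorname{Coker} f$. A module is torsionless if it is a submodule of a projective module. The $\mho$-quiver of $\Lambda$ has as vertices the isomorphism classes $[M]$ of indecomposable non-projective modules, and there is an arrow from $[N]$ to $[M]$ (starting at $[N]$, ending at $[M]$) whenever $M$ is torsionless and $N\cong\mho M$. (Known fact: if $M$ is indecomposable, non-projective and torsionless, then $\mho M$ is indecomposable non-projective.) At most one arrow starts and at most one arrow ends at each vertex. A path of length $t<\infty$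 is a sequence of $t$ composable arrows (vertices may repeat; a path of length $0$ at $[M]$ is trivial and always exists). A path of length $\infty$ starting at $[M]$ is an infinite sequence of arrows $[M]\to[M_1]\to[M_2]\to\cdots$; a path of length $\infty$ ending at $[M]$ is an infinite sequence of arrows $\cdots\to[M_2]\to[M_1]\to[M]$. Let $\cdots\to P_2\xrightarrow{\partial_2}P_1\xrightarrow{\partial_1}P_0\to D(\Lambda_\Lambda)\to 0$ be a minimal projective resolution; put $K_0=D(\Lambda_\Lambda)$ and $K_i=\operatorname{Im}\partial_i$ for $i\ge1$. Let $0\to{}_\Lambda\Lambda\to I_0\xrightarrow{\partial_{-1}}I_{-1}\xrightarrow{\partial_{-2}}I_{-2}\to\cdots$ be a minimal injective coresolution; put $L_0={}_\Lambda\Lambda$ and $L_i=\operatorname{Im}\partial_i$ for $i\le-1$. For $n\in\mathbb N$ let $\mathcal S_n=\{K_0,\dots,K_n\}$ and $\mathcal T_n=\{L_0,L_{-1},\dots,L_{-n}\}$; let $\mathcal S_\infty=\{K_0,K_1,\dots\}$ and $\mathcal T_\infty=\{L_0,L_{-1},\dots\}$. Convention: $\infty-1=\infty$. For a class $\mathcal X$ of modules, ${}^{\perp_1}\mathcal X=\{Z\in\Lambda\text{-mod}\mid \operatorname{Ext}^1_\Lambda(Z,X)=0\text{ for all }X\in\mathcal X\}$; for a single module $X$, ${}^{\perp_1}X={}^{\perp_1}\{X\}$. *)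

theory Defs
  imports "HOL-Algebra.Module" "HOL-Algebra.Ideal" "HOL-Library.Extended_Nat"
begin

section \<open>Modules over a not necessarily commutative ring\<close>

text \<open>
  The locale \<^locale>\<open>Module.module\<close> of HOL-Algebra asks for a commutative ring of scalars. As there, the
  multiplication and unit stored in a module record play no role for a module.
\<close>

locale left_module = R?: ring R + M?: abelian_group M
    for R :: "('a, 'r) ring_scheme" (structure) and M :: "('a, 'm) module" (structure) +
  assumes smult_closed [simp, intro]:
      "\<lbrakk>a \<in> carrier R; x \<in> carrier M\<rbrakk> \<Longrightarrow> a \<odot>\<^bsub>M\<^esub> x \<in> carrier M"
    and smult_l_distr:
      "\<lbrakk>a \<in> carrier R; b \<in> carrier R; x \<in> carrier M\<rbrakk> \<Longrightarrow>
        (a \<oplus> b) \<odot>\<^bsub>M\<^esub> x = a \<odot>\<^bsub>M\<^esub> x \<oplus>\<^bsub>M\<^esub> b \<odot>\<^bsub>M\<^esub> x"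
    and smult_r_distr:
      "\<lbrakk>a \<in> carrier R; x \<in> carrier M; y \<in> carrier M\<rbrakk> \<Longrightarrow>
        a \<odot>\<^bsub>M\<^esub> (x \<oplus>\<^bsub>M\<^esub> y) = a \<odot>\<^bsub>M\<^esub> x \<oplus>\<^bsub>M\<^esub> a \<odot>\<^bsub>M\<^esub> y"
    and smult_assoc1:
      "\<lbrakk>a \<in> carrier R; b \<in> carrier R; x \<in> carrier M\<rbrakk> \<Longrightarrow>
        (a \<otimes> b) \<odot>\<^bsub>M\<^esub> x = a \<odot>\<^bsub>M\<^esub> (b \<odot>\<^bsub>M\<^esub> x)"
    and smult_one [simp]:
      "x \<in> carrier M \<Longrightarrow> \<one> \<odot>\<^bsub>M\<^esub> x = x"

definition fg_module :: "('a, 'r) ring_scheme \<Rightarrow> ('a, 'm) module \<Rightarrow> bool" where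
  "fg_module A M \<longleftrightarrow> left_module A M \<and>
     (\<exists>S. finite S \<and> S \<subseteq> carrier M \<and> (\<forall>H. submodule H A M \<and> S \<subseteq> H \<longrightarrow> H = carrier M))"

text \<open>
  Homomorphisms are undefined outside the carrier, so that equality of homomorphisms is equality
  of functions.
\<close>

definition module_hom ::
    "('a, 'r) ring_scheme \<Rightarrow> ('a, 'm) module \<Rightarrow> ('a, 'n) module \<Rightarrow> ('m \<Rightarrow> 'n) set" where
  "module_hom A M N = {f \<in> carrier M \<rightarrow>\<^sub>E carrier N.
     (\<forall>x\<in>carrier M. \<forall>y\<in>carrier M. f (x \<oplus>\<^bsub>M\<^esub> y) = f x \<oplus>\<^bsub>N\<^esub> f y) \<and>
     (\<forall>a\<in>carrier A. \<forall>x\<in>carrier M. f (a \<odot>\<^bsub>M\<^esub> x) = a \<odot>\<^bsub>N\<^esub> f x)}"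

definition module_iso :: "('a, 'r) ring_scheme \<Rightarrow> ('a, 'm) module \<Rightarrow> ('a, 'n) module \<Rightarrow> bool" where
  "module_iso A M N \<longleftrightarrow> (\<exists>f\<in>module_hom A M N. bij_betw f (carrier M) (carrier N))"

definition ker_module :: "('a, 'm) module \<Rightarrow> ('a, 'n) module \<Rightarrow> ('m \<Rightarrow> 'n) \<Rightarrow> 'm set" where
  "ker_module M N f = {x \<in> carrier M. f x = \<zero>\<^bsub>N\<^esub>}"

definition image_module :: "('a, 'm) module \<Rightarrow> ('a, 'n) module \<Rightarrow> ('m \<Rightarrow> 'n) \<Rightarrow> ('a, 'n) module" where
  "image_module M N f = N\<lparr>carrier := f ` carrier M\<rparr>"

definition regular_module :: "('a, 'r) ring_scheme \<Rightarrow> ('a, 'a) module" where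
  "regular_module A = \<lparr>carrier = carrier A, mult = mult A, one = one A,
     zero = zero A, add = add A, smult = mult A\<rparr>"

definition quot_module :: "('a, 'm) module \<Rightarrow> 'm set \<Rightarrow> ('a, 'm set) module" where
  "quot_module M H = \<lparr>carrier = a_rcosets\<^bsub>M\<^esub> H, mult = undefined, one = undefined,
     zero = H, add = set_add M, smult = (\<lambda>a X. \<Union>x\<in>X. H +>\<^bsub>M\<^esub> (a \<odot>\<^bsub>M\<^esub> x))\<rparr>"

definition coker_module :: "('a, 'm) module \<Rightarrow> ('a, 'n) module \<Rightarrow> ('m \<Rightarrow> 'n) \<Rightarrow> ('a, 'n set) module" where
  "coker_module M N f = quot_module N (f ` carrier M)"

definition direct_sum_module :: "('a, 'm) module \<Rightarrow> ('a, 'n) module \<Rightarrow> ('a, 'm \<times> 'n) module" where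
  "direct_sum_module M N = \<lparr>carrier = carrier M \<times> carrier N, mult = undefined, one = undefined,
     zero = (\<zero>\<^bsub>M\<^esub>, \<zero>\<^bsub>N\<^esub>),
     add = (\<lambda>(x, y) (x', y'). (x \<oplus>\<^bsub>M\<^esub> x', y \<oplus>\<^bsub>N\<^esub> y')),
     smult = (\<lambda>a (x, y). (a \<odot>\<^bsub>M\<^esub> x, a \<odot>\<^bsub>N\<^esub> y))\<rparr>"

definition indecomposable_module :: "('a, 'r) ring_scheme \<Rightarrow> ('a, 'm) module \<Rightarrow> bool" where
  "indecomposable_module A M \<longleftrightarrow> carrier M \<noteq> {\<zero>\<^bsub>M\<^esub>} \<and>
     (\<forall>H U. submodule H A M \<and> submodule U A M \<and> H \<inter> U = {\<zero>\<^bsub>M\<^esub>} \<and> H <+>\<^bsub>M\<^esub> U = carrier M \<longrightarrow>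
        H = {\<zero>\<^bsub>M\<^esub>} \<or> U = {\<zero>\<^bsub>M\<^esub>})"

definition essential_submodule :: "('a, 'r) ring_scheme \<Rightarrow> 'm set \<Rightarrow> ('a, 'm) module \<Rightarrow> bool" where
  "essential_submodule A H M \<longleftrightarrow> submodule H A M \<and>
     (\<forall>U. submodule U A M \<and> H \<inter> U = {\<zero>\<^bsub>M\<^esub>} \<longrightarrow> U = {\<zero>\<^bsub>M\<^esub>})"

definition superfluous_submodule :: "('a, 'r) ring_scheme \<Rightarrow> 'm set \<Rightarrow> ('a, 'm) module \<Rightarrow> bool" where
  "superfluous_submodule A H M \<longleftrightarrow> submodule H A M \<and>
     (\<forall>U. submodule U A M \<and> H <+>\<^bsub>M\<^esub> U = carrier M \<longrightarrow> U = carrier M)"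


section \<open>The category of finitely generated modules\<close>

text \<open>
  Quantifying over all finitely generated modules needs one type that contains a copy of each of
  them. An element of $A^k/U$ is a coset, that is, a set of coefficient vectors, so the type of
  sets of functions from \<^typ>\<open>nat\<close> to the ring is large enough: this is the lemma
  \<open>ex_iso_in_mod_cat\<close> below.
\<close>

type_synonym 'a univ = "(nat \<Rightarrow> 'a) set"

definition mod_cat :: "('a, 'r) ring_scheme \<Rightarrow> ('a, 'a univ) module set" where
  "mod_cat A = {M. fg_module A M}"

definition lincomb_of ::
    "('a, 'r) ring_scheme \<Rightarrow> ('a, 'm) module \<Rightarrow> (nat \<Rightarrow> 'm) \<Rightarrow> nat \<Rightarrow> (nat \<Rightarrow> 'a) \<Rightarrow> 'm" where
  "lincomb_of A M s k c = (\<Oplus>\<^bsub>M\<^esub>i\<in>{..<k}. c i \<odot>\<^bsub>M\<^esub> s i)"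

lemma (in left_module) smult_zero_left: "x \<in> carrier M \<Longrightarrow> \<zero> \<odot>\<^bsub>M\<^esub> x = \<zero>\<^bsub>M\<^esub>"
  by (metis M.add.r_cancel_one' R.l_zero R.zero_closed smult_closed smult_l_distr)

lemma (in left_module) smult_zero_right: "a \<in> carrier R \<Longrightarrow> a \<odot>\<^bsub>M\<^esub> \<zero>\<^bsub>M\<^esub> = \<zero>\<^bsub>M\<^esub>"
  by (metis M.add.r_cancel_one' M.l_zero M.zero_closed smult_closed smult_r_distr)

lemma (in left_module) smult_minus_one: "x \<in> carrier M \<Longrightarrow> (\<ominus> \<one>) \<odot>\<^bsub>M\<^esub> x = \<ominus>\<^bsub>M\<^esub> x"
  by (metis M.minus_equality R.add.inv_closed R.l_neg R.one_closed smult_closed smult_l_distr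
      smult_one smult_zero_left a_inv_def)

lemma (in left_module) submodule_lincombs:
  assumes s: "s \<in> {..<k} \<rightarrow> carrier M"
  shows "submodule (lincomb_of R M s k ` ({..<k} \<rightarrow> carrier R)) R M"
proof -
  let ?H = "lincomb_of R M s k ` ({..<k} \<rightarrow> carrier R)"
  have cl: "(\<lambda>i. c i \<odot>\<^bsub>M\<^esub> s i) \<in> {..<k} \<rightarrow> carrier M" if "c \<in> {..<k} \<rightarrow> carrier R" for c
    using that s by (auto simp: Pi_def)
  have scale: "a \<odot>\<^bsub>M\<^esub> (\<Oplus>\<^bsub>M\<^esub>i\<in>F. f i) = (\<Oplus>\<^bsub>M\<^esub>i\<in>F. a \<odot>\<^bsub>M\<^esub> f i)"
    if "finite F" "a \<in> carrier R" "f \<in> F \<rightarrow> carrier M" for a F and f :: "nat \<Rightarrow> _"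
    using that by (induction F) (auto simp: smult_zero_right smult_r_distr Pi_def)
  have smult: "a \<odot>\<^bsub>M\<^esub> x \<in> ?H" if a: "a \<in> carrier R" and x: "x \<in> ?H" for a x
  proof -
    obtain c where c: "c \<in> {..<k} \<rightarrow> carrier R" "x = lincomb_of R M s k c" using x by blast
    have "a \<odot>\<^bsub>M\<^esub> x = (\<Oplus>\<^bsub>M\<^esub>i\<in>{..<k}. a \<odot>\<^bsub>M\<^esub> (c i \<odot>\<^bsub>M\<^esub> s i))"
      unfolding c(2) lincomb_of_def by (rule scale) (use a cl[OF c(1)] in auto)
    also have "\<dots> = lincomb_of R M s k (\<lambda>i. a \<otimes> c i)"
      unfolding lincomb_of_def using a c(1) s by (intro M.finsum_cong') (auto simp: smult_assoc1 Pi_def)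
    finally show ?thesis using a c(1) by (auto intro!: imageI)
  qed
  have add: "x \<oplus>\<^bsub>M\<^esub> y \<in> ?H" if x: "x \<in> ?H" and y: "y \<in> ?H" for x y
  proof -
    obtain c where c: "c \<in> {..<k} \<rightarrow> carrier R" "x = lincomb_of R M s k c" using x by blast
    obtain c' where c': "c' \<in> {..<k} \<rightarrow> carrier R" "y = lincomb_of R M s k c'" using y by blast
    have "x \<oplus>\<^bsub>M\<^esub> y = (\<Oplus>\<^bsub>M\<^esub>i\<in>{..<k}. c i \<odot>\<^bsub>M\<^esub> s i \<oplus>\<^bsub>M\<^esub> c' i \<odot>\<^bsub>M\<^esub> s i)"
      unfolding c(2) c'(2) lincomb_of_def by (rule M.finsum_addf[symmetric]) (use cl[OF c(1)] cl[OF c'(1)] in auto)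
    also have "\<dots> = lincomb_of R M s k (\<lambda>i. c i \<oplus> c' i)"
      unfolding lincomb_of_def using c(1) c'(1) s by (intro M.finsum_cong') (auto simp: smult_l_distr Pi_def)
    finally show ?thesis using c(1) c'(1) by (auto intro!: imageI)
  qed
  have sub: "?H \<subseteq> carrier M"
    using cl by (auto simp: lincomb_of_def intro!: M.finsum_closed)
  have "lincomb_of R M s k (\<lambda>_. \<zero>) = \<zero>\<^bsub>M\<^esub>"
    unfolding lincomb_of_def using s by (intro M.add.finprod_one_eqI) (auto simp: smult_zero_left Pi_def)
  then have ne: "\<zero>\<^bsub>M\<^esub> \<in> ?H" by (metis (no_types, lifting) Pi_I R.zero_closed imageI)
  have "\<ominus>\<^bsub>M\<^esub> x \<in> ?H" if "x \<in> ?H" for x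
    using smult[of "\<ominus> \<one>" x] that sub by (auto simp: smult_minus_one subset_eq)
  then show ?thesis
    using sub ne add smult
    by (intro submodule.intro M.add.subgroupI submodule_axioms.intro) (auto simp flip: a_inv_def)
qed

lemma (in left_module) lincomb_of_single:
  assumes s: "s \<in> {..<k} \<rightarrow> carrier M" and j: "j < k"
  shows "lincomb_of R M s k (\<lambda>i. if i = j then \<one> else \<zero>) = s j"
proof -
  have "lincomb_of R M s k (\<lambda>i. if i = j then \<one> else \<zero>)
      = (\<Oplus>\<^bsub>M\<^esub>i\<in>{..<k}. if j = i then s i else \<zero>\<^bsub>M\<^esub>)"
    unfolding lincomb_of_def using s
    by (intro M.finsum_cong') (auto simp: smult_zero_left Pi_def)
  also have "\<dots> = s j"
    using s j by (intro M.add.finprod_singleton) auto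
  finally show ?thesis .
qed

lemma module_iso_transport:
  fixes A :: "('a, 'r) ring_scheme" and M :: "('a, 'm) module" and \<phi> :: "'m \<Rightarrow> 'u"
  assumes M: "fg_module A M" and phi: "inj_on \<phi> (carrier M)"
  shows "\<exists>N :: ('a, 'u) module. fg_module A N \<and> module_iso A M N"
proof -
  interpret left_module A M using M by (simp add: fg_module_def)
  define \<psi> where "\<psi> = the_inv_into (carrier M) \<phi>"
  have psi [simp]: "\<psi> (\<phi> x) = x" if "x \<in> carrier M" for x
    using that phi by (simp add: \<psi>_def the_inv_into_f_f)
  define N :: "('a, 'u) module" where "N = \<lparr>carrier = \<phi> ` carrier M, mult = undefined, one = undefined,
    zero = \<phi> \<zero>\<^bsub>M\<^esub>, add = (\<lambda>X Y. \<phi> (\<psi> X \<oplus>\<^bsub>M\<^esub> \<psi> Y)), smult = (\<lambda>a X. \<phi> (a \<odot>\<^bsub>M\<^esub> \<psi> X))\<rparr>"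
  have N [simp]: "carrier N = \<phi> ` carrier M" "\<zero>\<^bsub>N\<^esub> = \<phi> \<zero>\<^bsub>M\<^esub>"
    "X \<oplus>\<^bsub>N\<^esub> Y = \<phi> (\<psi> X \<oplus>\<^bsub>M\<^esub> \<psi> Y)" "a \<odot>\<^bsub>N\<^esub> X = \<phi> (a \<odot>\<^bsub>M\<^esub> \<psi> X)" for X Y a
    by (simp_all add: N_def)
  interpret N: abelian_group N
  proof (rule abelian_groupI)
    fix x assume "x \<in> carrier N"
    then show "\<exists>y\<in>carrier N. y \<oplus>\<^bsub>N\<^esub> x = \<zero>\<^bsub>N\<^esub>"
      by (auto simp: M.l_neg intro!: bexI[of _ "\<ominus>\<^bsub>M\<^esub> \<psi> x"])
  qed (auto simp: M.a_ac)
  have lmN: "left_module A N"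
    by unfold_locales (auto simp: smult_l_distr smult_r_distr smult_assoc1)
  define f where "f = restrict \<phi> (carrier M)"
  have hom: "f \<in> module_hom A M N"
    by (auto simp: f_def module_hom_def)
  have bij: "bij_betw f (carrier M) (carrier N)"
    using phi by (auto simp: f_def bij_betw_def inj_on_def)
  obtain S where S: "finite S" "S \<subseteq> carrier M" "\<And>H. submodule H A M \<Longrightarrow> S \<subseteq> H \<Longrightarrow> H = carrier M"
    using M by (auto simp: fg_module_def)
  have "H = carrier N" if H: "submodule H A N" "\<phi> ` S \<subseteq> H" for H
  proof -
    interpret H: submodule H A N by fact
    let ?H = "{x \<in> carrier M. \<phi> x \<in> H}"
    have zero: "\<phi> \<zero>\<^bsub>M\<^esub> \<in> H" using H.one_closed by simp
    have add: "\<phi> (x \<oplus>\<^bsub>M\<^esub> y) \<in> H" if "x \<in> ?H" "y \<in> ?H" for x y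
      using H.m_closed[of "\<phi> x" "\<phi> y"] that by simp
    have smult: "\<phi> (a \<odot>\<^bsub>M\<^esub> x) \<in> H" if "a \<in> carrier A" "x \<in> ?H" for a x
      using H.smult_closed[of a "\<phi> x"] that by simp
    have minus: "\<phi> (\<ominus>\<^bsub>M\<^esub> x) \<in> H" if "x \<in> ?H" for x
      using smult[of "\<ominus>\<^bsub>A\<^esub> \<one>\<^bsub>A\<^esub>" x] that by (auto simp: smult_minus_one)
    have "submodule ?H A M"
      using zero add smult minus M.zero_closed
      by (intro submodule.intro M.add.subgroupI submodule_axioms.intro) (auto simp flip: a_inv_def)
    then have "?H = carrier M" using S(2) H(2) by (intro S(3)) auto
    then show ?thesis using H.subset by auto
  qed
  then have "fg_module A N"
    using lmN S(1,2) unfolding fg_module_def by (intro conjI exI[of _ "\<phi> ` S"]) auto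
  then show ?thesis using hom bij unfolding module_iso_def by blast
qed

lemma ex_iso_in_mod_cat:
  assumes M: "fg_module A M"
  shows "\<exists>N\<in>mod_cat A. module_iso A M N"
proof -
  interpret left_module A M using M by (simp add: fg_module_def)
  obtain S where S: "finite S" "S \<subseteq> carrier M" "\<And>H. submodule H A M \<Longrightarrow> S \<subseteq> H \<Longrightarrow> H = carrier M"
    using M by (auto simp: fg_module_def)
  obtain k :: nat and s where k: "S = s ` {i. i < k}"
    using S(1) by (auto simp: finite_conv_nat_seg_image)
  have s: "s \<in> {..<k} \<rightarrow> carrier M" using S(2) k by auto
  let ?H = "lincomb_of A M s k ` ({..<k} \<rightarrow> carrier A)"
  have "S \<subseteq> ?H"
  proof
    fix x assume "x \<in> S"
    then obtain j where "j < k" "x = s j" using k by auto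
    then show "x \<in> ?H"
      using lincomb_of_single[OF s, of j] by (intro image_eqI[of _ _ "\<lambda>i. if i = j then \<one>\<^bsub>A\<^esub> else \<zero>\<^bsub>A\<^esub>"]) auto
  qed
  then have H: "?H = carrier M" using S(3) submodule_lincombs[OF s] by blast
  define \<phi> where "\<phi> x = {c \<in> {..<k} \<rightarrow> carrier A. lincomb_of A M s k c = x}" for x
  have "inj_on \<phi> (carrier M)"
  proof (rule inj_onI)
    fix x y assume x: "x \<in> carrier M" and eq: "\<phi> x = \<phi> y"
    obtain c where "c \<in> {..<k} \<rightarrow> carrier A" "x = lincomb_of A M s k c"
      using x unfolding H[symmetric] by blast
    then have "c \<in> \<phi> x" by (simp add: \<phi>_def)
    then show "x = y" using eq by (auto simp: \<phi>_def)
  qed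
  from module_iso_transport[OF M this] show ?thesis by (auto simp: mod_cat_def)
qed

definition projective_module :: "('a, 'r) ring_scheme \<Rightarrow> ('a, 'm) module \<Rightarrow> bool" where
  "projective_module A P \<longleftrightarrow> fg_module A P \<and>
     (\<forall>X\<in>mod_cat A. \<forall>Y\<in>mod_cat A. \<forall>g\<in>module_hom A X Y. \<forall>h\<in>module_hom A P Y.
        g ` carrier X = carrier Y \<longrightarrow>
        (\<exists>k\<in>module_hom A P X. \<forall>p\<in>carrier P. g (k p) = h p))"

definition injective_module :: "('a, 'r) ring_scheme \<Rightarrow> ('a, 'm) module \<Rightarrow> bool" where
  "injective_module A I \<longleftrightarrow> fg_module A I \<and>
     (\<forall>X\<in>mod_cat A. \<forall>Y\<in>mod_cat A. \<forall>g\<in>module_hom A X Y. \<forall>h\<in>module_hom A X I.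
        inj_on g (carrier X) \<longrightarrow>
        (\<exists>k\<in>module_hom A Y I. \<forall>x\<in>carrier X. k (g x) = h x))"

definition injective_envelope ::
    "('a, 'r) ring_scheme \<Rightarrow> ('a, 'm) module \<Rightarrow> ('a, 'n) module \<Rightarrow> ('m \<Rightarrow> 'n) \<Rightarrow> bool" where
  "injective_envelope A M I f \<longleftrightarrow> injective_module A I \<and> f \<in> module_hom A M I \<and>
     inj_on f (carrier M) \<and> essential_submodule A (f ` carrier M) I"

definition torsionless :: "('a, 'r) ring_scheme \<Rightarrow> ('a, 'm) module \<Rightarrow> bool" where
  "torsionless A M \<longleftrightarrow>
     (\<exists>P\<in>mod_cat A. projective_module A P \<and> (\<exists>f\<in>module_hom A M P. inj_on f (carrier M)))"


section \<open>Artin algebras and the canonical duality\<close>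

definition artinian_cring :: "('r, 'x) ring_scheme \<Rightarrow> bool" where
  "artinian_cring R \<longleftrightarrow> cring R \<and>
     (\<forall>I :: nat \<Rightarrow> 'r set. (\<forall>i. ideal (I i) R) \<and> (\<forall>i. I (Suc i) \<subseteq> I i) \<longrightarrow>
        (\<exists>k. \<forall>i\<ge>k. I i = I k))"

text \<open>
  The record \<^term>\<open>A\<close> carries both the ring structure of the algebra and, through
  \<^const>\<open>smult\<close>, its structure of an \<^term>\<open>R\<close>-module.
\<close>

locale artin_algebra = Module.module R A + A?: ring A
    for R :: "('r, 'x) ring_scheme" (structure) and A :: "('r, 'a) module" (structure) +
  assumes artinian: "artinian_cring R"
    and smult_mult_left:
      "\<lbrakk>r \<in> carrier R; x \<in> carrier A; y \<in> carrier A\<rbrakk> \<Longrightarrow> (r \<odot>\<^bsub>A\<^esub> x) \<otimes>\<^bsub>A\<^esub> y = r \<odot>\<^bsub>A\<^esub> (x \<otimes>\<^bsub>A\<^esub> y)"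
    and smult_mult_right:
      "\<lbrakk>r \<in> carrier R; x \<in> carrier A; y \<in> carrier A\<rbrakk> \<Longrightarrow> x \<otimes>\<^bsub>A\<^esub> (r \<odot>\<^bsub>A\<^esub> y) = r \<odot>\<^bsub>A\<^esub> (x \<otimes>\<^bsub>A\<^esub> y)"
    and finitely_generated: "fg_module R A"

text \<open>
  For a commutative ring. The zero ring has no maximal ideal, whence the intersection with the
  carrier.
\<close>

definition jacobson_radical :: "('r, 'x) ring_scheme \<Rightarrow> 'r set" where
  "jacobson_radical R = carrier R \<inter> \<Inter>{I. maximalideal I R}"

text \<open>
  The canonical duality is $D = \mathrm{Hom}_R(-, J)$ with $J$ an injective envelope of
  $R/\mathrm{rad}\,R$. The right action of the algebra on itself becomes the left action
  $(a f)(x) = f(x a)$ on $D(A_A)$.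
\<close>

definition dual_regular ::
    "('r, 'x) ring_scheme \<Rightarrow> ('r, 'a) module \<Rightarrow> ('r, 'e) module \<Rightarrow> ('a, 'a \<Rightarrow> 'e) module" where
  "dual_regular R A J = \<lparr>carrier = module_hom R A J, mult = undefined, one = undefined,
     zero = (\<lambda>x\<in>carrier A. \<zero>\<^bsub>J\<^esub>),
     add = (\<lambda>f g. \<lambda>x\<in>carrier A. f x \<oplus>\<^bsub>J\<^esub> g x),
     smult = (\<lambda>a f. \<lambda>x\<in>carrier A. f (x \<otimes>\<^bsub>A\<^esub> a))\<rparr>"


section \<open>Resolutions\<close>

text \<open>
  The differentials are \<open>d (Suc i) : P (Suc i) \<rightarrow> P i\<close> and the augmentation is \<open>e : P 0 \<rightarrow> Z\<close>;
  the value \<open>d 0\<close> is not used. Dually for coresolutions, where \<open>I i\<close> and \<open>d (Suc i)\<close> stand for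
  the module in degree $-i$ and the differential with target in degree $-(i+1)$.
\<close>

definition projective_resolution ::
    "('a, 'r) ring_scheme \<Rightarrow> ('a, 'm) module \<Rightarrow> (nat \<Rightarrow> ('a, 'a univ) module) \<Rightarrow>
     ('a univ \<Rightarrow> 'm) \<Rightarrow> (nat \<Rightarrow> 'a univ \<Rightarrow> 'a univ) \<Rightarrow> bool" where
  "projective_resolution A Z P e d \<longleftrightarrow>
     (\<forall>i. projective_module A (P i)) \<and>
     e \<in> module_hom A (P 0) Z \<and> e ` carrier (P 0) = carrier Z \<and>
     (\<forall>i. d (Suc i) \<in> module_hom A (P (Suc i)) (P i)) \<and>
     d 1 ` carrier (P 1) = ker_module (P 0) Z e \<and>
     (\<forall>i. d (Suc (Suc i)) ` carrier (P (Suc (Suc i))) = ker_module (P (Suc i)) (P i) (d (Suc i)))"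

definition minimal_projective_resolution ::
    "('a, 'r) ring_scheme \<Rightarrow> ('a, 'm) module \<Rightarrow> (nat \<Rightarrow> ('a, 'a univ) module) \<Rightarrow>
     ('a univ \<Rightarrow> 'm) \<Rightarrow> (nat \<Rightarrow> 'a univ \<Rightarrow> 'a univ) \<Rightarrow> bool" where
  "minimal_projective_resolution A Z P e d \<longleftrightarrow> projective_resolution A Z P e d \<and>
     superfluous_submodule A (ker_module (P 0) Z e) (P 0) \<and>
     (\<forall>i. superfluous_submodule A (ker_module (P (Suc i)) (P i) (d (Suc i))) (P (Suc i)))"

definition injective_coresolution ::
    "('a, 'r) ring_scheme \<Rightarrow> ('a, 'm) module \<Rightarrow> (nat \<Rightarrow> ('a, 'a univ) module) \<Rightarrow>
     ('m \<Rightarrow> 'a univ) \<Rightarrow> (nat \<Rightarrow> 'a univ \<Rightarrow> 'a univ) \<Rightarrow> bool" where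
  "injective_coresolution A Z I e d \<longleftrightarrow>
     (\<forall>i. injective_module A (I i)) \<and>
     e \<in> module_hom A Z (I 0) \<and> inj_on e (carrier Z) \<and>
     (\<forall>i. d (Suc i) \<in> module_hom A (I i) (I (Suc i))) \<and>
     e ` carrier Z = ker_module (I 0) (I 1) (d 1) \<and>
     (\<forall>i. d (Suc i) ` carrier (I i) = ker_module (I (Suc i)) (I (Suc (Suc i))) (d (Suc (Suc i))))"

definition minimal_injective_coresolution ::
    "('a, 'r) ring_scheme \<Rightarrow> ('a, 'm) module \<Rightarrow> (nat \<Rightarrow> ('a, 'a univ) module) \<Rightarrow>
     ('m \<Rightarrow> 'a univ) \<Rightarrow> (nat \<Rightarrow> 'a univ \<Rightarrow> 'a univ) \<Rightarrow> bool" where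
  "minimal_injective_coresolution A Z I e d \<longleftrightarrow> injective_coresolution A Z I e d \<and>
     essential_submodule A (e ` carrier Z) (I 0) \<and>
     (\<forall>i. essential_submodule A (d (Suc i) ` carrier (I i)) (I (Suc i)))"


section \<open>The first extension group\<close>

definition hom_group ::
    "('a, 'r) ring_scheme \<Rightarrow> ('a, 'm) module \<Rightarrow> ('a, 'n) module \<Rightarrow> ('m \<Rightarrow> 'n) monoid" where
  "hom_group A M N = \<lparr>carrier = module_hom A M N,
     mult = (\<lambda>f g. \<lambda>x\<in>carrier M. f x \<oplus>\<^bsub>N\<^esub> g x), one = (\<lambda>x\<in>carrier M. \<zero>\<^bsub>N\<^esub>)\<rparr>"

text \<open>The first cohomology group of the complex $\mathrm{Hom}(P_\bullet, X)$.\<close>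

definition Ext1_via ::
    "('a, 'r) ring_scheme \<Rightarrow> (nat \<Rightarrow> ('a, 'p) module) \<Rightarrow> (nat \<Rightarrow> 'p \<Rightarrow> 'p) \<Rightarrow> ('a, 'x) module \<Rightarrow>
     ('p \<Rightarrow> 'x) set monoid" where
  "Ext1_via A P d X =
     (hom_group A (P 1) X)
       \<lparr>carrier := {f \<in> module_hom A (P 1) X. \<forall>x\<in>carrier (P 2). f (d 2 x) = \<zero>\<^bsub>X\<^esub>}\<rparr>
     Mod {compose (carrier (P 1)) g (d 1) | g. g \<in> module_hom A (P 0) X}"

definition Ext1 ::
    "('a, 'r) ring_scheme \<Rightarrow> ('a, 'm) module \<Rightarrow> ('a, 'x) module \<Rightarrow> ('a univ \<Rightarrow> 'x) set monoid" where
  "Ext1 A Z X = (case (SOME (P, d). \<exists>e. projective_resolution A Z P e d) of (P, d) \<Rightarrow> Ext1_via A P d X)"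

definition perp1 :: "('a, 'r) ring_scheme \<Rightarrow> ('a, 'x) module set \<Rightarrow> ('a, 'm) module set" where
  "perp1 A \<X> = {Z. fg_module A Z \<and> (\<forall>X\<in>\<X>. carrier (Ext1 A Z X) = {\<one>\<^bsub>Ext1 A Z X\<^esub>})}"


section \<open>The agemo quiver\<close>

definition left_proj_approx ::
    "('a, 'r) ring_scheme \<Rightarrow> ('a, 'm) module \<Rightarrow> ('a, 'n) module \<Rightarrow> ('m \<Rightarrow> 'n) \<Rightarrow> bool" where
  "left_proj_approx A M Q f \<longleftrightarrow> projective_module A Q \<and> f \<in> module_hom A M Q \<and>
     (\<forall>P\<in>mod_cat A. projective_module A P \<longrightarrow>
        (\<forall>g\<in>module_hom A M P. \<exists>h\<in>module_hom A Q P. \<forall>x\<in>carrier M. g x = h (f x)))"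

definition minimal_left_proj_approx ::
    "('a, 'r) ring_scheme \<Rightarrow> ('a, 'm) module \<Rightarrow> ('a, 'n) module \<Rightarrow> ('m \<Rightarrow> 'n) \<Rightarrow> bool" where
  "minimal_left_proj_approx A M Q f \<longleftrightarrow> left_proj_approx A M Q f \<and>
     (\<forall>t\<in>module_hom A Q Q. (\<forall>x\<in>carrier M. t (f x) = f x) \<longrightarrow> bij_betw t (carrier Q) (carrier Q))"

text \<open>\<open>is_mho A M N\<close> says $N \cong \mho M$; the cokernel is determined by $M$ up to isomorphism.\<close>

definition is_mho :: "('a, 'r) ring_scheme \<Rightarrow> ('a, 'm) module \<Rightarrow> ('a, 'n) module \<Rightarrow> bool" where
  "is_mho A M N \<longleftrightarrow>
     (\<exists>Q\<in>mod_cat A. \<exists>f. minimal_left_proj_approx A M Q f \<and> module_iso A N (coker_module M Q f))"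

definition iso_class :: "('a, 'r) ring_scheme \<Rightarrow> ('a, 'm) module \<Rightarrow> ('a, 'a univ) module set" where
  "iso_class A M = {N \<in> mod_cat A. module_iso A M N}"

definition mho_vertices :: "('a, 'r) ring_scheme \<Rightarrow> ('a, 'a univ) module set set" where
  "mho_vertices A =
     {iso_class A M | M. M \<in> mod_cat A \<and> indecomposable_module A M \<and> \<not> projective_module A M}"

text \<open>At most one arrow joins two vertices, so the arrows form a relation.\<close>

definition mho_arrows ::
    "('a, 'r) ring_scheme \<Rightarrow> (('a, 'a univ) module set \<times> ('a, 'a univ) module set) set" where
  "mho_arrows A = {(iso_class A N, iso_class A M) | N M.
     N \<in> mod_cat A \<and> indecomposable_module A N \<and> \<not> projective_module A N \<and>
     M \<in> mod_cat A \<and> indecomposable_module A M \<and> \<not> projective_module A M \<and>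
     torsionless A M \<and> is_mho A M N}"

text \<open>
  Only the first \<open>t\<close> steps of the sequence \<open>p\<close> matter; for \<open>t = \<infinity>\<close> these are all of them. A path
  ending at a vertex is listed backwards.
\<close>

definition mho_path_from :: "('a, 'r) ring_scheme \<Rightarrow> ('a, 'a univ) module set \<Rightarrow> enat \<Rightarrow> bool" where
  "mho_path_from A v t \<longleftrightarrow> v \<in> mho_vertices A \<and>
     (\<exists>p. p 0 = v \<and> (\<forall>i. enat i < t \<longrightarrow> (p i, p (Suc i)) \<in> mho_arrows A))"

definition mho_path_to :: "('a, 'r) ring_scheme \<Rightarrow> ('a, 'a univ) module set \<Rightarrow> enat \<Rightarrow> bool" where
  "mho_path_to A v t \<longleftrightarrow> v \<in> mho_vertices A \<and>
     (\<exists>p. p 0 = v \<and> (\<forall>i. enat i < t \<longrightarrow> (p (Suc i), p i) \<in> mho_arrows A))"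

end

theory Submission
  imports Defs
begin

text \<open>
  Choose a short exact sequence $0 \to X \to Q \to Y \to 0$ with $Q$ projective. If
  $\mathrm{Ext}^1(Y, \Lambda) = 0$, then $X \to Q$ is a left approximation. If the sequence is moreover
  minimal, then $Y \cong \mho X$, and Fitting's lemma shows that $X$ is indecomposable non-projective
  if and only if $Y$ is. So an arrow starts at $[Y]$ exactly when $\mathrm{Ext}^1(Y, \Lambda) = 0$, and an
  arrow ends at $[X]$ exactly when $X$ is torsionless. Since $D(\Lambda)$ is an injective cogenerator, $X$
  is torsionless exactly when all maps $X \to D(\Lambda)$ lift to $P_0$; if
  $\mathrm{Ext}^1(X, \Lambda) = 0$, this says that $\mathrm{Ext}^1(X, K_1) = 0$. Along an arrow,
  $\mathrm{Ext}^1(Y, L_{-i-1})$ vanishes exactly when $\mathrm{Ext}^1(X, L_{-i})$ does, and, if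
  $\mathrm{Ext}^1(X, \Lambda) = 0$, $\mathrm{Ext}^1(X, K_{i+1})$ vanishes exactly when
  $\mathrm{Ext}^1(Y, K_i)$ does; the theorem follows by induction along the paths.
\<close>

section \<open>Homomorphisms and submodules\<close>

text \<open>Two choices shape the development. \<open>Ext1\<close> is the cohomology of a resolution
  picked by Hilbert choice, so it is replaced at once by an extension problem:
  \<open>extends_along\<close> says that every map from \<open>K\<close> to \<open>X\<close> factors
  through \<open>K\<close> -> \<open>P\<close>. If \<open>K\<close> is the kernel of a projective
  presentation, this is the vanishing of Ext^1; for \<open>X\<close> the regular module, it says
  that \<open>K\<close> -> \<open>P\<close> is a left approximation. Both halves of the argument
  thus speak about one condition. Minimal approximations and covers come from direct summands that
  are minimal under inclusion, in place of the radical of the algebra and the Krull-Schmidt theorem.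
  This costs both chain conditions, whereas the hypotheses supply only the descending one for ideals
  of \<open>R\<close>; the ascending one has to be recovered from \<open>J\<close>. The condition m
  \<noteq> 0 puts the algebra itself among the test modules, so Ext^1(M, \<Lambda>) = 0 is available
  when arrows ending at [M] are studied. Going backwards along a path, each further vertex has the
  same vanishing because an arrow starts there.\<close>

lemma hom_closed: "f \<in> module_hom A M N \<Longrightarrow> x \<in> carrier M \<Longrightarrow> f x \<in> carrier N"
  by (auto simp: module_hom_def)

lemma hom_add: "f \<in> module_hom A M N \<Longrightarrow> x \<in> carrier M \<Longrightarrow> y \<in> carrier M \<Longrightarrow> f (x \<oplus>\<^bsub>M\<^esub> y) = f x \<oplus>\<^bsub>N\<^esub> f y"
  by (auto simp: module_hom_def)

lemma hom_smult: "f \<in> module_hom A M N \<Longrightarrow> a \<in> carrier A \<Longrightarrow> x \<in> carrier M \<Longrightarrow> f (a \<odot>\<^bsub>M\<^esub> x) = a \<odot>\<^bsub>N\<^esub> f x"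
  by (auto simp: module_hom_def)

lemma hom_eqI:
  assumes "f \<in> module_hom A M N" "g \<in> module_hom A M N" "\<And>x. x \<in> carrier M \<Longrightarrow> f x = g x"
  shows "f = g"
  using assms by (auto simp: module_hom_def intro: PiE_ext)

text \<open>Homomorphisms are undefined off the carrier, so a formula has to be restricted before it
  can be one. That \<open>M\<close> is a module keeps sums and multiples inside the carrier, where
  the restriction is invisible.\<close>

lemma hom_restrictI:
  assumes M: "left_module A M"
    and "\<And>x. x \<in> carrier M \<Longrightarrow> f x \<in> carrier N"
    and "\<And>x y. x \<in> carrier M \<Longrightarrow> y \<in> carrier M \<Longrightarrow> f (x \<oplus>\<^bsub>M\<^esub> y) = f x \<oplus>\<^bsub>N\<^esub> f y"
    and "\<And>a x. a \<in> carrier A \<Longrightarrow> x \<in> carrier M \<Longrightarrow> f (a \<odot>\<^bsub>M\<^esub> x) = a \<odot>\<^bsub>N\<^esub> f x"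
  shows "(\<lambda>x\<in>carrier M. f x) \<in> module_hom A M N"
proof -
  interpret left_module A M by fact
  show ?thesis using assms by (auto simp: module_hom_def)
qed

lemma hom_zero:
  assumes "left_module A M" "left_module A N" "f \<in> module_hom A M N"
  shows "f \<zero>\<^bsub>M\<^esub> = \<zero>\<^bsub>N\<^esub>"
proof -
  interpret M: left_module A M by fact
  interpret N: left_module A N by fact
  show ?thesis
    using hom_smult[OF assms(3), of "\<zero>\<^bsub>A\<^esub>" "\<zero>\<^bsub>M\<^esub>"] hom_closed[OF assms(3), of "\<zero>\<^bsub>M\<^esub>"]
    by (simp add: M.smult_zero_left N.smult_zero_left)
qed

lemma hom_minus:
  assumes "left_module A M" "left_module A N" "f \<in> module_hom A M N" "x \<in> carrier M"
  shows "f (\<ominus>\<^bsub>M\<^esub> x) = \<ominus>\<^bsub>N\<^esub> f x"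
proof -
  interpret M: left_module A M by fact
  interpret N: left_module A N by fact
  show ?thesis
    using hom_smult[OF assms(3), of "\<ominus>\<^bsub>A\<^esub> \<one>\<^bsub>A\<^esub>" x] assms(4) hom_closed[OF assms(3,4)]
    by (simp add: M.smult_minus_one N.smult_minus_one)
qed

lemma hom_diff:
  assumes "left_module A M" "left_module A N" "f \<in> module_hom A M N" "x \<in> carrier M" "y \<in> carrier M"
  shows "f (x \<ominus>\<^bsub>M\<^esub> y) = f x \<ominus>\<^bsub>N\<^esub> f y"
proof -
  interpret M: left_module A M by fact
  interpret N: left_module A N by fact
  show ?thesis
    using assms(4,5) by (simp add: a_minus_def hom_add[OF assms(3)] hom_minus[OF assms(1-3)])
qed

lemma hom_id: "left_module A M \<Longrightarrow> (\<lambda>x\<in>carrier M. x) \<in> module_hom A M M"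
  by (rule hom_restrictI) auto

lemma hom_comp:
  assumes "left_module A M" and f: "f \<in> module_hom A M N" and g: "g \<in> module_hom A N P"
  shows "(\<lambda>x\<in>carrier M. g (f x)) \<in> module_hom A M P"
  using assms(1)
  by (rule hom_restrictI) (simp_all add: hom_closed[OF f] hom_closed[OF g] hom_add[OF f] hom_add[OF g]
      hom_smult[OF f] hom_smult[OF g])

lemma hom_plus:
  assumes "left_module A M" "left_module A N" and f: "f \<in> module_hom A M N" and g: "g \<in> module_hom A M N"
  shows "(\<lambda>x\<in>carrier M. f x \<oplus>\<^bsub>N\<^esub> g x) \<in> module_hom A M N"
proof -
  interpret N: left_module A N by fact
  show ?thesis
    using assms(1)
    by (rule hom_restrictI) (simp_all add: hom_closed[OF f] hom_closed[OF g] hom_add[OF f] hom_add[OF g]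
      hom_smult[OF f] hom_smult[OF g] N.smult_r_distr N.a_ac)
qed

lemma hom_const_zero:
  assumes "left_module A M" "left_module A N"
  shows "(\<lambda>x\<in>carrier M. \<zero>\<^bsub>N\<^esub>) \<in> module_hom A M N"
proof -
  interpret N: left_module A N by fact
  show ?thesis using assms(1) by (rule hom_restrictI) (simp_all add: N.smult_zero_right)
qed

lemma (in left_module) minus_add_distrib:
  assumes "x \<in> carrier M" "y \<in> carrier M" "z \<in> carrier M" "w \<in> carrier M"
  shows "(x \<oplus>\<^bsub>M\<^esub> y) \<ominus>\<^bsub>M\<^esub> (z \<oplus>\<^bsub>M\<^esub> w) = (x \<ominus>\<^bsub>M\<^esub> z) \<oplus>\<^bsub>M\<^esub> (y \<ominus>\<^bsub>M\<^esub> w)"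
  using assms by (simp add: a_minus_def M.minus_add M.a_ac)

lemma (in left_module) smult_minus_right:
  assumes "a \<in> carrier R" "x \<in> carrier M"
  shows "a \<odot>\<^bsub>M\<^esub> (\<ominus>\<^bsub>M\<^esub> x) = \<ominus>\<^bsub>M\<^esub> (a \<odot>\<^bsub>M\<^esub> x)"
proof -
  have "(a \<odot>\<^bsub>M\<^esub> (\<ominus>\<^bsub>M\<^esub> x)) \<oplus>\<^bsub>M\<^esub> (a \<odot>\<^bsub>M\<^esub> x) = \<zero>\<^bsub>M\<^esub>"
    using assms smult_r_distr[of a "\<ominus>\<^bsub>M\<^esub> x" x] by (simp add: M.l_neg smult_zero_right)
  then show ?thesis using assms by (intro M.minus_equality[symmetric]) auto
qed

lemma (in left_module) smult_diff:
  assumes "a \<in> carrier R" "x \<in> carrier M" "y \<in> carrier M"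
  shows "a \<odot>\<^bsub>M\<^esub> (x \<ominus>\<^bsub>M\<^esub> y) = a \<odot>\<^bsub>M\<^esub> x \<ominus>\<^bsub>M\<^esub> a \<odot>\<^bsub>M\<^esub> y"
  using assms by (simp add: a_minus_def smult_r_distr smult_minus_right)

lemma (in left_module) diff_add_cancel:
  assumes "x \<in> carrier M" "y \<in> carrier M"
  shows "(x \<ominus>\<^bsub>M\<^esub> y) \<oplus>\<^bsub>M\<^esub> y = x" "y \<oplus>\<^bsub>M\<^esub> (x \<ominus>\<^bsub>M\<^esub> y) = x"
    "(x \<oplus>\<^bsub>M\<^esub> y) \<ominus>\<^bsub>M\<^esub> y = x" "(x \<oplus>\<^bsub>M\<^esub> y) \<ominus>\<^bsub>M\<^esub> x = y"
  using assms
     apply (simp_all add: a_minus_def M.a_assoc M.l_neg M.r_neg)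
   apply (metis M.a_comm M.add.inv_closed M.r_neg2)
  by (metis M.a_comm M.a_assoc M.add.inv_closed M.r_neg2 M.add.m_closed)

lemma (in left_module) diff_eq_zero_iff [simp]:
  assumes "x \<in> carrier M" "y \<in> carrier M"
  shows "x \<ominus>\<^bsub>M\<^esub> y = \<zero>\<^bsub>M\<^esub> \<longleftrightarrow> x = y"
  using assms diff_add_cancel(1)[of x y] by (auto simp: a_minus_def M.r_neg)

lemma hom_minus_hom:
  assumes "left_module A M" "left_module A N" and f: "f \<in> module_hom A M N" and g: "g \<in> module_hom A M N"
  shows "(\<lambda>x\<in>carrier M. f x \<ominus>\<^bsub>N\<^esub> g x) \<in> module_hom A M N"
proof -
  interpret N: left_module A N by fact
  show ?thesis
    using assms(1)
    by (rule hom_restrictI) (simp_all add: hom_closed[OF f] hom_closed[OF g] hom_add[OF f] hom_add[OF g]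
      hom_smult[OF f] hom_smult[OF g] N.smult_diff N.minus_add_distrib)
qed

lemma hom_inj_iff:
  assumes "left_module A M" "left_module A N" "f \<in> module_hom A M N"
  shows "inj_on f (carrier M) \<longleftrightarrow> ker_module M N f = {\<zero>\<^bsub>M\<^esub>}"
proof -
  interpret M: left_module A M by fact
  interpret N: left_module A N by fact
  have "x = y" if "ker_module M N f = {\<zero>\<^bsub>M\<^esub>}" "x \<in> carrier M" "y \<in> carrier M" "f x = f y" for x y
  proof -
    have "f (x \<ominus>\<^bsub>M\<^esub> y) = f y \<ominus>\<^bsub>N\<^esub> f y"
      using hom_diff[OF assms that(2,3)] that(4) by simp
    then have "x \<ominus>\<^bsub>M\<^esub> y \<in> ker_module M N f"
      using that(2,3) hom_closed[OF assms(3) that(3)] by (simp add: ker_module_def)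
    then show ?thesis using that by simp
  qed
  then have "inj_on f (carrier M)" if "ker_module M N f = {\<zero>\<^bsub>M\<^esub>}" using that by (intro inj_onI)
  moreover have "ker_module M N f = {\<zero>\<^bsub>M\<^esub>}" if inj: "inj_on f (carrier M)"
  proof -
    have "x = \<zero>\<^bsub>M\<^esub>" if "x \<in> carrier M" "f x = \<zero>\<^bsub>N\<^esub>" for x
      using inj_onD[OF inj _ that(1) M.zero_closed] that(2) hom_zero[OF assms] by simp
    then show ?thesis using hom_zero[OF assms] unfolding ker_module_def by blast
  qed
  ultimately show ?thesis by blast
qed

section \<open>Submodules, kernels, images and preimages\<close>

lemma submodule_subset: "submodule H A M \<Longrightarrow> H \<subseteq> carrier M"
  by (metis partial_object.select_convs(1) submodule_def subgroup.subset)

lemma submodule_zero: "submodule H A M \<Longrightarrow> \<zero>\<^bsub>M\<^esub> \<in> H"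
  by (metis monoid.select_convs(2) submodule_def subgroup.one_closed)

lemma submodule_add: "submodule H A M \<Longrightarrow> x \<in> H \<Longrightarrow> y \<in> H \<Longrightarrow> x \<oplus>\<^bsub>M\<^esub> y \<in> H"
  by (metis monoid.select_convs(1) submodule_def subgroup.m_closed)

lemma submodule_smult: "submodule H A M \<Longrightarrow> a \<in> carrier A \<Longrightarrow> x \<in> H \<Longrightarrow> a \<odot>\<^bsub>M\<^esub> x \<in> H"
  by (rule submodule.smult_closed)

lemma submodule_minus: "submodule H A M \<Longrightarrow> x \<in> H \<Longrightarrow> \<ominus>\<^bsub>M\<^esub> x \<in> H"
  by (metis a_inv_def submodule_def subgroup.m_inv_closed)

lemma submodule_diff: "submodule H A M \<Longrightarrow> x \<in> H \<Longrightarrow> y \<in> H \<Longrightarrow> x \<ominus>\<^bsub>M\<^esub> y \<in> H"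
  by (simp add: a_minus_def submodule_add submodule_minus)

text \<open>Sums and multiples suffice as closure conditions: negatives come from scaling by minus
  one.\<close>

lemma submodule_intro:
  assumes "left_module A M" "H \<subseteq> carrier M" "\<zero>\<^bsub>M\<^esub> \<in> H"
    "\<And>x y. x \<in> H \<Longrightarrow> y \<in> H \<Longrightarrow> x \<oplus>\<^bsub>M\<^esub> y \<in> H"
    "\<And>a x. a \<in> carrier A \<Longrightarrow> x \<in> H \<Longrightarrow> a \<odot>\<^bsub>M\<^esub> x \<in> H"
  shows "submodule H A M"
proof -
  interpret left_module A M by fact
  have "\<ominus>\<^bsub>M\<^esub> x \<in> H" if "x \<in> H" for x
    using assms(5)[of "\<ominus>\<^bsub>A\<^esub> \<one>\<^bsub>A\<^esub>" x] that assms(2) by (auto simp: smult_minus_one subset_eq)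
  then show ?thesis
    using assms by (intro submodule.intro M.add.subgroupI submodule_axioms.intro) (auto simp flip: a_inv_def)
qed

text \<open>All module laws are inherited through \<open>p\<close>, since every element of
  \<open>N\<close> is the image of an element of \<open>M\<close>. This spares calculations with
  representatives in quotient modules.\<close>

lemma left_module_surj:
  assumes M: "left_module A M" and p: "p ` carrier M = carrier N"
    and add: "\<And>x y. x \<in> carrier M \<Longrightarrow> y \<in> carrier M \<Longrightarrow> p x \<oplus>\<^bsub>N\<^esub> p y = p (x \<oplus>\<^bsub>M\<^esub> y)"
    and smult: "\<And>a x. a \<in> carrier A \<Longrightarrow> x \<in> carrier M \<Longrightarrow> a \<odot>\<^bsub>N\<^esub> p x = p (a \<odot>\<^bsub>M\<^esub> x)"
    and zero: "\<zero>\<^bsub>N\<^esub> = p \<zero>\<^bsub>M\<^esub>"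
  shows "left_module A N"
proof -
  interpret left_module A M by fact
  have el: "\<exists>x\<in>carrier M. y = p x" if "y \<in> carrier N" for y using that p by auto
  have cl: "p x \<in> carrier N" if "x \<in> carrier M" for x using that p by auto
  interpret N: abelian_group N
  proof (rule abelian_groupI)
    fix x assume "x \<in> carrier N"
    then obtain u where u: "u \<in> carrier M" "x = p u" using el by blast
    show "\<exists>y\<in>carrier N. y \<oplus>\<^bsub>N\<^esub> x = \<zero>\<^bsub>N\<^esub>"
      using u by (intro bexI[of _ "p (\<ominus>\<^bsub>M\<^esub> u)"]) (auto simp: add zero M.l_neg cl)
  qed (auto dest!: el simp: cl add zero M.a_ac)
  show ?thesis
    by unfold_locales (auto dest!: el simp: cl add smult smult_l_distr smult_r_distr smult_assoc1)
qed

lemma submodule_left_module: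
  assumes M: "left_module A M" and H: "submodule H A M"
  shows "left_module A (M\<lparr>carrier := H\<rparr>)"
proof -
  interpret left_module A M by fact
  have sub: "x \<in> carrier M" if "x \<in> H" for x using that submodule_subset[OF H] by blast
  interpret N: abelian_group "M\<lparr>carrier := H\<rparr>"
  proof (rule abelian_groupI)
    fix x assume "x \<in> carrier (M\<lparr>carrier := H\<rparr>)"
    then show "\<exists>y\<in>carrier (M\<lparr>carrier := H\<rparr>). y \<oplus>\<^bsub>M\<lparr>carrier := H\<rparr>\<^esub> x = \<zero>\<^bsub>M\<lparr>carrier := H\<rparr>\<^esub>"
      by (intro bexI[of _ "\<ominus>\<^bsub>M\<^esub> x"]) (auto simp: M.l_neg sub submodule_minus[OF H])
  qed (auto simp: sub submodule_add[OF H] submodule_zero[OF H] M.a_ac)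
  show ?thesis
    by unfold_locales (auto simp: sub submodule_smult[OF H] smult_l_distr smult_r_distr smult_assoc1)
qed

lemma submodule_of_submodule:
  assumes M: "left_module A M" and H: "submodule H A M"
  shows "submodule U A (M\<lparr>carrier := H\<rparr>) \<longleftrightarrow> submodule U A M \<and> U \<subseteq> H"
proof -
  have "submodule U A M" if "submodule U A (M\<lparr>carrier := H\<rparr>)"
    using submodule_subset[OF that] submodule_zero[OF that] submodule_add[OF that] submodule_smult[OF that]
      submodule_subset[OF H] by (intro submodule_intro[OF M]) auto
  moreover have "submodule U A (M\<lparr>carrier := H\<rparr>)" if U: "submodule U A M" "U \<subseteq> H"
    using U(2) submodule_zero[OF U(1)] submodule_add[OF U(1)] submodule_smult[OF U(1)]
    by (intro submodule_intro[OF submodule_left_module[OF M H]]) auto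
  ultimately show ?thesis using submodule_subset by fastforce
qed

lemma hom_incl:
  assumes "left_module A M" "submodule H A M"
  shows "(\<lambda>x\<in>H. x) \<in> module_hom A (M\<lparr>carrier := H\<rparr>) M"
  using hom_restrictI[OF submodule_left_module[OF assms], of "\<lambda>x. x" M] submodule_subset[OF assms(2)] by auto

lemma hom_restrict:
  assumes "left_module A M" "submodule H A M" "f \<in> module_hom A M N"
  shows "(\<lambda>x\<in>H. f x) \<in> module_hom A (M\<lparr>carrier := H\<rparr>) N"
  using hom_comp[OF submodule_left_module[OF assms(1,2)] hom_incl[OF assms(1,2)] assms(3)]
  by (simp add: restrict_def if_distrib cong: if_cong)

lemma hom_codom:
  assumes "f \<in> module_hom A M N" "f ` carrier M \<subseteq> H"
  shows "f \<in> module_hom A M (N\<lparr>carrier := H\<rparr>)"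
  using assms by (auto simp: module_hom_def PiE_def Pi_def)

lemma hom_codomD:
  assumes "f \<in> module_hom A M (N\<lparr>carrier := H\<rparr>)" "H \<subseteq> carrier N"
  shows "f \<in> module_hom A M N"
  using assms by (auto simp: module_hom_def PiE_def Pi_def)

lemma ker_submodule:
  assumes "left_module A M" "left_module A N" "f \<in> module_hom A M N"
  shows "submodule (ker_module M N f) A M"
proof -
  interpret M: left_module A M by fact
  interpret N: left_module A N by fact
  show ?thesis
    using hom_zero[OF assms] by (intro submodule_intro[OF assms(1)])
      (auto simp: ker_module_def hom_add[OF assms(3)] hom_smult[OF assms(3)] N.smult_zero_right)
qed

lemma image_submodule:
  assumes "left_module A M" "left_module A N" and f: "f \<in> module_hom A M N" and H: "submodule H A M"
  shows "submodule (f ` H) A N"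
proof -
  interpret M: left_module A M by fact
  interpret N: left_module A N by fact
  have sub: "x \<in> carrier M" if "x \<in> H" for x using that submodule_subset[OF H] by blast
  show ?thesis
  proof (rule submodule_intro[OF assms(2)])
    show "\<zero>\<^bsub>N\<^esub> \<in> f ` H" using hom_zero[OF assms(1-3)] submodule_zero[OF H] by force
    show "x \<oplus>\<^bsub>N\<^esub> y \<in> f ` H" if "x \<in> f ` H" "y \<in> f ` H" for x y
      using that by (auto simp: sub hom_add[OF f, symmetric] submodule_add[OF H])
    show "a \<odot>\<^bsub>N\<^esub> x \<in> f ` H" if "a \<in> carrier A" "x \<in> f ` H" for a x
      using that by (auto simp: sub hom_smult[OF f, symmetric] submodule_smult[OF H])
  qed (use sub hom_closed[OF f] in auto)
qed

lemma carrier_submodule: "left_module A M \<Longrightarrow> submodule (carrier M) A M"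
proof -
  assume "left_module A M"
  then interpret left_module A M .
  show ?thesis by (rule submodule_intro) (auto simp: left_module_axioms)
qed

lemma zero_submodule: "left_module A M \<Longrightarrow> submodule {\<zero>\<^bsub>M\<^esub>} A M"
proof -
  assume "left_module A M"
  then interpret left_module A M .
  show ?thesis by (rule submodule_intro) (auto simp: left_module_axioms smult_zero_right)
qed

lemma vimage_submodule:
  assumes "left_module A M" "left_module A N" and f: "f \<in> module_hom A M N" and H: "submodule H A N"
  shows "submodule {x \<in> carrier M. f x \<in> H} A M"
proof -
  interpret M: left_module A M by fact
  show ?thesis
    using hom_zero[OF assms(1-3)] submodule_zero[OF H] submodule_add[OF H] submodule_smult[OF H]
    by (intro submodule_intro[OF assms(1)]) (auto simp: hom_add[OF f] hom_smult[OF f])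
qed

lemma inter_submodule:
  assumes "left_module A M" "submodule H A M" "submodule U A M"
  shows "submodule (H \<inter> U) A M"
  using submodule_subset[OF assms(2)] submodule_zero[OF assms(2)] submodule_zero[OF assms(3)]
    submodule_add[OF assms(2)] submodule_add[OF assms(3)] submodule_smult[OF assms(2)]
    submodule_smult[OF assms(3)]
  by (intro submodule_intro[OF assms(1)]) auto

lemma mem_set_add: "x \<in> H <+>\<^bsub>M\<^esub> U \<longleftrightarrow> (\<exists>h\<in>H. \<exists>u\<in>U. x = h \<oplus>\<^bsub>M\<^esub> u)"
  by (auto simp: set_add_def')

lemma sum_submodule:
  assumes "left_module A M" and H: "submodule H A M" and U: "submodule U A M"
  shows "submodule (H <+>\<^bsub>M\<^esub> U) A M"
proof -
  interpret left_module A M by fact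
  have sub: "x \<in> carrier M" if "x \<in> H \<or> x \<in> U" for x
    using that submodule_subset[OF H] submodule_subset[OF U] by blast
  show ?thesis
  proof (rule submodule_intro[OF assms(1)])
    show "\<zero>\<^bsub>M\<^esub> \<in> H <+>\<^bsub>M\<^esub> U"
      using submodule_zero[OF H] submodule_zero[OF U] by (force simp: mem_set_add)
    fix x y assume "x \<in> H <+>\<^bsub>M\<^esub> U" "y \<in> H <+>\<^bsub>M\<^esub> U"
    then obtain h u h' u' where *: "h \<in> H" "u \<in> U" "h' \<in> H" "u' \<in> U" "x = h \<oplus>\<^bsub>M\<^esub> u" "y = h' \<oplus>\<^bsub>M\<^esub> u'"
      by (auto simp: mem_set_add)
    then have "x \<oplus>\<^bsub>M\<^esub> y = (h \<oplus>\<^bsub>M\<^esub> h') \<oplus>\<^bsub>M\<^esub> (u \<oplus>\<^bsub>M\<^esub> u')" by (simp add: sub M.a_ac)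
    then show "x \<oplus>\<^bsub>M\<^esub> y \<in> H <+>\<^bsub>M\<^esub> U"
      using submodule_add[OF H *(1,3)] submodule_add[OF U *(2,4)] unfolding mem_set_add by blast
  next
    fix a x assume a: "a \<in> carrier A" and "x \<in> H <+>\<^bsub>M\<^esub> U"
    then obtain h u where *: "h \<in> H" "u \<in> U" "x = h \<oplus>\<^bsub>M\<^esub> u" by (auto simp: mem_set_add)
    then show "a \<odot>\<^bsub>M\<^esub> x \<in> H <+>\<^bsub>M\<^esub> U"
      using submodule_smult[OF H a *(1)] submodule_smult[OF U a *(2)] a
      unfolding mem_set_add by (auto simp: sub smult_r_distr)
  qed (auto simp: mem_set_add sub)
qed

text \<open>The set-theoretic section \<open>s\<close> is not linear, but its composition with
  \<open>f\<close> is: two preimages of one element differ by an element of the kernel of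
  \<open>g\<close>, which \<open>f\<close> kills.\<close>

lemma factor_surj:
  assumes P: "left_module A P" and Y: "left_module A Y" and Z: "left_module A Z"
    and g: "g \<in> module_hom A P Y" and surj: "g ` carrier P = carrier Y"
    and f: "f \<in> module_hom A P Z" and ker: "ker_module P Y g \<subseteq> ker_module P Z f"
  shows "\<exists>f'\<in>module_hom A Y Z. \<forall>x\<in>carrier P. f' (g x) = f x"
proof -
  interpret P: left_module A P by fact
  interpret Y: left_module A Y by fact
  interpret Z: left_module A Z by fact
  define s where "s = inv_into (carrier P) g"
  have s: "s y \<in> carrier P" "g (s y) = y" if "y \<in> carrier Y" for y
    using that surj by (auto simp: s_def inv_into_into f_inv_into_f)
  have eq: "f x = f x'" if "x \<in> carrier P" "x' \<in> carrier P" "g x = g x'" for x x'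
  proof -
    have "x \<ominus>\<^bsub>P\<^esub> x' \<in> ker_module P Y g"
      using that hom_diff[OF P Y g, of x x'] hom_closed[OF g, of x'] by (auto simp: ker_module_def)
    then have "f (x \<ominus>\<^bsub>P\<^esub> x') = \<zero>\<^bsub>Z\<^esub>" using ker by (auto simp: ker_module_def)
    then show ?thesis using hom_diff[OF P Z f, of x x'] that hom_closed[OF f] by simp
  qed
  have "(\<lambda>y\<in>carrier Y. f (s y)) \<in> module_hom A Y Z"
  proof (rule hom_restrictI[OF Y])
    fix x y assume "x \<in> carrier Y" "y \<in> carrier Y"
    then show "f (s (x \<oplus>\<^bsub>Y\<^esub> y)) = f (s x) \<oplus>\<^bsub>Z\<^esub> f (s y)"
      using eq[of "s (x \<oplus>\<^bsub>Y\<^esub> y)" "s x \<oplus>\<^bsub>P\<^esub> s y"] by (simp add: s hom_add[OF g] hom_add[OF f])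
  next
    fix a x assume "a \<in> carrier A" "x \<in> carrier Y"
    then show "f (s (a \<odot>\<^bsub>Y\<^esub> x)) = a \<odot>\<^bsub>Z\<^esub> f (s x)"
      using eq[of "s (a \<odot>\<^bsub>Y\<^esub> x)" "a \<odot>\<^bsub>P\<^esub> s x"] by (simp add: s hom_smult[OF g] hom_smult[OF f])
  qed (use s hom_closed[OF f] in auto)
  moreover have "f (s (g x)) = f x" if "x \<in> carrier P" for x
    using that by (intro eq) (auto simp: s hom_closed[OF g])
  ultimately show ?thesis using hom_closed[OF g] by (intro bexI[of _ "\<lambda>y\<in>carrier Y. f (s y)"]) auto
qed

text \<open>The preimage of \<open>f z\<close> under \<open>i\<close> is unique, and uniqueness
  forces the choice of preimages to be linear.\<close>

lemma factor_inj:
  assumes K: "left_module A K" and P: "left_module A P" and Z: "left_module A Z"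
    and i: "i \<in> module_hom A K P" and inj: "inj_on i (carrier K)"
    and f: "f \<in> module_hom A Z P" and img: "f ` carrier Z \<subseteq> i ` carrier K"
  shows "\<exists>f'\<in>module_hom A Z K. \<forall>z\<in>carrier Z. i (f' z) = f z"
proof -
  interpret K: left_module A K by fact
  interpret P: left_module A P by fact
  interpret Z: left_module A Z by fact
  define s where "s = (\<lambda>z. inv_into (carrier K) i (f z))"
  have s: "s z \<in> carrier K" "i (s z) = f z" if "z \<in> carrier Z" for z
    using that img by (auto simp: s_def image_subset_iff inv_into_into f_inv_into_f)
  have "(\<lambda>z\<in>carrier Z. s z) \<in> module_hom A Z K"
  proof (rule hom_restrictI[OF Z])
    fix x y assume "x \<in> carrier Z" "y \<in> carrier Z"
    then show "s (x \<oplus>\<^bsub>Z\<^esub> y) = s x \<oplus>\<^bsub>K\<^esub> s y"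
      by (intro inj_onD[OF inj]) (simp_all add: s hom_add[OF i] hom_add[OF f])
  next
    fix a x assume "a \<in> carrier A" "x \<in> carrier Z"
    then show "s (a \<odot>\<^bsub>Z\<^esub> x) = a \<odot>\<^bsub>K\<^esub> s x"
      by (intro inj_onD[OF inj]) (simp_all add: s hom_smult[OF i] hom_smult[OF f])
  qed (use s in auto)
  then show ?thesis using s by (intro bexI[of _ "\<lambda>z\<in>carrier Z. s z"]) auto
qed

section \<open>Isomorphisms\<close>

lemma iso_inverse:
  assumes M: "left_module A M" and N: "left_module A N"
    and f: "f \<in> module_hom A M N" and bij: "bij_betw f (carrier M) (carrier N)"
  obtains g where "g \<in> module_hom A N M" "bij_betw g (carrier N) (carrier M)"
    "\<And>x. x \<in> carrier M \<Longrightarrow> g (f x) = x" "\<And>y. y \<in> carrier N \<Longrightarrow> f (g y) = y"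
proof -
  obtain g where g: "g \<in> module_hom A N M" "\<And>y. y \<in> carrier N \<Longrightarrow> f (g y) = y"
    using factor_inj[OF M N N f _ hom_id[OF N]] bij by (auto simp: bij_betw_def)
  have "g (f x) = x" if "x \<in> carrier M" for x
    using bij g(2)[of "f x"] that hom_closed[OF g(1)] hom_closed[OF f] by (auto simp: bij_betw_def inj_on_def)
  moreover from this have "bij_betw g (carrier N) (carrier M)"
    using g(2) hom_closed[OF g(1)] hom_closed[OF f]
    by (intro bij_betw_byWitness[where f' = f]) auto
  ultimately show ?thesis using g that by blast
qed

lemma module_iso_refl: "left_module A M \<Longrightarrow> module_iso A M M"
  unfolding module_iso_def by (rule bexI[OF _ hom_id]) (auto simp: bij_betw_def inj_on_def)

lemma module_iso_sym: "left_module A M \<Longrightarrow> left_module A N \<Longrightarrow> module_iso A M N \<Longrightarrow> module_iso A N M"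
  unfolding module_iso_def by (meson iso_inverse)

lemma module_iso_trans:
  assumes "left_module A M" "module_iso A M N" "module_iso A N P"
  shows "module_iso A M P"
proof -
  obtain f g where fg: "f \<in> module_hom A M N" "bij_betw f (carrier M) (carrier N)"
    "g \<in> module_hom A N P" "bij_betw g (carrier N) (carrier P)"
    using assms(2,3) by (auto simp: module_iso_def)
  have "bij_betw (\<lambda>x\<in>carrier M. g (f x)) (carrier M) (carrier P)"
    using bij_betw_trans[OF fg(2,4)] by (simp add: comp_def cong: bij_betw_cong)
  then show ?thesis using hom_comp[OF assms(1) fg(1,3)] unfolding module_iso_def by blast
qed

section \<open>Quotients, direct sums and finite generation\<close>

lemma submodule_additive: "left_module A M \<Longrightarrow> submodule H A M \<Longrightarrow> abelian_subgroup H M"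
  by (intro abelian_subgroupI3 additive_subgroup.intro) (auto simp: left_module_def submodule_def)

context
  fixes A :: "('a, 'r) ring_scheme" and M :: "('a, 'm) module" and H
  assumes M: "left_module A M" and H: "submodule H A M"
begin

interpretation left_module A M by (rule M)
interpretation H: abelian_subgroup H M by (rule submodule_additive[OF M H])

lemma coset_eq_iff:
  assumes "x \<in> carrier M" "y \<in> carrier M"
  shows "H +>\<^bsub>M\<^esub> x = H +>\<^bsub>M\<^esub> y \<longleftrightarrow> x \<ominus>\<^bsub>M\<^esub> y \<in> H"
  using assms H.a_rcos_module[of y x] H.a_rcos_self M.a_repr_independence[OF _ _ H.a_subgroup]
  by (metis a_minus_def)

text \<open>The union in \<open>quot_module\<close> runs over all representatives of a coset. They
  all contribute the same coset because \<open>a\<close> times a difference of representatives lies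
  in \<open>H\<close>, and the union is not empty because \<open>x\<close> represents its own
  coset.\<close>

lemma quot_smult:
  assumes a: "a \<in> carrier A" and x: "x \<in> carrier M"
  shows "a \<odot>\<^bsub>quot_module M H\<^esub> (H +>\<^bsub>M\<^esub> x) = H +>\<^bsub>M\<^esub> (a \<odot>\<^bsub>M\<^esub> x)"
proof -
  have "H +>\<^bsub>M\<^esub> (a \<odot>\<^bsub>M\<^esub> y) = H +>\<^bsub>M\<^esub> (a \<odot>\<^bsub>M\<^esub> x)" if "y \<in> H +>\<^bsub>M\<^esub> x" for y
  proof -
    have y: "y \<in> carrier M" using that x submodule_subset[OF H] by (auto simp: a_r_coset_def')
    have "y \<ominus>\<^bsub>M\<^esub> x \<in> H" using that x y H.a_rcos_module[of x y] by (auto simp: a_minus_def)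
    then have "a \<odot>\<^bsub>M\<^esub> (y \<ominus>\<^bsub>M\<^esub> x) \<in> H" by (rule submodule_smult[OF H a])
    then show ?thesis using a x y by (simp add: coset_eq_iff smult_diff)
  qed
  moreover have "x \<in> H +>\<^bsub>M\<^esub> x" using x by (rule H.a_rcos_self)
  ultimately show ?thesis unfolding quot_module_def module.simps by blast
qed

lemma quot_carrier: "carrier (quot_module M H) = (\<lambda>x. H +>\<^bsub>M\<^esub> x) ` carrier M"
  by (auto simp: quot_module_def A_RCOSETS_def')

lemma quot_add:
  assumes "x \<in> carrier M" "y \<in> carrier M"
  shows "(H +>\<^bsub>M\<^esub> x) \<oplus>\<^bsub>quot_module M H\<^esub> (H +>\<^bsub>M\<^esub> y) = H +>\<^bsub>M\<^esub> (x \<oplus>\<^bsub>M\<^esub> y)"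
  using assms by (simp add: quot_module_def H.a_rcos_sum)

lemma quot_zero: "\<zero>\<^bsub>quot_module M H\<^esub> = H +>\<^bsub>M\<^esub> \<zero>\<^bsub>M\<^esub>"
  using M.a_coset_add_zero submodule_subset[OF H] by (simp add: quot_module_def)

lemma quot_left_module: "left_module A (quot_module M H)"
  using M by (rule left_module_surj) (auto simp: quot_carrier quot_add quot_smult quot_zero)

lemma quot_proj: "(\<lambda>x\<in>carrier M. H +>\<^bsub>M\<^esub> x) \<in> module_hom A M (quot_module M H)"
  using M by (rule hom_restrictI) (auto simp: quot_carrier quot_add quot_smult)

lemma quot_proj_surj: "(\<lambda>x\<in>carrier M. H +>\<^bsub>M\<^esub> x) ` carrier M = carrier (quot_module M H)"
  by (auto simp: quot_carrier)

lemma quot_proj_ker: "ker_module M (quot_module M H) (\<lambda>x\<in>carrier M. H +>\<^bsub>M\<^esub> x) = H"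
proof -
  have "H +>\<^bsub>M\<^esub> x = H +>\<^bsub>M\<^esub> \<zero>\<^bsub>M\<^esub> \<longleftrightarrow> x \<in> H" if "x \<in> carrier M" for x
    using coset_eq_iff[OF that M.zero_closed] that diff_add_cancel(1)[OF that M.zero_closed] by simp
  then show ?thesis
    using submodule_subset[OF H] unfolding ker_module_def quot_zero by (simp del: M.a_coset_add_zero) blast
qed

end

section \<open>External direct sums\<close>

lemma direct_sum_left_module:
  assumes "left_module A M" "left_module A N"
  shows "left_module A (direct_sum_module M N)"
proof -
  interpret M: left_module A M by fact
  interpret N: left_module A N by fact
  interpret abelian_group "direct_sum_module M N"
  proof (rule abelian_groupI)
    fix x assume "x \<in> carrier (direct_sum_module M N)"
    then show "\<exists>y\<in>carrier (direct_sum_module M N). y \<oplus>\<^bsub>direct_sum_module M N\<^esub> x = \<zero>\<^bsub>direct_sum_module M N\<^esub>"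
      by (intro bexI[of _ "(\<ominus>\<^bsub>M\<^esub> fst x, \<ominus>\<^bsub>N\<^esub> snd x)"]) (auto simp: direct_sum_module_def M.l_neg N.l_neg)
  qed (auto simp: direct_sum_module_def M.a_ac N.a_ac)
  show ?thesis
    by unfold_locales (auto simp: direct_sum_module_def M.smult_l_distr M.smult_r_distr M.smult_assoc1
      N.smult_l_distr N.smult_r_distr N.smult_assoc1)
qed

lemma direct_sum_carrier [simp]: "carrier (direct_sum_module M N) = carrier M \<times> carrier N"
  by (simp add: direct_sum_module_def)

lemma direct_sum_zero [simp]: "\<zero>\<^bsub>direct_sum_module M N\<^esub> = (\<zero>\<^bsub>M\<^esub>, \<zero>\<^bsub>N\<^esub>)"
  by (simp add: direct_sum_module_def)

lemma direct_sum_add [simp]: "(x, y) \<oplus>\<^bsub>direct_sum_module M N\<^esub> (x', y') = (x \<oplus>\<^bsub>M\<^esub> x', y \<oplus>\<^bsub>N\<^esub> y')"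
  by (simp add: direct_sum_module_def)

lemma direct_sum_smult [simp]: "a \<odot>\<^bsub>direct_sum_module M N\<^esub> (x, y) = (a \<odot>\<^bsub>M\<^esub> x, a \<odot>\<^bsub>N\<^esub> y)"
  by (simp add: direct_sum_module_def)

context
  fixes A :: "('a, 'r) ring_scheme" and M :: "('a, 'm) module" and N :: "('a, 'n) module"
  assumes M: "left_module A M" and N: "left_module A N"
begin

interpretation M: left_module A M by (rule M)
interpretation N: left_module A N by (rule N)

lemma hom_fst: "(\<lambda>x\<in>carrier M \<times> carrier N. fst x) \<in> module_hom A (direct_sum_module M N) M"
  using hom_restrictI[OF direct_sum_left_module[OF M N], of fst M] by auto

lemma hom_snd: "(\<lambda>x\<in>carrier M \<times> carrier N. snd x) \<in> module_hom A (direct_sum_module M N) N"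
  using hom_restrictI[OF direct_sum_left_module[OF M N], of snd N] by auto

lemma hom_inl: "(\<lambda>x\<in>carrier M. (x, \<zero>\<^bsub>N\<^esub>)) \<in> module_hom A M (direct_sum_module M N)"
  using M by (rule hom_restrictI) (auto simp: N.smult_zero_right)

lemma hom_inr: "(\<lambda>x\<in>carrier N. (\<zero>\<^bsub>M\<^esub>, x)) \<in> module_hom A N (direct_sum_module M N)"
  using N by (rule hom_restrictI) (auto simp: M.smult_zero_right)

lemma hom_pair:
  assumes X: "left_module A X" and f: "f \<in> module_hom A X M" and g: "g \<in> module_hom A X N"
  shows "(\<lambda>x\<in>carrier X. (f x, g x)) \<in> module_hom A X (direct_sum_module M N)"
  using X by (rule hom_restrictI) (auto simp: hom_closed[OF f] hom_closed[OF g] hom_add[OF f] hom_add[OF g]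
      hom_smult[OF f] hom_smult[OF g])

lemma hom_copair:
  assumes X: "left_module A X" and f: "f \<in> module_hom A M X" and g: "g \<in> module_hom A N X"
  shows "(\<lambda>x\<in>carrier M \<times> carrier N. f (fst x) \<oplus>\<^bsub>X\<^esub> g (snd x)) \<in> module_hom A (direct_sum_module M N) X"
proof -
  interpret X: left_module A X by (rule X)
  show ?thesis
    using hom_restrictI[OF direct_sum_left_module[OF M N], of "\<lambda>x. f (fst x) \<oplus>\<^bsub>X\<^esub> g (snd x)" X]
    by (auto simp: hom_closed[OF f] hom_closed[OF g] hom_add[OF f] hom_add[OF g]
      hom_smult[OF f] hom_smult[OF g] X.smult_r_distr X.a_ac)
qed

end

section \<open>Finite generation and the regular module\<close>

lemma fg_left_module: "fg_module A M \<Longrightarrow> left_module A M"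
  by (simp add: fg_module_def)

text \<open>The preimage of a submodule containing the images of the generators contains the
  generators, hence everything.\<close>

lemma fg_surj:
  assumes P: "fg_module A P" and N: "left_module A N" and f: "f \<in> module_hom A P N"
    and surj: "f ` carrier P = carrier N"
  shows "fg_module A N"
proof -
  obtain S where S: "finite S" "S \<subseteq> carrier P" "\<And>H. submodule H A P \<Longrightarrow> S \<subseteq> H \<Longrightarrow> H = carrier P"
    using P by (auto simp: fg_module_def)
  have "H = carrier N" if H: "submodule H A N" "f ` S \<subseteq> H" for H
  proof -
    have "{x \<in> carrier P. f x \<in> H} = carrier P"
      using H S(2) by (intro S(3) vimage_submodule[OF fg_left_module[OF P] N f]) auto
    then have "carrier N \<subseteq> H" unfolding surj[symmetric] by blast
    then show ?thesis using submodule_subset[OF H(1)] by blast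
  qed
  moreover have "f ` S \<subseteq> carrier N" using S(2) surj by auto
  ultimately show ?thesis using N S(1) unfolding fg_module_def by (meson finite_imageI)
qed

text \<open>A submodule containing both sets of generators is pulled back along the two inclusions;
  it contains each summand and therefore all sums.\<close>

lemma fg_direct_sum:
  assumes M: "fg_module A M" and N: "fg_module A N"
  shows "fg_module A (direct_sum_module M N)"
proof -
  note lm = fg_left_module[OF M] fg_left_module[OF N]
  interpret M: left_module A M by (rule lm)
  interpret N: left_module A N by (rule lm)
  note D = direct_sum_left_module[OF lm]
  obtain S where S: "finite S" "S \<subseteq> carrier M" "\<And>H. submodule H A M \<Longrightarrow> S \<subseteq> H \<Longrightarrow> H = carrier M"
    using M by (auto simp: fg_module_def)
  obtain T where T: "finite T" "T \<subseteq> carrier N" "\<And>H. submodule H A N \<Longrightarrow> T \<subseteq> H \<Longrightarrow> H = carrier N"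
    using N by (auto simp: fg_module_def)
  let ?i = "\<lambda>x. (x, \<zero>\<^bsub>N\<^esub>)" and ?j = "\<lambda>y. (\<zero>\<^bsub>M\<^esub>, y)"
  have "H = carrier M \<times> carrier N"
    if H: "submodule H A (direct_sum_module M N)" and sub: "?i ` S \<union> ?j ` T \<subseteq> H" for H
  proof -
    have 1: "{x \<in> carrier M. ?i x \<in> H} = carrier M"
      using vimage_submodule[OF lm(1) D hom_inl[OF lm] H] sub S(2)
      by (intro S(3)) (auto cong: conj_cong)
    have 2: "{x \<in> carrier N. ?j x \<in> H} = carrier N"
      using vimage_submodule[OF lm(2) D hom_inr[OF lm] H] sub T(2)
      by (intro T(3)) (auto cong: conj_cong)
    have "(x, y) \<in> H" if "x \<in> carrier M" "y \<in> carrier N" for x y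
      using submodule_add[OF H, of "?i x" "?j y"] that 1 2 by auto
    then show ?thesis using submodule_subset[OF H] by auto
  qed
  then show ?thesis
    unfolding fg_module_def using D S(1,2) T(1,2) by (intro conjI exI[of _ "?i ` S \<union> ?j ` T"]) auto
qed

lemma regular_left_module:
  assumes "ring A" shows "left_module A (regular_module A)"
proof -
  interpret ring A by fact
  interpret N: abelian_group "regular_module A"
  proof (rule abelian_groupI)
    fix x assume "x \<in> carrier (regular_module A)"
    then show "\<exists>y\<in>carrier (regular_module A). y \<oplus>\<^bsub>regular_module A\<^esub> x = \<zero>\<^bsub>regular_module A\<^esub>"
      by (intro bexI[of _ "\<ominus>\<^bsub>A\<^esub> x"]) (auto simp: regular_module_def l_neg)
  qed (auto simp: regular_module_def a_ac)
  show ?thesis by unfold_locales (auto simp: regular_module_def l_distr r_distr m_assoc)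
qed

lemma regular_simps [simp]:
  "carrier (regular_module A) = carrier A" "\<zero>\<^bsub>regular_module A\<^esub> = \<zero>\<^bsub>A\<^esub>"
  "x \<oplus>\<^bsub>regular_module A\<^esub> y = x \<oplus>\<^bsub>A\<^esub> y" "x \<odot>\<^bsub>regular_module A\<^esub> y = x \<otimes>\<^bsub>A\<^esub> y"
  by (auto simp: regular_module_def)

lemma regular_fg:
  assumes "ring A" shows "fg_module A (regular_module A)"
proof -
  interpret ring A by fact
  have "H = carrier A" if H: "submodule H A (regular_module A)" "{\<one>\<^bsub>A\<^esub>} \<subseteq> H" for H
    using submodule_smult[OF H(1), of _ "\<one>\<^bsub>A\<^esub>"] H(2) submodule_subset[OF H(1)] by auto
  then show ?thesis
    using regular_left_module[OF assms] unfolding fg_module_def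
    by (intro conjI exI[of _ "{\<one>\<^bsub>A\<^esub>}"]) auto
qed

lemma hom_from_regular:
  assumes M: "left_module A M" and x: "x \<in> carrier M"
  shows "(\<lambda>a\<in>carrier A. a \<odot>\<^bsub>M\<^esub> x) \<in> module_hom A (regular_module A) M"
proof -
  interpret left_module A M by fact
  show ?thesis
    using hom_restrictI[OF regular_left_module[OF R.ring_axioms], of "\<lambda>a. a \<odot>\<^bsub>M\<^esub> x" M] x
    by (auto simp: smult_l_distr smult_assoc1)
qed

section \<open>Projective and injective modules\<close>

text \<open>Projectivity, injectivity and approximations are tested on \<open>mod_cat A\<close>. A
  copy with mutually inverse homomorphisms makes these tests available for modules whose elements
  have another type.\<close>

lemma mod_cat_copy:
  assumes "fg_module A X"
  obtains X' f g where "X' \<in> mod_cat A" "f \<in> module_hom A X X'" "g \<in> module_hom A X' X"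
    "\<And>x. x \<in> carrier X \<Longrightarrow> g (f x) = x" "\<And>y. y \<in> carrier X' \<Longrightarrow> f (g y) = y"
proof -
  obtain X' f where X': "X' \<in> mod_cat A" "f \<in> module_hom A X X'" "bij_betw f (carrier X) (carrier X')"
    using ex_iso_in_mod_cat[OF assms] by (auto simp: module_iso_def)
  have "left_module A X" "left_module A X'"
    using assms X'(1) by (auto simp: mod_cat_def fg_module_def)
  from iso_inverse[OF this X'(2,3)] show thesis using X' that by metis
qed

lemma mod_catD: "X \<in> mod_cat A \<Longrightarrow> fg_module A X" "X \<in> mod_cat A \<Longrightarrow> left_module A X"
  by (auto simp: mod_cat_def fg_module_def)

lemma projective_fg: "projective_module A P \<Longrightarrow> fg_module A P"
  by (simp add: projective_module_def)

lemma projective_left_module: "projective_module A P \<Longrightarrow> left_module A P"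
  by (simp add: projective_module_def fg_module_def)

lemma injective_fg: "injective_module A P \<Longrightarrow> fg_module A P"
  by (simp add: injective_module_def)

lemma injective_left_module: "injective_module A P \<Longrightarrow> left_module A P"
  by (simp add: injective_module_def fg_module_def)

text \<open>Conjugating the lifting problem with copies of \<open>X\<close> and \<open>Y\<close> in
  \<open>mod_cat A\<close> frees the lifting property from the fixed element type.\<close>

lemma projective_lift:
  assumes P: "projective_module A P" and X: "fg_module A X" and Y: "fg_module A Y"
    and g: "g \<in> module_hom A X Y" and surj: "g ` carrier X = carrier Y" and h: "h \<in> module_hom A P Y"
  obtains k where "k \<in> module_hom A P X" "\<And>p. p \<in> carrier P \<Longrightarrow> g (k p) = h p"
proof -
  note lm = projective_left_module[OF P] fg_left_module[OF X] fg_left_module[OF Y]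
  obtain X' i i' where X': "X' \<in> mod_cat A" "i \<in> module_hom A X X'" "i' \<in> module_hom A X' X"
    "\<And>x. x \<in> carrier X \<Longrightarrow> i' (i x) = x" "\<And>y. y \<in> carrier X' \<Longrightarrow> i (i' y) = y"
    using mod_cat_copy[OF X] by metis
  obtain Y' j j' where Y': "Y' \<in> mod_cat A" "j \<in> module_hom A Y Y'" "j' \<in> module_hom A Y' Y"
    "\<And>x. x \<in> carrier Y \<Longrightarrow> j' (j x) = x" "\<And>y. y \<in> carrier Y' \<Longrightarrow> j (j' y) = y"
    using mod_cat_copy[OF Y] by metis
  note cl = hom_closed[OF X'(2)] hom_closed[OF X'(3)] hom_closed[OF Y'(2)] hom_closed[OF Y'(3)]
    hom_closed[OF g] hom_closed[OF h]
  define g' where "g' = (\<lambda>x\<in>carrier X'. j (g (i' x)))"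
  have g': "g' \<in> module_hom A X' Y'"
    using hom_comp[OF mod_catD(2)[OF X'(1)] hom_comp[OF mod_catD(2)[OF X'(1)] X'(3) g] Y'(2)]
    by (simp add: g'_def cong: restrict_cong)
  have "y \<in> g' ` carrier X'" if y: "y \<in> carrier Y'" for y
  proof -
    obtain x where x: "x \<in> carrier X" "g x = j' y" using hom_closed[OF Y'(3) y] unfolding surj[symmetric] by (metis imageE)
    then have "g' (i x) = y" using y by (simp add: g'_def cl X' Y')
    then show ?thesis using cl(1)[OF x(1)] by blast
  qed
  then have "g' ` carrier X' = carrier Y'" using hom_closed[OF g'] by auto
  then obtain k where k: "k \<in> module_hom A P X'" "\<And>p. p \<in> carrier P \<Longrightarrow> g' (k p) = j (h p)"
    using P hom_comp[OF lm(1) h Y'(2)] X'(1) Y'(1) g' unfolding projective_module_def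
    by (smt (verit) restrict_apply')
  have "g (i' (k p)) = h p" if "p \<in> carrier P" for p
    using k(2)[OF that] hom_closed[OF k(1) that] cl(6)[OF that] Y'(4) cl(2) cl(5)
    by (simp add: g'_def) metis
  then show thesis using hom_comp[OF lm(1) k(1) X'(3)] by (intro that) auto
qed

lemma injective_extend:
  assumes I: "injective_module A I" and X: "fg_module A X" and Y: "fg_module A Y"
    and g: "g \<in> module_hom A X Y" and inj: "inj_on g (carrier X)" and h: "h \<in> module_hom A X I"
  obtains k where "k \<in> module_hom A Y I" "\<And>x. x \<in> carrier X \<Longrightarrow> k (g x) = h x"
proof -
  note lm = injective_left_module[OF I] fg_left_module[OF X] fg_left_module[OF Y]
  obtain X' i i' where X': "X' \<in> mod_cat A" "i \<in> module_hom A X X'" "i' \<in> module_hom A X' X"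
    "\<And>x. x \<in> carrier X \<Longrightarrow> i' (i x) = x" "\<And>y. y \<in> carrier X' \<Longrightarrow> i (i' y) = y"
    using mod_cat_copy[OF X] by metis
  obtain Y' j j' where Y': "Y' \<in> mod_cat A" "j \<in> module_hom A Y Y'" "j' \<in> module_hom A Y' Y"
    "\<And>x. x \<in> carrier Y \<Longrightarrow> j' (j x) = x" "\<And>y. y \<in> carrier Y' \<Longrightarrow> j (j' y) = y"
    using mod_cat_copy[OF Y] by metis
  note cl = hom_closed[OF X'(2)] hom_closed[OF X'(3)] hom_closed[OF Y'(2)] hom_closed[OF Y'(3)]
    hom_closed[OF g] hom_closed[OF h]
  define g' where "g' = (\<lambda>x\<in>carrier X'. j (g (i' x)))"
  have g': "g' \<in> module_hom A X' Y'"
    using hom_comp[OF mod_catD(2)[OF X'(1)] hom_comp[OF mod_catD(2)[OF X'(1)] X'(3) g] Y'(2)]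
    by (simp add: g'_def cong: restrict_cong)
  have "inj_on g' (carrier X')"
  proof (rule inj_onI)
    fix x y assume xy: "x \<in> carrier X'" "y \<in> carrier X'" "g' x = g' y"
    then have "g (i' x) = g (i' y)" using Y'(4) cl(2,5) by (simp add: g'_def) metis
    then have "i' x = i' y" using inj cl(2) xy by (auto dest: inj_onD)
    then show "x = y" using X'(5) xy by metis
  qed
  then obtain k where k: "k \<in> module_hom A Y' I" "\<And>x. x \<in> carrier X' \<Longrightarrow> k (g' x) = h (i' x)"
    using I hom_comp[OF mod_catD(2)[OF X'(1)] X'(3) h] X'(1) Y'(1) g' unfolding injective_module_def
    by (smt (verit) restrict_apply')
  have "k (j (g x)) = h x" if "x \<in> carrier X" for x
    using k(2)[of "i x"] that by (simp add: g'_def cl X')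
  then show thesis using hom_comp[OF lm(3) Y'(2) k(1)] cl(5) by (intro that) auto
qed

text \<open>Lift the composition of \<open>r\<close> and \<open>h\<close> from \<open>P\<close>,
  then precompose the lift with \<open>s\<close>.\<close>

lemma projective_retract:
  assumes P: "projective_module A P" and P': "left_module A P'"
    and r: "r \<in> module_hom A P P'" and s: "s \<in> module_hom A P' P"
    and rs: "\<And>x. x \<in> carrier P' \<Longrightarrow> r (s x) = x"
  shows "projective_module A P'"
  unfolding projective_module_def
proof (intro conjI ballI impI)
  have "r ` carrier P = carrier P'" using rs hom_closed[OF r] hom_closed[OF s] by force
  then show "fg_module A P'" using fg_surj[OF projective_fg[OF P] P' r] by blast
  fix X Y g h assume *: "X \<in> mod_cat A" "Y \<in> mod_cat A" "g \<in> module_hom A X Y" "h \<in> module_hom A P' Y"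
    "g ` carrier X = carrier Y"
  obtain k where k: "k \<in> module_hom A P X" "\<And>p. p \<in> carrier P \<Longrightarrow> g (k p) = h (r p)"
    using projective_lift[OF P mod_catD(1)[OF *(1)] mod_catD(1)[OF *(2)] *(3,5)
      hom_comp[OF projective_left_module[OF P] r *(4)]] by auto
  show "\<exists>k\<in>module_hom A P' X. \<forall>p\<in>carrier P'. g (k p) = h p"
    using hom_comp[OF P' s k(1)] k(2) hom_closed[OF s] rs by (intro bexI) auto
qed

lemma projective_iso:
  assumes P: "projective_module A P" and P': "left_module A P'" and iso: "module_iso A P P'"
  shows "projective_module A P'"
proof -
  obtain f where f: "f \<in> module_hom A P P'" "bij_betw f (carrier P) (carrier P')"
    using iso by (auto simp: module_iso_def)
  show ?thesis
    using iso_inverse[OF projective_left_module[OF P] P' f] projective_retract[OF P P' f(1)] by metis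
qed

lemma projective_direct_sum:
  assumes P: "projective_module A P" and Q: "projective_module A Q"
  shows "projective_module A (direct_sum_module P Q)"
  unfolding projective_module_def
proof (intro conjI ballI impI)
  note lm = projective_left_module[OF P] projective_left_module[OF Q]
  interpret P: left_module A P by (rule lm)
  interpret Q: left_module A Q by (rule lm)
  note D = direct_sum_left_module[OF lm]
  show "fg_module A (direct_sum_module P Q)" using P Q by (simp add: fg_direct_sum projective_fg)
  fix X Y g h assume *: "X \<in> mod_cat A" "Y \<in> mod_cat A" "g \<in> module_hom A X Y"
    "h \<in> module_hom A (direct_sum_module P Q) Y" "g ` carrier X = carrier Y"
  obtain k where k: "k \<in> module_hom A P X" "\<And>p. p \<in> carrier P \<Longrightarrow> g (k p) = h (p, \<zero>\<^bsub>Q\<^esub>)"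
    using projective_lift[OF P mod_catD(1)[OF *(1)] mod_catD(1)[OF *(2)] *(3,5)
      hom_comp[OF lm(1) hom_inl[OF lm] *(4)]] by auto
  obtain l where l: "l \<in> module_hom A Q X" "\<And>q. q \<in> carrier Q \<Longrightarrow> g (l q) = h (\<zero>\<^bsub>P\<^esub>, q)"
    using projective_lift[OF Q mod_catD(1)[OF *(1)] mod_catD(1)[OF *(2)] *(3,5)
      hom_comp[OF lm(2) hom_inr[OF lm] *(4)]] by auto
  have "g (k p \<oplus>\<^bsub>X\<^esub> l q) = h (p, q)" if "p \<in> carrier P" "q \<in> carrier Q" for p q
    using that hom_add[OF *(4), of "(p, \<zero>\<^bsub>Q\<^esub>)" "(\<zero>\<^bsub>P\<^esub>, q)"]
    by (simp add: hom_add[OF *(3)] hom_closed[OF k(1)] hom_closed[OF l(1)] k(2) l(2))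
  then show "\<exists>k\<in>module_hom A (direct_sum_module P Q) X. \<forall>p\<in>carrier (direct_sum_module P Q). g (k p) = h p"
    using hom_copair[OF lm mod_catD(2)[OF *(1)] k(1) l(1)] by (intro bexI) auto
qed

text \<open>A homomorphism on the regular module is determined by its value at 1, so a preimage of
  that value defines the lift.\<close>

lemma projective_regular:
  assumes "ring A" shows "projective_module A (regular_module A)"
  unfolding projective_module_def
proof (intro conjI ballI impI)
  interpret ring A by fact
  show "fg_module A (regular_module A)" using assms by (rule regular_fg)
  fix X Y g h assume *: "X \<in> mod_cat A" "Y \<in> mod_cat A" "g \<in> module_hom A X Y"
    "h \<in> module_hom A (regular_module A) Y" "g ` carrier X = carrier Y"
  then obtain x where x: "x \<in> carrier X" "g x = h \<one>\<^bsub>A\<^esub>"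
    using hom_closed[OF *(4), of "\<one>\<^bsub>A\<^esub>"] by (metis imageE one_closed regular_simps(1))
  show "\<exists>k\<in>module_hom A (regular_module A) X. \<forall>p\<in>carrier (regular_module A). g (k p) = h p"
  proof (intro bexI[OF _ hom_from_regular[OF mod_catD(2)[OF *(1)] x(1)]] ballI)
    fix p assume "p \<in> carrier (regular_module A)"
    then show "g ((\<lambda>a\<in>carrier A. a \<odot>\<^bsub>X\<^esub> x) p) = h p"
      using hom_smult[OF *(4), of p "\<one>\<^bsub>A\<^esub>"] x(1) by (simp add: hom_smult[OF *(3)] x(2)[symmetric])
  qed
qed

lemma zero_fg:
  assumes "left_module A M" "carrier M = {\<zero>\<^bsub>M\<^esub>}" shows "fg_module A M"
  using assms submodule_zero submodule_subset unfolding fg_module_def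
  by (intro conjI exI[of _ "{}"]) fastforce+

lemma zero_projective:
  assumes M: "left_module A M" "carrier M = {\<zero>\<^bsub>M\<^esub>}" shows "projective_module A M"
  unfolding projective_module_def
proof (intro conjI ballI impI)
  show "fg_module A M" using assms by (rule zero_fg)
  fix X Y g h assume *: "X \<in> mod_cat A" "Y \<in> mod_cat A" "g \<in> module_hom A X Y" "h \<in> module_hom A M Y"
  note lm = mod_catD(2)[OF *(1)] mod_catD(2)[OF *(2)]
  show "\<exists>k\<in>module_hom A M X. \<forall>p\<in>carrier M. g (k p) = h p"
    using hom_const_zero[OF M(1) lm(1)] hom_zero[OF lm *(3)] hom_zero[OF M(1) lm(2) *(4)] M(2)
    by (intro bexI[of _ "\<lambda>x\<in>carrier M. \<zero>\<^bsub>X\<^esub>"]) auto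
qed

section \<open>Extending homomorphisms\<close>

text \<open>This is the surjectivity of the map Hom(f, X) from Hom(P, X) to Hom(K, X), for an
  arbitrary homomorphism \<open>f\<close>.\<close>

definition extends_along ::
    "('a, 'r) ring_scheme \<Rightarrow> ('a, 'k) module \<Rightarrow> ('a, 'p) module \<Rightarrow> ('k \<Rightarrow> 'p) \<Rightarrow> ('a, 'x) module \<Rightarrow> bool" where
  "extends_along A K P f X \<longleftrightarrow>
     (\<forall>g\<in>module_hom A K X. \<exists>h\<in>module_hom A P X. \<forall>x\<in>carrier K. h (f x) = g x)"

lemma extends_alongE:
  assumes "extends_along A K P f X" "g \<in> module_hom A K X"
  obtains h where "h \<in> module_hom A P X" "\<And>x. x \<in> carrier K \<Longrightarrow> h (f x) = g x"
  using assms by (auto simp: extends_along_def)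

lemma extends_along_retract:
  assumes K: "left_module A K" and P: "left_module A P" and f: "f \<in> module_hom A K P"
    and ext: "extends_along A K P f X"
    and r: "r \<in> module_hom A X X'" and s: "s \<in> module_hom A X' X"
    and rs: "\<And>x. x \<in> carrier X' \<Longrightarrow> r (s x) = x"
  shows "extends_along A K P f X'"
  unfolding extends_along_def
proof
  fix g assume g: "g \<in> module_hom A K X'"
  obtain h where h: "h \<in> module_hom A P X" "\<And>x. x \<in> carrier K \<Longrightarrow> h (f x) = s (g x)"
    using extends_alongE[OF ext hom_comp[OF K g s]] by auto
  then show "\<exists>h\<in>module_hom A P X'. \<forall>x\<in>carrier K. h (f x) = g x"
    using hom_comp[OF P h(1) r] hom_closed[OF f] hom_closed[OF g] rs by (intro bexI) auto
qed

lemma extends_along_iso: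
  assumes K: "left_module A K" and P: "left_module A P" and f: "f \<in> module_hom A K P"
    and ext: "extends_along A K P f X" and X: "left_module A X" "left_module A X'" "module_iso A X X'"
  shows "extends_along A K P f X'"
proof -
  obtain r where r: "r \<in> module_hom A X X'" "bij_betw r (carrier X) (carrier X')"
    using X(3) by (auto simp: module_iso_def)
  show ?thesis
    using iso_inverse[OF X(1,2) r] extends_along_retract[OF K P f ext r(1)] by metis
qed

lemma extends_along_direct_sum:
  assumes K: "left_module A K" and P: "left_module A P" and f: "f \<in> module_hom A K P"
    and X: "left_module A X" and Y: "left_module A Y"
  shows "extends_along A K P f (direct_sum_module X Y) \<longleftrightarrow> extends_along A K P f X \<and> extends_along A K P f Y"
proof (intro iffI conjI)
  interpret X: left_module A X by fact
  interpret Y: left_module A Y by fact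
  assume ext: "extends_along A K P f (direct_sum_module X Y)"
  show "extends_along A K P f X"
    by (rule extends_along_retract[OF K P f ext hom_fst[OF X Y] hom_inl[OF X Y]]) simp
  show "extends_along A K P f Y"
    by (rule extends_along_retract[OF K P f ext hom_snd[OF X Y] hom_inr[OF X Y]]) simp
next
  assume *: "extends_along A K P f X \<and> extends_along A K P f Y"
  show "extends_along A K P f (direct_sum_module X Y)"
    unfolding extends_along_def
  proof
    fix g assume g: "g \<in> module_hom A K (direct_sum_module X Y)"
    obtain h where h: "h \<in> module_hom A P X" "\<And>x. x \<in> carrier K \<Longrightarrow> h (f x) = fst (g x)"
      using extends_alongE[OF conjunct1[OF *] hom_comp[OF K g hom_fst[OF X Y]]] hom_closed[OF g] by auto
    obtain k where k: "k \<in> module_hom A P Y" "\<And>x. x \<in> carrier K \<Longrightarrow> k (f x) = snd (g x)"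
      using extends_alongE[OF conjunct2[OF *] hom_comp[OF K g hom_snd[OF X Y]]] hom_closed[OF g] by auto
    show "\<exists>h\<in>module_hom A P (direct_sum_module X Y). \<forall>x\<in>carrier K. h (f x) = g x"
      using hom_pair[OF X Y P h(1) k(1)] hom_closed[OF f] h(2) k(2) by (intro bexI) auto
  qed
qed

lemma extends_along_injective:
  assumes "injective_module A I" "fg_module A K" "fg_module A P" "f \<in> module_hom A K P" "inj_on f (carrier K)"
  shows "extends_along A K P f I"
  unfolding extends_along_def by (meson injective_extend[OF assms])

section \<open>Free covers\<close>

text \<open>These are the free modules of finite rank, up to isomorphism. An iterated direct sum
  would change its type with the rank, so each step admits a copy of the sum in the fixed element
  type; induction on the rank becomes rule induction.\<close>

inductive free_module :: "('a, 'r) ring_scheme \<Rightarrow> ('a, 'a univ) module \<Rightarrow> bool" for A where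
  zero: "left_module A F \<Longrightarrow> carrier F = {\<zero>\<^bsub>F\<^esub>} \<Longrightarrow> free_module A F"
| step: "free_module A F \<Longrightarrow> fg_module A F' \<Longrightarrow>
    module_iso A (direct_sum_module (regular_module A) F) F' \<Longrightarrow> free_module A F'"

lemma free_fg: "free_module A F \<Longrightarrow> fg_module A F"
  by (induction rule: free_module.induct) (auto intro: zero_fg)

lemma free_projective: "free_module A F \<Longrightarrow> projective_module A F"
proof (induction rule: free_module.induct)
  case (zero F)
  then show ?case by (rule zero_projective)
next
  case (step F F')
  then have "left_module A F'" by (simp add: fg_left_module)
  then have "ring A" by (simp add: left_module_def)
  then show ?case
    using step by (intro projective_iso[OF projective_direct_sum[OF projective_regular step.IH]]) (auto simp: fg_left_module)
qed

text \<open>Each element of \<open>S\<close> adds one copy of the regular module, whose unit is sent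
  to that element.\<close>

lemma free_cover_finite:
  assumes M: "left_module A M" and S: "finite S" "S \<subseteq> carrier M"
  shows "\<exists>F f. free_module A F \<and> f \<in> module_hom A F M \<and> S \<subseteq> f ` carrier F"
  using S
proof (induction S)
  case empty
  interpret left_module A M by (rule M)
  \<comment> \<open>The zero submodule, copied into the fixed element type, is the free module of
    rank zero.\<close>
  have "left_module A (M\<lparr>carrier := {\<zero>\<^bsub>M\<^esub>}\<rparr>)"
    by (intro submodule_left_module M zero_submodule)
  then have "fg_module A (M\<lparr>carrier := {\<zero>\<^bsub>M\<^esub>}\<rparr>)" by (rule zero_fg) simp
  from ex_iso_in_mod_cat[OF this] obtain F f where F: "F \<in> mod_cat A"
      "f \<in> module_hom A (M\<lparr>carrier := {\<zero>\<^bsub>M\<^esub>}\<rparr>) F" "bij_betw f {\<zero>\<^bsub>M\<^esub>} (carrier F)"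
    by (auto simp: module_iso_def)
  interpret F: left_module A F using F(1) by (simp add: mod_catD)
  have "carrier F = {\<zero>\<^bsub>F\<^esub>}" using F(3) F.zero_closed by (auto simp: bij_betw_def)
  then have "free_module A F" by (rule free_module.zero[OF F.left_module_axioms])
  then show ?case using hom_const_zero[OF F.left_module_axioms M] by blast
next
  case (insert s S)
  interpret left_module A M by (rule M)
  have s: "s \<in> carrier M" using insert by auto
  obtain F f where F: "free_module A F" "f \<in> module_hom A F M" "S \<subseteq> f ` carrier F"
    using insert by auto
  note lmF = fg_left_module[OF free_fg[OF F(1)]]
  interpret F: left_module A F by (rule lmF)
  note reg = regular_left_module[OF R.ring_axioms]
  let ?D = "direct_sum_module (regular_module A) F"
  have D: "fg_module A ?D"
    by (intro fg_direct_sum regular_fg free_fg F R.ring_axioms)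
  obtain F' i j where F': "F' \<in> mod_cat A" "i \<in> module_hom A ?D F'" "j \<in> module_hom A F' ?D"
    "\<And>x. x \<in> carrier ?D \<Longrightarrow> j (i x) = x" "\<And>y. y \<in> carrier F' \<Longrightarrow> i (j y) = y"
    using mod_cat_copy[OF D] by metis
  have "bij_betw i (carrier ?D) (carrier F')"
    using F'(4,5) by (intro bij_betw_byWitness[where f' = j] ballI image_subsetI hom_closed[OF F'(2)] hom_closed[OF F'(3)])
  then have free: "free_module A F'"
    using free_module.step[OF F(1) mod_catD(1)[OF F'(1)]] F'(2) by (auto simp: module_iso_def)
  define h where "h = (\<lambda>x\<in>carrier (regular_module A) \<times> carrier F. (\<lambda>a\<in>carrier A. a \<odot>\<^bsub>M\<^esub> s) (fst x) \<oplus>\<^bsub>M\<^esub> f (snd x))"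
  have h: "h \<in> module_hom A ?D M"
    unfolding h_def by (rule hom_copair[OF reg lmF M hom_from_regular[OF M s] F(2)])
  have "t \<in> (\<lambda>x\<in>carrier F'. h (j x)) ` carrier F'" if t: "t \<in> insert s S" for t
  proof -
    have "\<exists>x\<in>carrier ?D. h x = t"
    proof (cases "t = s")
      case True
      then show ?thesis using s hom_zero[OF lmF M F(2)]
        by (intro bexI[of _ "(\<one>\<^bsub>A\<^esub>, \<zero>\<^bsub>F\<^esub>)"]) (auto simp: h_def)
    next
      case False
      then obtain x where "x \<in> carrier F" "t = f x" using t F(3) by auto
      then show ?thesis using s hom_closed[OF F(2)]
        by (intro bexI[of _ "(\<zero>\<^bsub>A\<^esub>, x)"]) (auto simp: h_def smult_zero_left)
    qed
    then obtain x where x: "x \<in> carrier ?D" "h x = t" by blast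
    then show ?thesis using hom_closed[OF F'(2) x(1)] F'(4)[OF x(1)]
      by (intro image_eqI[of _ _ "i x"]) auto
  qed
  then show ?case using free hom_comp[OF mod_catD(2)[OF F'(1)] F'(3) h] by blast
qed

lemma free_cover:
  assumes "fg_module A M"
  obtains F f where "free_module A F" "f \<in> module_hom A F M" "f ` carrier F = carrier M"
proof -
  note M = fg_left_module[OF assms]
  obtain S where S: "finite S" "S \<subseteq> carrier M" "\<And>H. submodule H A M \<Longrightarrow> S \<subseteq> H \<Longrightarrow> H = carrier M"
    using assms by (auto simp: fg_module_def)
  obtain F f where F: "free_module A F" "f \<in> module_hom A F M" "S \<subseteq> f ` carrier F"
    using free_cover_finite[OF M S(1,2)] by blast
  note lmF = fg_left_module[OF free_fg[OF F(1)]]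
  have "f ` carrier F = carrier M"
    by (rule S(3)[OF image_submodule[OF lmF M F(2) carrier_submodule[OF lmF]] F(3)])
  then show thesis using F that by blast
qed

text \<open>The property passes from the regular module to finite direct sums of it, and from there
  to \<open>Q\<close>: a free cover of \<open>Q\<close> splits, so \<open>Q\<close> is a retract of
  a free module.\<close>

lemma extends_along_projective:
  assumes K: "left_module A K" and P: "left_module A P" and f: "f \<in> module_hom A K P"
    and ext: "extends_along A K P f (regular_module A)" and Q: "projective_module A Q"
  shows "extends_along A K P f Q"
proof -
  have ring: "ring A" using K by (simp add: left_module_def)
  have free: "extends_along A K P f F" if "free_module A F" for F
    using that
  proof (induction rule: free_module.induct)
    case (zero F)
    have "h (f x) = g x" if "h \<in> module_hom A P F" "g \<in> module_hom A K F" "x \<in> carrier K" for g h x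
      using hom_closed[OF that(1) hom_closed[OF f that(3)]] hom_closed[OF that(2,3)] zero(2) by auto
    then show ?case using hom_const_zero[OF P zero(1)] unfolding extends_along_def by blast
  next
    case (step F F')
    note F = fg_left_module[OF free_fg[OF step(1)]] fg_left_module[OF step(2)]
    show ?case
      using extends_along_direct_sum[OF K P f regular_left_module[OF ring] F(1)] ext step.IH
      by (intro extends_along_iso[OF K P f _ direct_sum_left_module[OF regular_left_module[OF ring] F(1)] F(2) step(3)])
        blast
  qed
  obtain F r where F: "free_module A F" "r \<in> module_hom A F Q" "r ` carrier F = carrier Q"
    using free_cover[OF projective_fg[OF Q]] by blast
  obtain s where s: "s \<in> module_hom A Q F" "\<And>x. x \<in> carrier Q \<Longrightarrow> r (s x) = x"
    using projective_lift[OF Q free_fg[OF F(1)] projective_fg[OF Q] F(2,3) hom_id[OF projective_left_module[OF Q]]]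
    by auto
  show ?thesis by (rule extends_along_retract[OF K P f free[OF F(1)] F(2) s])
qed

section \<open>Short exact sequences\<close>

definition short_exact ::
    "('a, 'r) ring_scheme \<Rightarrow> ('a, 'k) module \<Rightarrow> ('a, 'p) module \<Rightarrow> ('a, 'm) module \<Rightarrow>
     ('k \<Rightarrow> 'p) \<Rightarrow> ('p \<Rightarrow> 'm) \<Rightarrow> bool" where
  "short_exact A K P M f e \<longleftrightarrow> left_module A K \<and> left_module A P \<and> left_module A M \<and>
     f \<in> module_hom A K P \<and> e \<in> module_hom A P M \<and> inj_on f (carrier K) \<and>
     e ` carrier P = carrier M \<and> f ` carrier K = ker_module P M e"

lemma short_exactD:
  assumes "short_exact A K P M f e"
  shows "left_module A K" "left_module A P" "left_module A M"
    "f \<in> module_hom A K P" "e \<in> module_hom A P M" "inj_on f (carrier K)"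
    "e ` carrier P = carrier M" "f ` carrier K = ker_module P M e"
  using assms by (auto simp: short_exact_def)

lemma short_exact_comp_zero: "short_exact A K P M f e \<Longrightarrow> x \<in> carrier K \<Longrightarrow> e (f x) = \<zero>\<^bsub>M\<^esub>"
  by (auto simp: short_exact_def ker_module_def)

lemma short_exact_ker:
  assumes P: "left_module A P" and M: "left_module A M" and e: "e \<in> module_hom A P M"
    and surj: "e ` carrier P = carrier M"
  shows "short_exact A (P\<lparr>carrier := ker_module P M e\<rparr>) P M (\<lambda>x\<in>ker_module P M e. x) e"
  unfolding short_exact_def
  using assms submodule_left_module[OF P ker_submodule[OF P M e]] hom_incl[OF P ker_submodule[OF P M e]]
  by (auto simp: inj_on_def)

lemma short_exact_coker:
  assumes K: "left_module A K" and P: "left_module A P" and f: "f \<in> module_hom A K P"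
    and inj: "inj_on f (carrier K)"
  shows "short_exact A K P (coker_module K P f) f (\<lambda>x\<in>carrier P. (f ` carrier K) +>\<^bsub>P\<^esub> x)"
proof -
  note H = image_submodule[OF K P f carrier_submodule[OF K]]
  show ?thesis
    unfolding short_exact_def coker_module_def
    using K P f inj quot_left_module[OF P H] quot_proj[OF P H] quot_proj_surj[OF P H] quot_proj_ker[OF P H]
    by blast
qed

lemma short_exact_iso_right:
  assumes ex: "short_exact A K P M f e" and N: "left_module A N"
    and j: "j \<in> module_hom A M N" and bij: "bij_betw j (carrier M) (carrier N)"
  shows "short_exact A K P N f (\<lambda>x\<in>carrier P. j (e x))"
proof -
  note S = short_exactD[OF ex]
  have "ker_module P N (\<lambda>x\<in>carrier P. j (e x)) = ker_module P M e"
    using hom_inj_iff[OF S(3) N j] bij hom_closed[OF S(5)] hom_zero[OF S(3) N j]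
    by (auto simp: ker_module_def bij_betw_def)
  moreover have "(\<lambda>x\<in>carrier P. j (e x)) ` carrier P = carrier N"
    using S(7) bij_betw_imp_surj_on[OF bij] by (metis (no_types, lifting) image_cong image_image restrict_apply')
  ultimately show ?thesis
    unfolding short_exact_def using S N hom_comp[OF S(2,5) j] by auto
qed

lemma short_exact_factor:
  assumes ex: "short_exact A K P M f e" and X: "left_module A X" and g: "g \<in> module_hom A X P"
    and zero: "\<And>x. x \<in> carrier X \<Longrightarrow> e (g x) = \<zero>\<^bsub>M\<^esub>"
  obtains h where "h \<in> module_hom A X K" "\<And>x. x \<in> carrier X \<Longrightarrow> f (h x) = g x"
proof -
  note S = short_exactD[OF ex]
  have "g ` carrier X \<subseteq> f ` carrier K"
    unfolding S(8) using zero hom_closed[OF g] by (auto simp: ker_module_def)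
  from factor_inj[OF S(1,2) X S(4,6) g this] show thesis using that by blast
qed

lemma short_exact_cofactor:
  assumes ex: "short_exact A K P M f e" and X: "left_module A X" and g: "g \<in> module_hom A P X"
    and zero: "\<And>x. x \<in> carrier K \<Longrightarrow> g (f x) = \<zero>\<^bsub>X\<^esub>"
  obtains h where "h \<in> module_hom A M X" "\<And>x. x \<in> carrier P \<Longrightarrow> h (e x) = g x"
proof -
  note S = short_exactD[OF ex]
  have "ker_module P M e \<subseteq> ker_module P X g"
    unfolding S(8)[symmetric] using zero hom_closed[OF S(4)] by (auto simp: ker_module_def)
  from factor_surj[OF S(2,3) X S(5,7) g this] show thesis using that by blast
qed

text \<open>
  The maps between the two presentations lift the identity of \<^term>\<open>M\<close>, as in Schanuel's lemma, and
  the round trip differs from the identity of \<^term>\<open>P'\<close> by a map into \<^term>\<open>K'\<close>.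
\<close>

lemma extends_along_presentation:
  assumes ex: "short_exact A K P M f e" and ex': "short_exact A K' P' M f' e'"
    and P: "projective_module A P" and P': "projective_module A P'"
    and X: "left_module A X" and ext: "extends_along A K P f X"
  shows "extends_along A K' P' f' X"
  unfolding extends_along_def
proof
  fix h assume h: "h \<in> module_hom A K' X"
  note S = short_exactD[OF ex] and S' = short_exactD[OF ex']
  interpret K': left_module A K' by (rule S')
  interpret P': left_module A P' by (rule S')
  interpret M: left_module A M by (rule S)
  interpret X: left_module A X by (rule X)
  have fgM: "fg_module A M" using fg_surj[OF projective_fg[OF P] S(3,5,7)] .
  obtain u where u: "u \<in> module_hom A P' P" "\<And>x. x \<in> carrier P' \<Longrightarrow> e (u x) = e' x"
    using projective_lift[OF P' projective_fg[OF P] fgM S(5,7) S'(5)] by blast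
  obtain v where v: "v \<in> module_hom A P P'" "\<And>x. x \<in> carrier P \<Longrightarrow> e' (v x) = e x"
    using projective_lift[OF P projective_fg[OF P'] fgM S'(5,7) S(5)] by blast
  obtain v1 where v1: "v1 \<in> module_hom A K K'" "\<And>x. x \<in> carrier K \<Longrightarrow> f' (v1 x) = v (f x)"
  proof (rule short_exact_factor[OF ex' S(1) hom_comp[OF S(1,4) v(1)]])
    show "e' ((\<lambda>x\<in>carrier K. v (f x)) x) = \<zero>\<^bsub>M\<^esub>" if "x \<in> carrier K" for x
      using that v(2) hom_closed[OF S(4)] short_exact_comp_zero[OF ex] by simp
  qed auto
  obtain g where g: "g \<in> module_hom A P X" "\<And>x. x \<in> carrier K \<Longrightarrow> g (f x) = h (v1 x)"
    using extends_alongE[OF ext hom_comp[OF S(1) v1(1) h]] by auto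
  have w: "(\<lambda>x\<in>carrier P'. x \<ominus>\<^bsub>P'\<^esub> v (u x)) \<in> module_hom A P' P'"
    using hom_minus_hom[OF S'(2,2) hom_id[OF S'(2)] hom_comp[OF S'(2) u(1) v(1)]]
    by (simp cong: restrict_cong)
  obtain w1 where w1: "w1 \<in> module_hom A P' K'" "\<And>x. x \<in> carrier P' \<Longrightarrow> f' (w1 x) = x \<ominus>\<^bsub>P'\<^esub> v (u x)"
  proof (rule short_exact_factor[OF ex' S'(2) w])
    show "e' ((\<lambda>x\<in>carrier P'. x \<ominus>\<^bsub>P'\<^esub> v (u x)) x) = \<zero>\<^bsub>M\<^esub>" if "x \<in> carrier P'" for x
      using that u(2) v(2) hom_closed[OF u(1)] hom_closed[OF v(1)] hom_closed[OF S'(5)]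
      by (simp add: hom_diff[OF S'(2,3,5)])
  qed auto
  \<comment> \<open>The extension of \<open>h\<close> is the sum of \<open>g\<close> after
    \<open>u\<close> and \<open>h\<close> after \<open>w1\<close>. If \<open>u (f' y) = f x\<close>,
    then \<open>w1 (f' y)\<close> is the difference of \<open>y\<close> and \<open>v1 x\<close> by
    injectivity of \<open>f'\<close>, and the two contributions add up to
    \<open>h y\<close>.\<close>
  have "g (u (f' y)) \<oplus>\<^bsub>X\<^esub> h (w1 (f' y)) = h y" if y: "y \<in> carrier K'" for y
  proof -
    have fy: "f' y \<in> carrier P'" using hom_closed[OF S'(4) y] .
    have "u (f' y) \<in> f ` carrier K"
      unfolding S(8) using fy u hom_closed[OF u(1)] short_exact_comp_zero[OF ex' y] by (simp add: ker_module_def)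
    then obtain x where x: "x \<in> carrier K" "u (f' y) = f x" by blast
    have v1x: "v1 x \<in> carrier K'" using hom_closed[OF v1(1) x(1)] .
    have "f' (w1 (f' y)) = f' (y \<ominus>\<^bsub>K'\<^esub> v1 x)"
      using w1(2)[OF fy] x v1(2)[OF x(1)] y v1x by (simp add: hom_diff[OF S'(1,2,4)])
    then have w1y: "w1 (f' y) = y \<ominus>\<^bsub>K'\<^esub> v1 x"
      using y v1x hom_closed[OF w1(1) fy] by (auto intro: inj_onD[OF S'(6)])
    have "g (u (f' y)) \<oplus>\<^bsub>X\<^esub> h (w1 (f' y)) = h (v1 x) \<oplus>\<^bsub>X\<^esub> h (y \<ominus>\<^bsub>K'\<^esub> v1 x)"
      using x g(2) w1y by simp
    also have "\<dots> = h (v1 x \<oplus>\<^bsub>K'\<^esub> (y \<ominus>\<^bsub>K'\<^esub> v1 x))" using y v1x by (simp add: hom_add[OF h])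
    also have "\<dots> = h y" using y v1x by (simp add: K'.diff_add_cancel)
    finally show ?thesis .
  qed
  then show "\<exists>k\<in>module_hom A P' X. \<forall>x\<in>carrier K'. k (f' x) = h x"
    using hom_plus[OF S'(2) X hom_comp[OF S'(2) u(1) g(1)] hom_comp[OF S'(2) w1(1) h]] hom_closed[OF S'(4)]
    by (intro bexI) auto
qed

section \<open>Vanishing of the first extension group\<close>

text \<open>For a short exact sequence 0 -> K -> P -> M -> 0 with P projective, Ext^1(M, X) is the
  cokernel of Hom(P, X) -> Hom(K, X). One presentation in the fixed element type is asked for; by
  \<open>Ext1_zero_iff\<close> the choice does not matter.\<close>

definition Ext1_zero :: "('a, 'r) ring_scheme \<Rightarrow> ('a, 'm) module \<Rightarrow> ('a, 'x) module \<Rightarrow> bool" where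
  "Ext1_zero A M X \<longleftrightarrow> (\<exists>P\<in>mod_cat A. \<exists>e. projective_module A P \<and> e \<in> module_hom A P M \<and>
     e ` carrier P = carrier M \<and>
     extends_along A (P\<lparr>carrier := ker_module P M e\<rparr>) P (\<lambda>x\<in>ker_module P M e. x) X)"

text \<open>Comparing presentations shows that any one of them decides the vanishing. Since
  \<open>P\<close> may have elements of another type, the converse passes to a free cover of
  \<open>M\<close> in the fixed type.\<close>

lemma Ext1_zero_iff:
  fixes A :: "('a, 'r) ring_scheme"
  assumes ex: "short_exact A K P M f e" and P: "projective_module A P" and X: "left_module A X"
  shows "Ext1_zero A M X \<longleftrightarrow> extends_along A K P f X"
proof
  note S = short_exactD[OF ex]
  assume "Ext1_zero A M X"
  then obtain P' :: "('a, 'a univ) module" and e' where P': "projective_module A P'" "e' \<in> module_hom A P' M" "e' ` carrier P' = carrier M"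
    "extends_along A (P'\<lparr>carrier := ker_module P' M e'\<rparr>) P' (\<lambda>x\<in>ker_module P' M e'. x) X"
    by (auto simp: Ext1_zero_def)
  show "extends_along A K P f X"
    using extends_along_presentation[OF short_exact_ker[OF projective_left_module[OF P'(1)] S(3) P'(2,3)]
      ex P'(1) P X P'(4)] .
next
  note S = short_exactD[OF ex]
  assume *: "extends_along A K P f X"
  have fgM: "fg_module A M" using fg_surj[OF projective_fg[OF P] S(3,5,7)] .
  obtain F e' where F: "free_module A F" "e' \<in> module_hom A F M" "e' ` carrier F = carrier M"
    using free_cover[OF fgM] by blast
  note F' = free_projective[OF F(1)]
  have "extends_along A (F\<lparr>carrier := ker_module F M e'\<rparr>) F (\<lambda>x\<in>ker_module F M e'. x) X"
    using extends_along_presentation[OF ex short_exact_ker[OF projective_left_module[OF F'] S(3) F(2,3)] P F' X *] .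
  then show "Ext1_zero A M X"
    unfolding Ext1_zero_def using F F' free_fg[OF F(1)] by (auto simp: mod_cat_def)
qed

lemma fg_presentation:
  assumes M: "fg_module A M"
  obtains K :: "('a, 'a univ) module" and F :: "('a, 'a univ) module" and f e
  where "short_exact A K F M f e" "free_module A F" "projective_module A F"
proof -
  obtain F e where F: "free_module A F" "e \<in> module_hom A F M" "e ` carrier F = carrier M"
    using free_cover[OF M] by blast
  show thesis
    using short_exact_ker[OF projective_left_module[OF free_projective[OF F(1)]] fg_left_module[OF M] F(2,3)]
      F(1) free_projective[OF F(1)] that by blast
qed

lemma Ext1_zero_direct_sum:
  assumes M: "fg_module A M" and X: "left_module A X" and Y: "left_module A Y"
  shows "Ext1_zero A M (direct_sum_module X Y) \<longleftrightarrow> Ext1_zero A M X \<and> Ext1_zero A M Y"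
proof -
  obtain K F :: "('a, 'a univ) module" and f e
    where ex: "short_exact A K F M f e" and F: "projective_module A F"
    using fg_presentation[OF M] by metis
  show ?thesis
    using extends_along_direct_sum[OF short_exactD(1,2,4)[OF ex] X Y]
    by (simp add: Ext1_zero_iff[OF ex F] X Y direct_sum_left_module)
qed

lemma Ext1_zero_projective:
  assumes M: "fg_module A M" and reg: "Ext1_zero A M (regular_module A)" and Q: "projective_module A Q"
  shows "Ext1_zero A M Q"
proof -
  obtain K F :: "('a, 'a univ) module" and f e
    where ex: "short_exact A K F M f e" and F: "projective_module A F"
    using fg_presentation[OF M] by metis
  have "ring A" using M by (simp add: fg_module_def left_module_def)
  then show ?thesis
    using extends_along_projective[OF short_exactD(1,2,4)[OF ex] _ Q] reg
    by (simp add: Ext1_zero_iff[OF ex F] projective_left_module[OF Q] regular_left_module)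
qed

lemma Ext1_zero_iso_right:
  assumes M: "fg_module A M" and X: "left_module A X" "left_module A Y" "module_iso A X Y"
    and ext: "Ext1_zero A M X"
  shows "Ext1_zero A M Y"
proof -
  obtain K F :: "('a, 'a univ) module" and f e
    where ex: "short_exact A K F M f e" and F: "projective_module A F"
    using fg_presentation[OF M] by metis
  show ?thesis
    using extends_along_iso[OF short_exactD(1,2,4)[OF ex] _ X] ext X(1,2) by (simp add: Ext1_zero_iff[OF ex F])
qed

text \<open>A presentation of \<open>M\<close> becomes one of \<open>N\<close> with the same
  kernel.\<close>

lemma Ext1_zero_iso_left:
  assumes M: "fg_module A M" and N: "left_module A N" "module_iso A M N" and X: "left_module A X"
    and ext: "Ext1_zero A M X"
  shows "Ext1_zero A N X"
proof -
  obtain K F :: "('a, 'a univ) module" and f e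
    where ex: "short_exact A K F M f e" and F: "projective_module A F"
    using fg_presentation[OF M] by metis
  obtain j where j: "j \<in> module_hom A M N" "bij_betw j (carrier M) (carrier N)"
    using N(2) by (auto simp: module_iso_def)
  show ?thesis
    using ext Ext1_zero_iff[OF ex F X] Ext1_zero_iff[OF short_exact_iso_right[OF ex N(1) j] F X] by blast
qed

text \<open>The long exact sequence, in the case where the middle term \<^term>\<open>Y\<close> has no extensions.\<close>

lemma Ext1_zero_iff_lift:
  assumes M: "fg_module A M" and ex: "short_exact A X' Y X i p" and fg: "fg_module A Y"
    and ext: "Ext1_zero A M Y"
  shows "Ext1_zero A M X' \<longleftrightarrow> (\<forall>h\<in>module_hom A M X. \<exists>k\<in>module_hom A M Y. \<forall>x\<in>carrier M. p (k x) = h x)"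
proof -
  obtain K F :: "('a, 'a univ) module" and f e
    where exM: "short_exact A K F M f e" and F: "projective_module A F"
    using fg_presentation[OF M] by metis
  note S = short_exactD[OF exM] and T = short_exactD[OF ex]
  interpret Y: left_module A Y by (rule T)
  interpret X: left_module A X by (rule T)
  have fgX: "fg_module A X" using fg_surj[OF fg T(3,5,7)] .
  show ?thesis
    unfolding Ext1_zero_iff[OF exM F T(1)]
  proof (intro iffI ballI)
    fix h assume ext': "extends_along A K F f X'" and h: "h \<in> module_hom A M X"
    \<comment> \<open>The lift \<open>l\<close> maps the kernel \<open>K\<close> into
      \<open>X'\<close>. Extending that map to \<open>F\<close> and subtracting it makes
      \<open>l\<close> vanish on \<open>K\<close>, so that the difference descends to the required
      lift on \<open>M\<close>.\<close>
    obtain l where l: "l \<in> module_hom A F Y" "\<And>x. x \<in> carrier F \<Longrightarrow> p (l x) = h (e x)"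
      using projective_lift[OF F fg fgX T(5,7) hom_comp[OF S(2,5) h]] by auto
    obtain l1 where l1: "l1 \<in> module_hom A K X'" "\<And>x. x \<in> carrier K \<Longrightarrow> i (l1 x) = l (f x)"
    proof (rule short_exact_factor[OF ex S(1) hom_comp[OF S(1,4) l(1)]])
      show "p ((\<lambda>x\<in>carrier K. l (f x)) x) = \<zero>\<^bsub>X\<^esub>" if "x \<in> carrier K" for x
        using that l(2) hom_closed[OF S(4)] short_exact_comp_zero[OF exM] hom_zero[OF S(3) T(3) h] by simp
    qed auto
    obtain g where g: "g \<in> module_hom A F X'" "\<And>x. x \<in> carrier K \<Longrightarrow> g (f x) = l1 x"
      using extends_alongE[OF ext' l1(1)] by auto
    note ig = hom_comp[OF S(2) g(1) T(4)]
    obtain k where k: "k \<in> module_hom A M Y"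
      "\<And>x. x \<in> carrier F \<Longrightarrow> k (e x) = l x \<ominus>\<^bsub>Y\<^esub> i (g x)"
    proof (rule short_exact_cofactor[OF exM T(2) hom_minus_hom[OF S(2) T(2) l(1) ig]])
      show "(\<lambda>x\<in>carrier F. l x \<ominus>\<^bsub>Y\<^esub> (\<lambda>x\<in>carrier F. i (g x)) x) (f x) = \<zero>\<^bsub>Y\<^esub>" if "x \<in> carrier K" for x
        using that hom_closed[OF S(4)] g(2) l1(2) hom_closed[OF l(1)] by simp
    qed auto
    have "p (k x) = h x" if x: "x \<in> carrier M" for x
    proof -
      obtain y where y: "y \<in> carrier F" "x = e y" using S(7) x by blast
      then show ?thesis
        using k(2)[OF y(1)] l(2) hom_closed[OF l(1)] hom_closed[OF T(4)] hom_closed[OF g(1)]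
          short_exact_comp_zero[OF ex] hom_closed[OF h x] X.diff_add_cancel(1)[of "h x" "\<zero>\<^bsub>X\<^esub>"]
        by (simp add: hom_diff[OF T(2,3,5)])
    qed
    then show "\<exists>k\<in>module_hom A M Y. \<forall>x\<in>carrier M. p (k x) = h x" using k(1) by blast
  next
    assume lift: "\<forall>h\<in>module_hom A M X. \<exists>k\<in>module_hom A M Y. \<forall>x\<in>carrier M. p (k x) = h x"
    show "extends_along A K F f X'"
      unfolding extends_along_def
    proof
      fix g assume g: "g \<in> module_hom A K X'"
      \<comment> \<open>Conversely, \<open>g\<close> followed by \<open>i\<close> extends to
        \<open>F\<close> because \<open>Y\<close> has no extensions by \<open>M\<close>. The
        extension \<open>l\<close> induces a map \<open>h\<close> on \<open>M\<close>; removing a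
        lift of \<open>h\<close> leaves a map into \<open>X'\<close> that still agrees with
        \<open>g\<close> on \<open>K\<close>.\<close>
      obtain l where l: "l \<in> module_hom A F Y" "\<And>x. x \<in> carrier K \<Longrightarrow> l (f x) = i (g x)"
        using extends_alongE[OF ext[unfolded Ext1_zero_iff[OF exM F T(2)]] hom_comp[OF S(1) g T(4)]] by auto
      obtain h where h: "h \<in> module_hom A M X" "\<And>x. x \<in> carrier F \<Longrightarrow> h (e x) = p (l x)"
      proof (rule short_exact_cofactor[OF exM T(3) hom_comp[OF S(2) l(1) T(5)]])
        show "(\<lambda>x\<in>carrier F. p (l x)) (f x) = \<zero>\<^bsub>X\<^esub>" if "x \<in> carrier K" for x
          using that hom_closed[OF S(4)] l(2) hom_closed[OF g] short_exact_comp_zero[OF ex] by simp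
      qed auto
      obtain k where k: "k \<in> module_hom A M Y" "\<And>x. x \<in> carrier M \<Longrightarrow> p (k x) = h x"
        using lift h(1) by blast
      note ke = hom_comp[OF S(2,5) k(1)]
      obtain g' where g': "g' \<in> module_hom A F X'"
        "\<And>x. x \<in> carrier F \<Longrightarrow> i (g' x) = l x \<ominus>\<^bsub>Y\<^esub> k (e x)"
      proof (rule short_exact_factor[OF ex S(2) hom_minus_hom[OF S(2) T(2) l(1) ke]])
        show "p ((\<lambda>x\<in>carrier F. l x \<ominus>\<^bsub>Y\<^esub> (\<lambda>x\<in>carrier F. k (e x)) x) x) = \<zero>\<^bsub>X\<^esub>" if "x \<in> carrier F" for x
          using that hom_closed[OF S(5)] h(2) k(2) hom_closed[OF l(1)] hom_closed[OF k(1)] hom_closed[OF T(5)]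
          by (simp add: hom_diff[OF T(2,3,5)])
      qed auto
      have "g' (f x) = g x" if x: "x \<in> carrier K" for x
      proof (rule inj_onD[OF T(6)])
        show "i (g' (f x)) = i (g x)"
          using x g'(2) hom_closed[OF S(4) x] l(2) short_exact_comp_zero[OF exM x] hom_zero[OF S(3) T(2) k(1)]
            hom_closed[OF T(4) hom_closed[OF g x]] Y.diff_add_cancel(1)[of "i (g x)" "\<zero>\<^bsub>Y\<^esub>"] by simp
      qed (use x hom_closed[OF S(4)] hom_closed[OF g] hom_closed[OF g'(1)] in auto)
      then show "\<exists>h\<in>module_hom A F X'. \<forall>x\<in>carrier K. h (f x) = g x" using g'(1) by blast
    qed
  qed
qed

text \<open>Both dimension shifts compare with the lifting problem of \<open>Ext1_zero_iff_lift\<close>.\<close>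

lemma Ext1_zero_shift_cosyzygy:
  assumes ex: "short_exact A X Q Y f e" and Q: "projective_module A Q" and fgX: "fg_module A X"
    and ex': "short_exact A L I L' i p" and I: "injective_module A I" and ext: "Ext1_zero A X I"
  shows "Ext1_zero A Y L' \<longleftrightarrow> Ext1_zero A X L"
proof -
  note S = short_exactD[OF ex] and T = short_exactD[OF ex']
  have fgL': "fg_module A L'" using fg_surj[OF injective_fg[OF I] T(3,5,7)] .
  show ?thesis
    unfolding Ext1_zero_iff[OF ex Q T(3)] Ext1_zero_iff_lift[OF fgX ex' injective_fg[OF I] ext]
  proof (intro iffI ballI)
    fix h assume "extends_along A X Q f L'" "h \<in> module_hom A X L'"
    then obtain g where g: "g \<in> module_hom A Q L'" "\<And>x. x \<in> carrier X \<Longrightarrow> g (f x) = h x"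
      using extends_alongE by metis
    obtain k where k: "k \<in> module_hom A Q I" "\<And>x. x \<in> carrier Q \<Longrightarrow> p (k x) = g x"
      using projective_lift[OF Q injective_fg[OF I] fgL' T(5,7) g(1)] by blast
    show "\<exists>k\<in>module_hom A X I. \<forall>x\<in>carrier X. p (k x) = h x"
      using hom_comp[OF S(1,4) k(1)] k(2) g(2) hom_closed[OF S(4)] by (intro bexI) auto
  next
    assume lift: "\<forall>h\<in>module_hom A X L'. \<exists>k\<in>module_hom A X I. \<forall>x\<in>carrier X. p (k x) = h x"
    show "extends_along A X Q f L'"
      unfolding extends_along_def
    proof
      fix h assume "h \<in> module_hom A X L'"
      then obtain k where k: "k \<in> module_hom A X I" "\<And>x. x \<in> carrier X \<Longrightarrow> p (k x) = h x"
        using lift by blast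
      \<comment> \<open>The lift has values in the injective module \<open>I\<close>, so it extends
        from \<open>X\<close> to \<open>Q\<close>.\<close>
      obtain g where g: "g \<in> module_hom A Q I" "\<And>x. x \<in> carrier X \<Longrightarrow> g (f x) = k x"
        using injective_extend[OF I fgX projective_fg[OF Q] S(4,6) k(1)] by blast
      show "\<exists>g\<in>module_hom A Q L'. \<forall>x\<in>carrier X. g (f x) = h x"
        using hom_comp[OF S(2) g(1) T(5)] k(2) g(2) hom_closed[OF S(4)] by (intro bexI) auto
    qed
  qed
qed

lemma Ext1_zero_shift_syzygy:
  assumes ex: "short_exact A X Q Y f e" and Q: "projective_module A Q" and fgX: "fg_module A X"
    and ex': "short_exact A K P K' i p" and P: "projective_module A P"
    and extX: "Ext1_zero A X P" and extY: "Ext1_zero A Y P"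
  shows "Ext1_zero A X K \<longleftrightarrow> Ext1_zero A Y K'"
proof -
  note S = short_exactD[OF ex] and T = short_exactD[OF ex']
  have fgK': "fg_module A K'" using fg_surj[OF projective_fg[OF P] T(3,5,7)] .
  show ?thesis
    unfolding Ext1_zero_iff[OF ex Q T(3)] Ext1_zero_iff_lift[OF fgX ex' projective_fg[OF P] extX]
  proof (intro iffI ballI)
    fix h assume "extends_along A X Q f K'" "h \<in> module_hom A X K'"
    then obtain g where g: "g \<in> module_hom A Q K'" "\<And>x. x \<in> carrier X \<Longrightarrow> g (f x) = h x"
      using extends_alongE by metis
    obtain k where k: "k \<in> module_hom A Q P" "\<And>x. x \<in> carrier Q \<Longrightarrow> p (k x) = g x"
      using projective_lift[OF Q projective_fg[OF P] fgK' T(5,7) g(1)] by blast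
    show "\<exists>k\<in>module_hom A X P. \<forall>x\<in>carrier X. p (k x) = h x"
      using hom_comp[OF S(1,4) k(1)] k(2) g(2) hom_closed[OF S(4)] by (intro bexI) auto
  next
    assume lift: "\<forall>h\<in>module_hom A X K'. \<exists>k\<in>module_hom A X P. \<forall>x\<in>carrier X. p (k x) = h x"
    show "extends_along A X Q f K'"
      unfolding extends_along_def
    proof
      fix h assume "h \<in> module_hom A X K'"
      then obtain k where k: "k \<in> module_hom A X P" "\<And>x. x \<in> carrier X \<Longrightarrow> p (k x) = h x"
        using lift by blast
      \<comment> \<open>Here the vanishing of Ext^1(Y, P) does what injectivity of \<open>I\<close>
        does in the other shift.\<close>
      obtain g where g: "g \<in> module_hom A Q P" "\<And>x. x \<in> carrier X \<Longrightarrow> g (f x) = k x"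
        using extends_alongE[OF extY[unfolded Ext1_zero_iff[OF ex Q T(2)]] k(1)] by blast
      show "\<exists>g\<in>module_hom A Q K'. \<forall>x\<in>carrier X. g (f x) = h x"
        using hom_comp[OF S(2) g(1) T(5)] k(2) g(2) hom_closed[OF S(4)] by (intro bexI) auto
    qed
  qed
qed

section \<open>Chain conditions\<close>

text \<open>One flag for both directions lets each transfer result be proved once. For the ascending
  condition the larger submodule counts as the lower one, since well-foundedness speaks of
  descent.\<close>

definition strictly_below :: "bool \<Rightarrow> 'b set \<Rightarrow> 'b set \<Rightarrow> bool" where
  "strictly_below up H H' \<longleftrightarrow> (if up then H' \<subset> H else H \<subset> H')"

text \<open>The ascending chain condition if \<^term>\<open>up\<close> holds, the descending one otherwise.\<close>

definition chain_condition :: "bool \<Rightarrow> ('a, 'r) ring_scheme \<Rightarrow> ('a, 'm) module \<Rightarrow> bool" where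
  "chain_condition up A M \<longleftrightarrow>
     wf {(H, H'). submodule H A M \<and> submodule H' A M \<and> strictly_below up H H'}"

lemma chain_condition_minimal:
  assumes "chain_condition False A M" "H \<in> \<H>" "\<And>U. U \<in> \<H> \<Longrightarrow> submodule U A M"
  shows "\<exists>U\<in>\<H>. \<forall>V\<in>\<H>. V \<subseteq> U \<longrightarrow> V = U"
proof (rule wfE_min[OF assms(1)[unfolded chain_condition_def] assms(2)])
  fix U assume U: "U \<in> \<H>"
    and *: "\<And>V. (V, U) \<in> {(H, H'). submodule H A M \<and> submodule H' A M \<and> strictly_below False H H'} \<Longrightarrow> V \<notin> \<H>"
  have "V = U" if "V \<in> \<H>" "V \<subseteq> U" for V
    using *[of V] assms(3)[OF that(1)] assms(3)[OF U] that by (auto simp: strictly_below_def)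
  then show ?thesis using U by blast
qed

lemma chain_condition_maximal:
  assumes "chain_condition True A M" "H \<in> \<H>" "\<And>U. U \<in> \<H> \<Longrightarrow> submodule U A M"
  shows "\<exists>U\<in>\<H>. \<forall>V\<in>\<H>. U \<subseteq> V \<longrightarrow> V = U"
proof (rule wfE_min[OF assms(1)[unfolded chain_condition_def] assms(2)])
  fix U assume U: "U \<in> \<H>"
    and *: "\<And>V. (V, U) \<in> {(H, H'). submodule H A M \<and> submodule H' A M \<and> strictly_below True H H'} \<Longrightarrow> V \<notin> \<H>"
  have "V = U" if "V \<in> \<H>" "U \<subseteq> V" for V
    using *[of V] assms(3)[OF that(1)] assms(3)[OF U] that by (auto simp: strictly_below_def)
  then show ?thesis using U by blast
qed

text \<open>\<open>F\<close> preserves strict inclusions, whichever way they are read, so the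
  well-founded relation on submodules of \<open>N\<close> can be pulled back.\<close>

lemma chain_condition_map:
  assumes N: "chain_condition up B N"
    and sub: "\<And>H. submodule H A M \<Longrightarrow> submodule (F H) B N"
    and mono: "\<And>H H'. submodule H A M \<Longrightarrow> submodule H' A M \<Longrightarrow> H \<subseteq> H' \<Longrightarrow> F H \<subseteq> F H'"
    and strict: "\<And>H H'. submodule H A M \<Longrightarrow> submodule H' A M \<Longrightarrow> H \<subseteq> H' \<Longrightarrow> F H = F H' \<Longrightarrow> H = H'"
  shows "chain_condition up A M"
  unfolding chain_condition_def
proof -
  have key: "F H \<subset> F H'" if "submodule H A M" "submodule H' A M" "H \<subset> H'" for H H'
    using that mono[OF that(1,2)] strict[OF that(1,2)] by blast
  show "wf {(H, H'). submodule H A M \<and> submodule H' A M \<and> strictly_below up H H'}"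
  proof (rule wf_subset[OF wf_inv_image[OF N[unfolded chain_condition_def], of F]], rule subrelI)
  fix H H' assume "(H, H') \<in> {(H, H'). submodule H A M \<and> submodule H' A M \<and> strictly_below up H H'}"
  then show "(H, H') \<in> inv_image {(H, H'). submodule H B N \<and> submodule H' B N \<and> strictly_below up H H'} F"
    using sub key[of H H'] key[of H' H] by (auto simp: strictly_below_def split: if_splits)
  qed
qed

text \<open>Along a strict inclusion either \<open>F\<close> changes strictly, or \<open>F\<close>
  is constant and \<open>G\<close> changes strictly. This is descent in a lexicographic
  product.\<close>

lemma chain_condition_map_pair:
  assumes N: "chain_condition up B N" and N': "chain_condition up B' N'"
    and sub: "\<And>H. submodule H A M \<Longrightarrow> submodule (F H) B N"
    and sub': "\<And>H. submodule H A M \<Longrightarrow> submodule (G H) B' N'"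
    and mono: "\<And>H H'. submodule H A M \<Longrightarrow> submodule H' A M \<Longrightarrow> H \<subseteq> H' \<Longrightarrow> F H \<subseteq> F H' \<and> G H \<subseteq> G H'"
    and strict: "\<And>H H'. submodule H A M \<Longrightarrow> submodule H' A M \<Longrightarrow> H \<subseteq> H' \<Longrightarrow> F H = F H' \<Longrightarrow> G H = G H' \<Longrightarrow> H = H'"
  shows "chain_condition up A M"
  unfolding chain_condition_def
proof -
  have key: "F H \<subset> F H' \<or> F H = F H' \<and> G H \<subset> G H'"
    if "submodule H A M" "submodule H' A M" "H \<subset> H'" for H H'
    using that mono[OF that(1,2)] strict[OF that(1,2)] by blast
  show "wf {(H, H'). submodule H A M \<and> submodule H' A M \<and> strictly_below up H H'}"
  proof (rule wf_subset[OF wf_inv_image[OF wf_lex_prod[OF N[unfolded chain_condition_def] N'[unfolded chain_condition_def]],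
        of "\<lambda>H. (F H, G H)"]], rule subrelI)
  fix H H' assume "(H, H') \<in> {(H, H'). submodule H A M \<and> submodule H' A M \<and> strictly_below up H H'}"
  then show "(H, H') \<in> inv_image ({(H, H'). submodule H B N \<and> submodule H' B N \<and> strictly_below up H H'} <*lex*>
      {(H, H'). submodule H B' N' \<and> submodule H' B' N' \<and> strictly_below up H H'}) (\<lambda>H. (F H, G H))"
    using sub sub' key[of H H'] key[of H' H] by (auto simp: strictly_below_def split: if_splits)
  qed
qed

text \<open>Preimages under \<open>f\<close> are monotone, and surjectivity recovers a submodule as
  the image of its preimage.\<close>

lemma chain_condition_surj:
  assumes M: "left_module A M" and N: "left_module A N" and f: "f \<in> module_hom A M N"
    and surj: "f ` carrier M = carrier N" and chain: "chain_condition up A M"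
  shows "chain_condition up A N"
proof (rule chain_condition_map[OF chain])
  show "submodule {x \<in> carrier M. f x \<in> H} A M" if "submodule H A N" for H
    using vimage_submodule[OF M N f that] .
  show "H = H'" if "submodule H A N" "submodule H' A N"
    "{x \<in> carrier M. f x \<in> H} = {x \<in> carrier M. f x \<in> H'}" for H H'
  proof -
    have "H = f ` {x \<in> carrier M. f x \<in> H}" if "submodule H A N" for H
      using submodule_subset[OF that] surj by auto
    then show ?thesis using that by metis
  qed
qed auto

text \<open>A submodule is compared through its trace on the first summand and its image in the
  second. If both agree for \<open>H\<close> inside \<open>H'\<close>, an element of
  \<open>H'\<close> differs from one of \<open>H\<close> by an element of the common trace.\<close>

lemma chain_condition_direct_sum:
  assumes M: "left_module A M" and N: "left_module A N"
    and chain: "chain_condition up A M" "chain_condition up A N"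
  shows "chain_condition up A (direct_sum_module M N)"
proof (rule chain_condition_map_pair[OF chain])
  interpret M: left_module A M by (rule M)
  interpret N: left_module A N by (rule N)
  note D = direct_sum_left_module[OF M N]
  interpret D: left_module A "direct_sum_module M N" by (rule D)
  show "submodule {x \<in> carrier M. (\<lambda>x\<in>carrier M. (x, \<zero>\<^bsub>N\<^esub>)) x \<in> H} A M"
    if "submodule H A (direct_sum_module M N)" for H
    by (rule vimage_submodule[OF M D hom_inl[OF M N] that])
  show "submodule ((\<lambda>x\<in>carrier M \<times> carrier N. snd x) ` H) A N"
    if "submodule H A (direct_sum_module M N)" for H
    by (rule image_submodule[OF D N hom_snd[OF M N] that])
  show "H = H'" if H: "submodule H A (direct_sum_module M N)" and H': "submodule H' A (direct_sum_module M N)"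
    and sub: "H \<subseteq> H'"
    and F: "{x \<in> carrier M. (\<lambda>x\<in>carrier M. (x, \<zero>\<^bsub>N\<^esub>)) x \<in> H} = {x \<in> carrier M. (\<lambda>x\<in>carrier M. (x, \<zero>\<^bsub>N\<^esub>)) x \<in> H'}"
    and G: "(\<lambda>x\<in>carrier M \<times> carrier N. snd x) ` H = (\<lambda>x\<in>carrier M \<times> carrier N. snd x) ` H'" for H H'
  proof (rule equalityI[OF sub], rule subsetI)
    fix z assume z: "z \<in> H'"
    have c: "H \<subseteq> carrier M \<times> carrier N" "H' \<subseteq> carrier M \<times> carrier N"
      using submodule_subset[OF H] submodule_subset[OF H'] by auto
    obtain x y where xy: "z = (x, y)" "x \<in> carrier M" "y \<in> carrier N" using z c by auto
    have "y \<in> (\<lambda>x\<in>carrier M \<times> carrier N. snd x) ` H" unfolding G using z xy by force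
    then obtain x' where x': "(x', y) \<in> H" "x' \<in> carrier M" using c by force
    have eq: "z = (x \<ominus>\<^bsub>M\<^esub> x', \<zero>\<^bsub>N\<^esub>) \<oplus>\<^bsub>direct_sum_module M N\<^esub> (x', y)"
      using xy x' by (simp add: M.diff_add_cancel)
    then have "(x \<ominus>\<^bsub>M\<^esub> x', \<zero>\<^bsub>N\<^esub>) = z \<ominus>\<^bsub>direct_sum_module M N\<^esub> (x', y)"
      using D.diff_add_cancel(3)[of "(x \<ominus>\<^bsub>M\<^esub> x', \<zero>\<^bsub>N\<^esub>)" "(x', y)"] xy x' by (simp del: direct_sum_add)
    then have "(x \<ominus>\<^bsub>M\<^esub> x', \<zero>\<^bsub>N\<^esub>) \<in> H'" using submodule_diff[OF H' z] x'(1) sub by auto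
    then have "x \<ominus>\<^bsub>M\<^esub> x' \<in> {x \<in> carrier M. (\<lambda>x\<in>carrier M. (x, \<zero>\<^bsub>N\<^esub>)) x \<in> H}"
      unfolding F using xy x' by simp
    then have "(x \<ominus>\<^bsub>M\<^esub> x', \<zero>\<^bsub>N\<^esub>) \<in> H" using xy x' by simp
    then show "z \<in> H" unfolding eq using submodule_add[OF H _ x'(1)] by (simp del: direct_sum_add)
  qed
qed auto

lemma chain_condition_zero:
  assumes "left_module A M" "carrier M = {\<zero>\<^bsub>M\<^esub>}" shows "chain_condition up A M"
proof -
  have "H = {\<zero>\<^bsub>M\<^esub>}" if "submodule H A M" for H
    using submodule_subset[OF that] submodule_zero[OF that] assms(2) by blast
  then have "{(H, H'). submodule H A M \<and> submodule H' A M \<and> strictly_below up H H'} = {}"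
    by (auto simp: strictly_below_def split: if_splits)
  then show ?thesis unfolding chain_condition_def by (metis wf_on_bot bot_set_def empty_def wf_subset wf_less_than empty_subsetI)
qed

text \<open>The condition climbs from the regular module to free modules by direct sums and passes
  to \<open>M\<close> along a free cover.\<close>

lemma chain_condition_fg:
  assumes ring: "ring A" and chain: "chain_condition up A (regular_module A)" and M: "fg_module A M"
  shows "chain_condition up A M"
proof -
  have free: "chain_condition up A F" if "free_module A F" for F
    using that
  proof (induction rule: free_module.induct)
    case (zero F)
    then show ?case by (rule chain_condition_zero)
  next
    case (step F F')
    note reg = regular_left_module[OF ring] and F = fg_left_module[OF free_fg[OF step(1)]]
    show ?case
      using step(3) chain_condition_surj[OF direct_sum_left_module[OF reg F] fg_left_module[OF step(2)]
        _ _ chain_condition_direct_sum[OF reg F chain step.IH]]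
      by (auto simp: module_iso_def bij_betw_def)
  qed
  obtain F f where F: "free_module A F" "f \<in> module_hom A F M" "f ` carrier F = carrier M"
    using free_cover[OF M] by blast
  show ?thesis
    using chain_condition_surj[OF fg_left_module[OF free_fg[OF F(1)]] fg_left_module[OF M] F(2,3) free[OF F(1)]] .
qed

text \<open>The variable \<open>up\<close> is left general in the assumption, so both the ascending
  and the descending condition are required.\<close>

locale finite_length_ring = ring A for A :: "('a, 'r) ring_scheme" +
  assumes chain_regular: "chain_condition up A (regular_module A)"
begin

lemma chain_fg: "fg_module A M \<Longrightarrow> chain_condition up A M"
  by (rule chain_condition_fg[OF ring_axioms chain_regular])

text \<open>Let \<open>U\<close> be maximal among the finitely generated submodules contained in
  \<open>H\<close>. For \<open>s\<close> in \<open>H\<close>, the submodule generated by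
  \<open>U\<close> and \<open>s\<close> is again of this kind, so it equals \<open>U\<close> and
  \<open>s\<close> lies in \<open>U\<close>.\<close>

lemma fg_submodule:
  assumes M: "fg_module A M" and H: "submodule H A M"
  shows "fg_module A (M\<lparr>carrier := H\<rparr>)"
proof -
  note lm = fg_left_module[OF M] and zc = zero_closed and oc = one_closed
  interpret left_module A M by (rule lm)
  let ?\<H> = "{U. submodule U A M \<and> U \<subseteq> H \<and> fg_module A (M\<lparr>carrier := U\<rparr>)}"
  have 0: "{\<zero>\<^bsub>M\<^esub>} \<in> ?\<H>"
    using zero_submodule[OF lm] submodule_zero[OF H] submodule_left_module[OF lm zero_submodule[OF lm]]
    by (auto intro!: zero_fg)
  have "\<exists>U\<in>?\<H>. \<forall>V\<in>?\<H>. U \<subseteq> V \<longrightarrow> V = U"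
    by (rule chain_condition_maximal[OF chain_fg[OF M] 0]) simp
  then obtain U where U': "U \<in> ?\<H>" and max: "\<forall>V\<in>?\<H>. U \<subseteq> V \<longrightarrow> V = U" ..
  have U: "submodule U A M" "U \<subseteq> H" "fg_module A (M\<lparr>carrier := U\<rparr>)" using U' by auto
  note lmU = submodule_left_module[OF lm U(1)] and reg = regular_left_module[OF ring_axioms]
  have "s \<in> U" if s: "s \<in> H" for s
  proof -
    have sM: "s \<in> carrier M" using s submodule_subset[OF H] by blast
    define D where "D = direct_sum_module (M\<lparr>carrier := U\<rparr>) (regular_module A)"
    define g where "g = (\<lambda>x\<in>carrier (M\<lparr>carrier := U\<rparr>) \<times> carrier (regular_module A).
       (\<lambda>x\<in>U. x) (fst x) \<oplus>\<^bsub>M\<^esub> (\<lambda>a\<in>carrier A. a \<odot>\<^bsub>M\<^esub> s) (snd x))"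
    have g: "g \<in> module_hom A D M"
      unfolding g_def D_def
      by (rule hom_copair[OF lmU reg lm hom_incl[OF lm U(1)] hom_from_regular[OF lm sM]])
    have fgD: "fg_module A D" unfolding D_def by (rule fg_direct_sum[OF U(3) regular_fg[OF ring_axioms]])
    note lmD = fg_left_module[OF fgD]
    define V where "V = g ` carrier D"
    have V: "submodule V A M" unfolding V_def by (rule image_submodule[OF lmD lm g carrier_submodule[OF lmD]])
    have "fg_module A (M\<lparr>carrier := V\<rparr>)"
      by (rule fg_surj[OF fgD submodule_left_module[OF lm V] hom_codom[OF g]]) (auto simp: V_def)
    moreover have gval: "g (u, a) = u \<oplus>\<^bsub>M\<^esub> a \<odot>\<^bsub>M\<^esub> s" if "u \<in> U" "a \<in> carrier A" for u a
      using that by (simp add: g_def)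
    moreover have "g x \<in> H" if "x \<in> carrier D" for x
    proof -
      obtain u a where x: "x = (u, a)" "u \<in> U" "a \<in> carrier A" using \<open>x \<in> carrier D\<close> by (auto simp: D_def)
      have "u \<in> H" using x U(2) by blast
      then show ?thesis
        unfolding x(1) gval[OF x(2,3)] by (rule submodule_add[OF H _ submodule_smult[OF H x(3) s]])
    qed
    then have "V \<subseteq> H" unfolding V_def by (rule image_subsetI)
    moreover note \<open>V \<subseteq> H\<close>
    moreover have "u \<in> V" if u: "u \<in> U" for u
      unfolding V_def using gval[OF u zc] sM u submodule_subset[OF U(1)]
      by (intro image_eqI[of _ _ "(u, \<zero>\<^bsub>A\<^esub>)"]) (auto simp: D_def smult_zero_left)
    moreover have "s \<in> V"
      unfolding V_def using gval[OF submodule_zero[OF U(1)] oc] sM submodule_zero[OF U(1)]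
      by (intro image_eqI[of _ _ "(\<zero>\<^bsub>M\<^esub>, \<one>\<^bsub>A\<^esub>)"]) (auto simp: D_def)
    ultimately show ?thesis using bspec[OF max, of V] V by blast
  qed
  then have "U = H" using U(2) by blast
  then show ?thesis using U(3) by simp
qed

end

section \<open>Direct decompositions and Fitting's lemma\<close>

definition internal_sum :: "('a, 'r) ring_scheme \<Rightarrow> ('a, 'm) module \<Rightarrow> 'm set \<Rightarrow> 'm set \<Rightarrow> bool" where
  "internal_sum A Q H U \<longleftrightarrow> submodule H A Q \<and> submodule U A Q \<and> H \<inter> U = {\<zero>\<^bsub>Q\<^esub>} \<and> H <+>\<^bsub>Q\<^esub> U = carrier Q"

lemma indecomposable_iff:
  "indecomposable_module A M \<longleftrightarrow> carrier M \<noteq> {\<zero>\<^bsub>M\<^esub>} \<and>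
     (\<forall>H U. internal_sum A M H U \<longrightarrow> H = {\<zero>\<^bsub>M\<^esub>} \<or> U = {\<zero>\<^bsub>M\<^esub>})"
  by (auto simp: indecomposable_module_def internal_sum_def)

lemma internal_sumD:
  assumes "internal_sum A Q H U"
  shows "submodule H A Q" "submodule U A Q" "H \<inter> U = {\<zero>\<^bsub>Q\<^esub>}" "H <+>\<^bsub>Q\<^esub> U = carrier Q"
  using assms by (auto simp: internal_sum_def)

lemma internal_sum_decompose:
  assumes "internal_sum A Q H U" "x \<in> carrier Q"
  obtains h u where "h \<in> H" "u \<in> U" "x = h \<oplus>\<^bsub>Q\<^esub> u"
  using assms unfolding internal_sum_def by (metis mem_set_add)

lemma internal_sumI:
  assumes "left_module A Q" and H: "submodule H A Q" and U: "submodule U A Q"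
    and "\<And>x. x \<in> H \<Longrightarrow> x \<in> U \<Longrightarrow> x = \<zero>\<^bsub>Q\<^esub>"
    and "\<And>x. x \<in> carrier Q \<Longrightarrow> \<exists>h\<in>H. \<exists>u\<in>U. x = h \<oplus>\<^bsub>Q\<^esub> u"
  shows "internal_sum A Q H U"
proof -
  have "H <+>\<^bsub>Q\<^esub> U = carrier Q"
    using assms(5) submodule_subset[OF sum_submodule[OF assms(1-3)]] by (auto simp: mem_set_add)
  then show ?thesis
    using H U assms(4) submodule_zero[OF H] submodule_zero[OF U] unfolding internal_sum_def by blast
qed

lemma internal_sum_sym:
  assumes Q: "left_module A Q" and sum: "internal_sum A Q H U"
  shows "internal_sum A Q U H"
proof -
  interpret left_module A Q by (rule Q)
  note D = internal_sumD[OF sum]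
  show ?thesis
  proof (rule internal_sumI[OF Q D(2,1)])
    fix x assume "x \<in> carrier Q"
    then obtain h u where "h \<in> H" "u \<in> U" "x = h \<oplus>\<^bsub>Q\<^esub> u" by (rule internal_sum_decompose[OF sum])
    then show "\<exists>u\<in>U. \<exists>h\<in>H. x = u \<oplus>\<^bsub>Q\<^esub> h"
      using submodule_subset[OF D(1)] submodule_subset[OF D(2)] M.a_comm by blast
  qed (use D(3) in blast)
qed

text \<open>The sum map from the external direct sum is bijective. Its inverse followed by the first
  projection is the projection onto \<open>H\<close> along \<open>U\<close>.\<close>

lemma internal_sum_projection:
  assumes Q: "left_module A Q" and sum: "internal_sum A Q H U"
  obtains p where "p \<in> module_hom A Q Q" "\<And>x. x \<in> H \<Longrightarrow> p x = x" "\<And>x. x \<in> U \<Longrightarrow> p x = \<zero>\<^bsub>Q\<^esub>"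
    "p ` carrier Q = H" "\<And>x. x \<in> carrier Q \<Longrightarrow> p x = \<zero>\<^bsub>Q\<^esub> \<Longrightarrow> x \<in> U"
proof -
  interpret left_module A Q by (rule Q)
  note D = internal_sumD[OF sum]
  note lm = submodule_left_module[OF Q D(1)] submodule_left_module[OF Q D(2)]
  have c: "x \<in> carrier Q" if "x \<in> H \<or> x \<in> U" for x
    using that submodule_subset[OF D(1)] submodule_subset[OF D(2)] by blast
  let ?D = "direct_sum_module (Q\<lparr>carrier := H\<rparr>) (Q\<lparr>carrier := U\<rparr>)"
  define s where "s = (\<lambda>x\<in>H \<times> U. (\<lambda>x\<in>H. x) (fst x) \<oplus>\<^bsub>Q\<^esub> (\<lambda>x\<in>U. x) (snd x))"
  have s: "s \<in> module_hom A ?D Q"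
    using hom_copair[OF lm Q hom_incl[OF Q D(1)] hom_incl[OF Q D(2)]] by (simp add: s_def)
  have sval: "s (h, u) = h \<oplus>\<^bsub>Q\<^esub> u" if "h \<in> H" "u \<in> U" for h u using that by (simp add: s_def)
  have surj: "s ` carrier ?D = carrier Q"
  proof (rule equalityI)
    show "carrier Q \<subseteq> s ` carrier ?D"
    proof
      fix x assume "x \<in> carrier Q"
      then obtain h u where "h \<in> H" "u \<in> U" "x = h \<oplus>\<^bsub>Q\<^esub> u" by (rule internal_sum_decompose[OF sum])
      then show "x \<in> s ` carrier ?D" using sval by (intro image_eqI[of _ _ "(h, u)"]) auto
    qed
  qed (use hom_closed[OF s] in blast)
  have zero: "h = \<zero>\<^bsub>Q\<^esub> \<and> u = \<zero>\<^bsub>Q\<^esub>" if "h \<in> H" "u \<in> U" "h \<oplus>\<^bsub>Q\<^esub> u = \<zero>\<^bsub>Q\<^esub>" for h u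
  proof -
    have "h = \<ominus>\<^bsub>Q\<^esub> u" using that c by (simp add: M.minus_equality)
    then have "h \<in> U" using submodule_minus[OF D(2) that(2)] by simp
    then have "h = \<zero>\<^bsub>Q\<^esub>" using D(3) that by blast
    then show ?thesis using that c by simp
  qed
  have "ker_module ?D Q s = {\<zero>\<^bsub>?D\<^esub>}"
    using zero sval submodule_zero[OF D(1)] submodule_zero[OF D(2)] by (auto simp: ker_module_def)
  then have "bij_betw s (carrier ?D) (carrier Q)"
    using surj hom_inj_iff[OF direct_sum_left_module[OF lm] Q s] by (auto simp: bij_betw_def)
  then obtain t where t: "t \<in> module_hom A Q ?D" "\<And>x. x \<in> carrier ?D \<Longrightarrow> t (s x) = x"
    using iso_inverse[OF direct_sum_left_module[OF lm] Q s] by metis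
  have f: "(\<lambda>x\<in>H \<times> U. fst x) \<in> module_hom A ?D Q"
    using hom_codomD[OF hom_fst[OF lm]] submodule_subset[OF D(1)] by simp
  define p where "p = (\<lambda>x\<in>carrier Q. (\<lambda>x\<in>H \<times> U. fst x) (t x))"
  have p: "p \<in> module_hom A Q Q" unfolding p_def by (rule hom_comp[OF Q t(1) f])
  have pval: "p (h \<oplus>\<^bsub>Q\<^esub> u) = h" if "h \<in> H" "u \<in> U" for h u
    using t(2)[of "(h, u)"] that sval c by (simp add: p_def)
  have pH: "p h = h" if "h \<in> H" for h using pval[OF that submodule_zero[OF D(2)]] that c by simp
  have pU: "p u = \<zero>\<^bsub>Q\<^esub>" if "u \<in> U" for u using pval[OF submodule_zero[OF D(1)] that] that c by simp
  have "p ` carrier Q = H"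
  proof (rule equalityI)
    show "p ` carrier Q \<subseteq> H"
      using pval by (auto elim!: internal_sum_decompose[OF sum])
    show "H \<subseteq> p ` carrier Q" using pH c by (metis imageI subsetI)
  qed
  moreover have "x \<in> U" if "x \<in> carrier Q" "p x = \<zero>\<^bsub>Q\<^esub>" for x
    using that(1)
  proof (rule internal_sum_decompose[OF sum])
    fix h u assume "h \<in> H" "u \<in> U" "x = h \<oplus>\<^bsub>Q\<^esub> u"
    then show "x \<in> U" using pval[of h u] that(2) c by simp
  qed
  ultimately show thesis using that[OF p pH pU] by blast
qed

lemma internal_sum_idempotent:
  assumes Q: "left_module A Q" and p: "p \<in> module_hom A Q Q"
    and idem: "\<And>x. x \<in> carrier Q \<Longrightarrow> p (p x) = p x"
  shows "internal_sum A Q (p ` carrier Q) (ker_module Q Q p)"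
proof (rule internal_sumI[OF Q image_submodule[OF Q Q p carrier_submodule[OF Q]] ker_submodule[OF Q Q p]])
  interpret left_module A Q by (rule Q)
  fix x assume x: "x \<in> carrier Q"
  have "x \<ominus>\<^bsub>Q\<^esub> p x \<in> ker_module Q Q p"
    using x hom_closed[OF p] idem by (simp add: ker_module_def hom_diff[OF Q Q p])
  moreover have "x = p x \<oplus>\<^bsub>Q\<^esub> (x \<ominus>\<^bsub>Q\<^esub> p x)" using x hom_closed[OF p] by (simp add: diff_add_cancel)
  ultimately show "\<exists>h\<in>p ` carrier Q. \<exists>u\<in>ker_module Q Q p. x = h \<oplus>\<^bsub>Q\<^esub> u" using x by blast
qed (auto simp: ker_module_def idem)

lemma summand_projective:
  assumes Q: "projective_module A Q" and sum: "internal_sum A Q H U"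
  shows "projective_module A (Q\<lparr>carrier := H\<rparr>)"
proof -
  note lm = projective_left_module[OF Q]
  note D = internal_sumD[OF sum]
  obtain p where p: "p \<in> module_hom A Q Q" "\<And>x. x \<in> H \<Longrightarrow> p x = x" "p ` carrier Q = H"
    using internal_sum_projection[OF lm sum] by metis
  show ?thesis
    using p by (intro projective_retract[OF Q submodule_left_module[OF lm D(1)] hom_codom[OF p(1)] hom_incl[OF lm D(1)]])
      auto
qed

text \<open>A summand of the summand \<open>H\<close> is a summand of \<open>Q\<close> with a larger
  complement. Hence splitting a minimal summand further would contradict its minimality, which is
  how minimal maps are produced.\<close>

lemma internal_sum_refine:
  assumes Q: "left_module A Q" and sum: "internal_sum A Q H U"
    and sum': "internal_sum A (Q\<lparr>carrier := H\<rparr>) V W"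
  shows "internal_sum A Q V (W <+>\<^bsub>Q\<^esub> U)"
proof -
  interpret left_module A Q by (rule Q)
  note D = internal_sumD[OF sum] and D' = internal_sumD[OF sum']
  have V: "submodule V A Q" "V \<subseteq> H" and W: "submodule W A Q" "W \<subseteq> H"
    using D'(1,2) submodule_of_submodule[OF Q D(1)] by auto
  have c: "x \<in> carrier Q" if "x \<in> H \<or> x \<in> U" for x
    using that submodule_subset[OF D(1)] submodule_subset[OF D(2)] by blast
  show ?thesis
  proof (rule internal_sumI[OF Q V(1) sum_submodule[OF Q W(1) D(2)]])
    fix x assume x: "x \<in> V" "x \<in> W <+>\<^bsub>Q\<^esub> U"
    then obtain w u where wu: "w \<in> W" "u \<in> U" "x = w \<oplus>\<^bsub>Q\<^esub> u" by (auto simp: mem_set_add)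
    have "u = x \<ominus>\<^bsub>Q\<^esub> w" using wu W(2) c by (simp add: diff_add_cancel subset_eq)
    then have "u \<in> H" using submodule_diff[OF D(1)] x(1) wu(1) V(2) W(2) by blast
    then have "u = \<zero>\<^bsub>Q\<^esub>" using D(3) wu(2) by blast
    then have "x = w" using wu W(2) c by auto
    then show "x = \<zero>\<^bsub>Q\<^esub>" using D'(3) x(1) wu(1) by auto
  next
    fix x assume "x \<in> carrier Q"
    then obtain h u where hu: "h \<in> H" "u \<in> U" "x = h \<oplus>\<^bsub>Q\<^esub> u" by (rule internal_sum_decompose[OF sum])
    obtain v w where vw: "v \<in> V" "w \<in> W" "h = v \<oplus>\<^bsub>Q\<^esub> w"
      using internal_sum_decompose[OF sum', of h] hu(1) by auto
    have "x = v \<oplus>\<^bsub>Q\<^esub> (w \<oplus>\<^bsub>Q\<^esub> u)" using hu vw c V(2) W(2) by (auto simp: M.a_assoc subset_eq)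
    moreover have "w \<oplus>\<^bsub>Q\<^esub> u \<in> W <+>\<^bsub>Q\<^esub> U" using vw(2) hu(2) unfolding mem_set_add by blast
    ultimately show "\<exists>h\<in>V. \<exists>u\<in>W <+>\<^bsub>Q\<^esub> U. x = h \<oplus>\<^bsub>Q\<^esub> u" using vw(1) by blast
  qed
qed

lemma internal_sum_iso:
  assumes M: "left_module A M" and N: "left_module A N" and f: "f \<in> module_hom A M N"
    and bij: "bij_betw f (carrier M) (carrier N)" and sum: "internal_sum A M H U"
  shows "internal_sum A N (f ` H) (f ` U)"
proof -
  note D = internal_sumD[OF sum]
  have c: "x \<in> carrier M" if "x \<in> H \<or> x \<in> U" for x
    using that submodule_subset[OF D(1)] submodule_subset[OF D(2)] by blast
  show ?thesis
  proof (rule internal_sumI[OF N image_submodule[OF M N f D(1)] image_submodule[OF M N f D(2)]])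
    fix x assume "x \<in> f ` H" "x \<in> f ` U"
    then obtain h u where hu: "h \<in> H" "u \<in> U" "x = f h" "f h = f u" by auto
    then have "h = u" using bij c by (auto simp: bij_betw_def dest: inj_onD)
    then have "h = \<zero>\<^bsub>M\<^esub>" using D(3) hu by blast
    then show "x = \<zero>\<^bsub>N\<^esub>" using hu hom_zero[OF M N f] by simp
  next
    fix x assume "x \<in> carrier N"
    then obtain y where y: "y \<in> carrier M" "x = f y" using bij by (auto simp: bij_betw_def)
    then obtain h u where "h \<in> H" "u \<in> U" "y = h \<oplus>\<^bsub>M\<^esub> u" using internal_sum_decompose[OF sum] by metis
    then show "\<exists>h\<in>f ` H. \<exists>u\<in>f ` U. x = h \<oplus>\<^bsub>N\<^esub> u" using y c hom_add[OF f] by blast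
  qed
qed

lemma indecomposable_iso:
  assumes M: "left_module A M" and N: "left_module A N" and iso: "module_iso A M N"
    and ind: "indecomposable_module A M"
  shows "indecomposable_module A N"
proof -
  obtain f where f: "f \<in> module_hom A M N" "bij_betw f (carrier M) (carrier N)"
    using iso by (auto simp: module_iso_def)
  obtain g where g: "g \<in> module_hom A N M" "bij_betw g (carrier N) (carrier M)"
    "\<And>y. y \<in> carrier N \<Longrightarrow> f (g y) = y"
    using iso_inverse[OF M N f] by metis
  have "carrier N \<noteq> {\<zero>\<^bsub>N\<^esub>}"
  proof
    assume "carrier N = {\<zero>\<^bsub>N\<^esub>}"
    then have "carrier M = {\<zero>\<^bsub>M\<^esub>}" using bij_betw_imp_surj_on[OF g(2)] hom_zero[OF N M g(1)] by simp
    then show False using ind by (simp add: indecomposable_iff)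
  qed
  moreover have "H = {\<zero>\<^bsub>N\<^esub>} \<or> U = {\<zero>\<^bsub>N\<^esub>}" if sum: "internal_sum A N H U" for H U
  proof -
    have *: "V = {\<zero>\<^bsub>N\<^esub>}" if "V \<subseteq> carrier N" "g ` V = {\<zero>\<^bsub>M\<^esub>}" for V
    proof -
      have "f ` g ` V = V" using that(1) g(3) by (force simp: image_image)
      then show ?thesis using that(2) hom_zero[OF M N f(1)] by simp
    qed
    have "g ` H = {\<zero>\<^bsub>M\<^esub>} \<or> g ` U = {\<zero>\<^bsub>M\<^esub>}"
      using internal_sum_iso[OF N M g(1,2) sum] ind by (auto simp: indecomposable_iff)
    then show ?thesis
      using *[OF submodule_subset[OF internal_sumD(1)[OF sum]]] *[OF submodule_subset[OF internal_sumD(2)[OF sum]]]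
      by blast
  qed
  ultimately show ?thesis by (simp add: indecomposable_iff)
qed

section \<open>Iterates of an endomorphism and Fitting's lemma\<close>

lemma hom_funpow:
  assumes Q: "left_module A Q" and t: "t \<in> module_hom A Q Q"
  shows "(\<lambda>x\<in>carrier Q. (t ^^ n) x) \<in> module_hom A Q Q"
proof (induction n)
  case 0
  then show ?case using hom_id[OF Q] by (simp add: restrict_def)
next
  case (Suc n)
  then show ?case using hom_comp[OF Q Suc t] by (simp add: restrict_def cong: if_cong)
qed

text \<open>Images of powers descend and kernels ascend, so both become stationary. If image and
  kernel agree for the powers n and 2n, then t^n x = t^(2n) y for some y, and x is t^n y plus an
  element of the kernel. The exponent is a successor so that the power contains a factor
  \<open>t\<close>, as the applications require.\<close>

lemma (in finite_length_ring) fitting: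
  assumes fgQ: "fg_module A Q" and t: "t \<in> module_hom A Q Q"
  obtains n where "internal_sum A Q ((t ^^ Suc n) ` carrier Q) {x \<in> carrier Q. (t ^^ Suc n) x = \<zero>\<^bsub>Q\<^esub>}"
proof -
  note Q = fg_left_module[OF fgQ]
  interpret Q: left_module A Q by (rule Q)
  define I where "I n = (t ^^ n) ` carrier Q" for n
  define N where "N n = {x \<in> carrier Q. (t ^^ n) x = \<zero>\<^bsub>Q\<^esub>}" for n
  have cl: "(t ^^ n) x \<in> carrier Q" if "x \<in> carrier Q" for n x
    using hom_closed[OF hom_funpow[OF Q t, of n] that] that by simp
  have diff: "(t ^^ n) (x \<ominus>\<^bsub>Q\<^esub> y) = (t ^^ n) x \<ominus>\<^bsub>Q\<^esub> (t ^^ n) y" if "x \<in> carrier Q" "y \<in> carrier Q" for n x y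
    using hom_diff[OF Q Q hom_funpow[OF Q t, of n] that] that by simp
  have zero: "(t ^^ n) \<zero>\<^bsub>Q\<^esub> = \<zero>\<^bsub>Q\<^esub>" for n
    using hom_zero[OF Q Q hom_funpow[OF Q t, of n]] by simp
  have I: "submodule (I n) A Q" for n
    using image_submodule[OF Q Q hom_funpow[OF Q t, of n] carrier_submodule[OF Q]] by (simp add: I_def)
  have N: "submodule (N n) A Q" for n
    using ker_submodule[OF Q Q hom_funpow[OF Q t, of n]] by (simp add: N_def ker_module_def cong: conj_cong)
  have I_mono: "I (n + k) \<subseteq> I n" for n k
    using cl by (auto simp: I_def funpow_add)
  have N_mono: "N n \<subseteq> N (n + k)" for n k
    using zero by (auto simp: N_def funpow_add add.commute[of n])
  obtain a where a: "\<And>m. I m \<subseteq> I a \<Longrightarrow> I m = I a"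
  proof -
    have sub: "submodule U A Q" if "U \<in> range I" for U using that I by blast
    obtain k where "\<forall>V\<in>range I. V \<subseteq> I k \<longrightarrow> V = I k"
      using chain_condition_minimal[OF chain_fg[OF fgQ] rangeI[of I 0] sub] by auto
    then show thesis by (intro that[of k]) simp
  qed
  obtain b where b: "\<And>m. N b \<subseteq> N m \<Longrightarrow> N m = N b"
  proof -
    have sub: "submodule U A Q" if "U \<in> range N" for U using that N by blast
    obtain k where "\<forall>V\<in>range N. N k \<subseteq> V \<longrightarrow> V = N k"
      using chain_condition_maximal[OF chain_fg[OF fgQ] rangeI[of N 0] sub] by auto
    then show thesis by (intro that[of k]) simp
  qed
  \<comment> \<open>This index is beyond both stationary points \<open>a\<close> and
    \<open>b\<close>, and so is its double.\<close>
  define n where "n = Suc (a + b)"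
  have In: "I (n + n) = I n"
    using a[of n] a[of "n + n"] I_mono[of a "Suc b"] I_mono[of a "Suc (Suc (a + b) + b)"] by (simp add: n_def ac_simps)
  have Nn: "N (n + n) = N n"
    using b[of n] b[of "n + n"] N_mono[of b "Suc a"] N_mono[of b "Suc (Suc (a + b) + a)"] by (simp add: n_def ac_simps)
  have "internal_sum A Q (I n) (N n)"
  proof (rule internal_sumI[OF Q I N])
    fix x assume "x \<in> I n" "x \<in> N n"
    then obtain y where y: "y \<in> carrier Q" "x = (t ^^ n) y" "(t ^^ n) x = \<zero>\<^bsub>Q\<^esub>" by (auto simp: I_def N_def)
    then have "y \<in> N (n + n)" by (simp add: N_def funpow_add)
    then show "x = \<zero>\<^bsub>Q\<^esub>" using y(2) by (simp add: Nn) (simp add: N_def)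
  next
    fix x assume x: "x \<in> carrier Q"
    have "(t ^^ n) x \<in> I (n + n)" unfolding In using x by (auto simp: I_def)
    then obtain y where y: "y \<in> carrier Q" "(t ^^ n) x = (t ^^ n) ((t ^^ n) y)" by (auto simp: I_def funpow_add)
    have "x \<ominus>\<^bsub>Q\<^esub> (t ^^ n) y \<in> N n" using x y cl by (simp add: N_def diff)
    moreover have "x = (t ^^ n) y \<oplus>\<^bsub>Q\<^esub> (x \<ominus>\<^bsub>Q\<^esub> (t ^^ n) y)" using x y cl by (simp add: Q.diff_add_cancel)
    moreover have "(t ^^ n) y \<in> I n" using y by (auto simp: I_def)
    ultimately show "\<exists>h\<in>I n. \<exists>u\<in>N n. x = h \<oplus>\<^bsub>Q\<^esub> u" by blast
  qed
  then show thesis using that[of "a + b"] by (simp add: I_def N_def n_def)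
qed

section \<open>Artinian commutative rings with an injective cogenerator\<close>

lemma (in cring) ideal_iff_submodule: "ideal I R \<longleftrightarrow> submodule I R (regular_module R)"
proof
  assume "ideal I R"
  then interpret I: ideal I R .
  show "submodule I R (regular_module R)"
    by (rule submodule_intro[OF regular_left_module[OF ring_axioms]]) (auto simp: I.I_l_closed I.a_subset)
next
  assume I: "submodule I R (regular_module R)"
  have sub: "I \<subseteq> carrier R" using submodule_subset[OF I] by simp
  have cl: "a \<otimes> x \<in> I" if "a \<in> carrier R" "x \<in> I" for a x
    using submodule_smult[OF I that] by simp
  have "\<ominus> x \<in> I" if "x \<in> I" for x
    using cl[of "\<ominus> \<one>" x] that sub by (auto simp: l_minus subset_eq)
  moreover have "x \<oplus> y \<in> I" if "x \<in> I" "y \<in> I" for x y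
    using submodule_add[OF I that] by simp
  ultimately have "subgroup I (add_monoid R)"
    using sub submodule_zero[OF I] by (intro add.subgroupI) (auto simp flip: a_inv_def)
  then show "ideal I R"
    using cl sub by (intro idealI[OF ring_axioms]) (metis m_comm subsetD)+
qed

lemma (in cring) submodule_is_ideal: "submodule I R (regular_module R) \<Longrightarrow> ideal I R"
  by (simp add: ideal_iff_submodule)

lemma artinian_descending_chain:
  assumes R: "artinian_cring R"
  shows "chain_condition False R (regular_module R)"
  unfolding chain_condition_def wf_iff_no_infinite_down_chain
proof
  interpret cring R using R by (simp add: artinian_cring_def)
  assume "\<exists>f. \<forall>i. (f (Suc i), f i) \<in> {(H, H'). submodule H R (regular_module R) \<and>
    submodule H' R (regular_module R) \<and> strictly_below False H H'}"
  then obtain f where f: "\<And>i. submodule (f i) R (regular_module R)" "\<And>i. f (Suc i) \<subset> f i"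
    unfolding strictly_below_def by simp blast
  have "(\<forall>i. ideal (f i) R) \<and> (\<forall>i. f (Suc i) \<subseteq> f i)"
    using submodule_is_ideal[OF f(1)] psubset_imp_subset[OF f(2)] by blast
  then obtain k where k: "\<forall>i\<ge>k. f i = f k"
    using R[unfolded artinian_cring_def, THEN conjunct2, THEN spec, of f] by blast
  have "f (Suc k) = f k" by (rule k[rule_format]) simp
  then show False using f(2)[of k] by simp
qed

locale artinian_cogenerator = cring R for R :: "('r, 'x) ring_scheme" (structure) +
  fixes J :: "('r, 'j) module" and \<iota> :: "'r set \<Rightarrow> 'j"
  assumes artinian: "artinian_cring R"
    and envelope: "injective_envelope R (quot_module (regular_module R) (jacobson_radical R)) J \<iota>"
begin

lemma J_injective: "injective_module R J"
  using envelope by (simp add: injective_envelope_def)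

lemma J_left_module: "left_module R J"
  using J_injective by (rule injective_left_module)

text \<open>An ideal \<open>E\<close> minimal among those not contained in \<open>m\<close> lies in
  every other maximal ideal \<open>n\<close>: for \<open>e\<close> in \<open>E\<close> and
  \<open>b\<close> in \<open>n\<close>, both outside the prime ideal \<open>m\<close>, their product
  shows that the intersection of \<open>E\<close> and \<open>n\<close> is not inside
  \<open>m\<close>, so it is \<open>E\<close>. This takes the place of the Chinese remainder
  theorem.\<close>

lemma maximalideal_separate:
  assumes m: "maximalideal m R"
  obtains e where "e \<in> carrier R" "e \<notin> m" "\<And>n. maximalideal n R \<Longrightarrow> n \<noteq> m \<Longrightarrow> e \<in> n"
proof -
  note reg = regular_left_module[OF ring_axioms]
  interpret m: maximalideal m R by (rule m)
  have pm: "primeideal m R" by (rule maximalideal_prime[OF m])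
  let ?S = "{I. submodule I R (regular_module R) \<and> \<not> I \<subseteq> m}"
  have S: "carrier R \<in> ?S"
    using carrier_submodule[OF reg] m.I_notcarr m.a_subset by auto
  have sub: "submodule U R (regular_module R)" if "U \<in> ?S" for U using that by simp
  show thesis
  proof (rule bexE[OF chain_condition_minimal[OF artinian_descending_chain[OF artinian] S sub]])
    fix E assume E: "E \<in> ?S" and min: "\<forall>V\<in>?S. V \<subseteq> E \<longrightarrow> V = E"
    then obtain e where e: "e \<in> E" "e \<notin> m" by blast
    have Ec: "E \<subseteq> carrier R" using submodule_subset[OF sub[OF E]] by simp
    have "e \<in> n" if n: "maximalideal n R" "n \<noteq> m" for n
    proof -
      interpret n: maximalideal n R by (rule n)
      have "\<not> n \<subseteq> m"
        using n.I_maximal[OF m.ideal_axioms] m.a_subset m.I_notcarr n(2) by auto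
      then obtain b where b: "b \<in> n" "b \<notin> m" by blast
      have "e \<otimes> b \<notin> m"
        using primeideal.I_prime[OF pm, of e b] e b Ec n.a_subset by auto
      moreover have "e \<otimes> b \<in> E"
        using submodule_smult[OF sub[OF E], of b e] e b Ec n.a_subset m_comm[of e b] by auto
      moreover have "e \<otimes> b \<in> n" using n.I_l_closed[of b e] b e Ec by auto
      moreover have "submodule (E \<inter> n) R (regular_module R)"
        using inter_submodule[OF reg sub[OF E]] n.ideal_axioms ideal_iff_submodule by blast
      ultimately have "E \<inter> n \<in> ?S" by blast
      then have "E \<inter> n = E" using min by blast
      then show ?thesis using e by blast
    qed
    then show thesis using that e Ec by blast
  qed
qed

text \<open>
  A simple submodule of \<^term>\<open>X\<close> is isomorphic to the residue field of a maximal ideal, which embeds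
  in the ring modulo its radical by multiplication with the element of \<open>maximalideal_separate\<close>.
\<close>

lemma J_cogenerator:
  assumes X: "fg_module R X" and x: "x \<in> carrier X" "x \<noteq> \<zero>\<^bsub>X\<^esub>"
  obtains h where "h \<in> module_hom R X J" "h x \<noteq> \<zero>\<^bsub>J\<^esub>"
proof -
  note lmX = fg_left_module[OF X] and reg = regular_left_module[OF ring_axioms]
  interpret X: left_module R X by (rule lmX)
  interpret J: left_module R J by (rule J_left_module)
  have cyc: "submodule ((\<lambda>a\<in>carrier R. a \<odot>\<^bsub>X\<^esub> y) ` carrier R) R X" if "y \<in> carrier X" for y
    using image_submodule[OF reg lmX hom_from_regular[OF lmX that] carrier_submodule[OF reg]] by simp
  define C where "C y = (\<lambda>a\<in>carrier R. a \<odot>\<^bsub>X\<^esub> y) ` carrier R" for y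
  have memC: "z \<in> C y \<longleftrightarrow> (\<exists>a\<in>carrier R. z = a \<odot>\<^bsub>X\<^esub> y)" for z y by (auto simp: C_def)
  have selfC: "y \<in> C y" if "y \<in> carrier X" for y using that memC X.smult_one by (metis one_closed)
  let ?S = "{H. submodule H R X \<and> H \<subseteq> C x \<and> H \<noteq> {\<zero>\<^bsub>X\<^esub>}}"
  have S: "C x \<in> ?S" using cyc[OF x(1)] selfC[OF x(1)] x(2) by (auto simp: C_def)
  have sub: "submodule U R X" if "U \<in> ?S" for U using that by blast
  have "\<exists>H\<in>?S. \<forall>V\<in>?S. V \<subseteq> H \<longrightarrow> V = H"
    by (rule chain_condition_minimal[OF chain_condition_fg[OF ring_axioms artinian_descending_chain[OF artinian] X] S sub])
  \<comment> \<open>Minimality makes \<open>H\<close> simple; \<open>gen\<close> records that each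
    nonzero element generates it. The annihilator \<open>m\<close> of one such element
    \<open>y\<close> will be a maximal ideal.\<close>
  then obtain H where HS: "H \<in> ?S" and min: "\<forall>V\<in>?S. V \<subseteq> H \<longrightarrow> V = H" ..
  have H: "submodule H R X" "H \<subseteq> C x" "H \<noteq> {\<zero>\<^bsub>X\<^esub>}" using HS by blast+
  obtain y where y: "y \<in> H" "y \<noteq> \<zero>\<^bsub>X\<^esub>" using H submodule_zero[OF H(1)] by blast
  have yX: "y \<in> carrier X" using submodule_subset[OF H(1)] y by blast
  have gen: "C z = H" if "z \<in> H" "z \<noteq> \<zero>\<^bsub>X\<^esub>" for z
  proof (rule bspec[OF min, rule_format])
    have "z \<in> carrier X" using submodule_subset[OF H(1)] that by blast
    moreover have "C z \<subseteq> H" using submodule_smult[OF H(1) _ that(1)] by (auto simp: memC)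
    ultimately show "C z \<in> ?S" "C z \<subseteq> H"
      using cyc[of z] selfC[of z] H(2) that by (auto simp: C_def)
  qed
  define m where "m = {a \<in> carrier R. a \<odot>\<^bsub>X\<^esub> y = \<zero>\<^bsub>X\<^esub>}"
  have "submodule m R (regular_module R)"
    using ker_submodule[OF reg lmX hom_from_regular[OF lmX yX]]
    by (simp add: m_def ker_module_def cong: conj_cong)
  then have mI: "ideal m R" by (rule submodule_is_ideal)
  have max: "maximalideal m R"
  proof (rule maximalidealI[OF mI])
    have "\<one> \<notin> m" unfolding m_def mem_Collect_eq X.smult_one[OF yX] using y(2) by blast
    then show "carrier R \<noteq> m" using one_closed by blast
    fix I assume I: "ideal I R" "m \<subseteq> I" "I \<subseteq> carrier R"
    interpret I: ideal I R by (rule I)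
    show "I = m \<or> I = carrier R"
    proof (cases "I = m")
      case False
      then obtain r where r: "r \<in> I" "r \<notin> m" "r \<in> carrier R" using I by blast
      have "r \<odot>\<^bsub>X\<^esub> y \<in> H" "r \<odot>\<^bsub>X\<^esub> y \<noteq> \<zero>\<^bsub>X\<^esub>"
        using r submodule_smult[OF H(1) _ y(1)] by (auto simp: m_def)
      then have "y \<in> C (r \<odot>\<^bsub>X\<^esub> y)" using gen y(1) by simp
      then obtain s where s: "s \<in> carrier R" "y = s \<odot>\<^bsub>X\<^esub> (r \<odot>\<^bsub>X\<^esub> y)" by (auto simp: memC)
      \<comment> \<open>Since \<open>y\<close> equals \<open>s\<close> times \<open>r\<close> times
        \<open>y\<close>, the element \<open>u\<close> annihilates \<open>y\<close>. So
        \<open>u\<close> lies in \<open>m\<close>, hence in \<open>I\<close>, and together with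
        \<open>r\<close> in \<open>I\<close> this puts 1 into \<open>I\<close>.\<close>
      define u where "u = \<one> \<ominus> s \<otimes> r"
      have u: "u \<in> carrier R" using s r by (simp add: u_def)
      have "u \<oplus> s \<otimes> r = \<one>" using s r by (simp add: u_def a_minus_def a_assoc l_neg)
      moreover have "u \<odot>\<^bsub>X\<^esub> y \<oplus>\<^bsub>X\<^esub> y = (u \<oplus> s \<otimes> r) \<odot>\<^bsub>X\<^esub> y"
        using s r yX u by (simp add: X.smult_l_distr X.smult_assoc1)
      ultimately have "u \<odot>\<^bsub>X\<^esub> y \<oplus>\<^bsub>X\<^esub> y = y" using yX by simp
      then have "u \<odot>\<^bsub>X\<^esub> y = \<zero>\<^bsub>X\<^esub>" using yX u by simp
      then have "u \<in> I" using u I(2) by (auto simp: m_def)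
      then have "\<one> \<in> I" using \<open>u \<oplus> s \<otimes> r = \<one>\<close> I.I_l_closed[OF r(1) s(1)] I.a_closed by metis
      then show ?thesis using I.one_imp_carrier by simp
    qed simp
  qed
  then obtain e where e: "e \<in> carrier R" "e \<notin> m" "\<And>n. maximalideal n R \<Longrightarrow> n \<noteq> m \<Longrightarrow> e \<in> n"
    by (rule maximalideal_separate) blast
  define rad where "rad = jacobson_radical R"
  have rad_sub: "submodule rad R (regular_module R)"
  proof (rule submodule_intro[OF reg])
    have *: "x \<in> rad \<longleftrightarrow> x \<in> carrier R \<and> (\<forall>n. maximalideal n R \<longrightarrow> x \<in> n)" for x
      by (auto simp: rad_def jacobson_radical_def)
    have n: "submodule n R (regular_module R)" if "maximalideal n R" for n
      using maximalideal.axioms(1)[OF that] ideal_iff_submodule by blast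
    show "rad \<subseteq> carrier (regular_module R)" "\<zero>\<^bsub>regular_module R\<^esub> \<in> rad"
      using submodule_zero[OF n] by (auto simp: *)
    show "x \<oplus>\<^bsub>regular_module R\<^esub> y \<in> rad" if "x \<in> rad" "y \<in> rad" for x y
      using that submodule_add[OF n] by (simp add: *)
    show "a \<odot>\<^bsub>regular_module R\<^esub> x \<in> rad" if "a \<in> carrier R" "x \<in> rad" for a x
      using that submodule_smult[OF n] by (simp add: *)
  qed
  \<comment> \<open>Multiplication by \<open>e\<close> detects \<open>m\<close> modulo the radical:
    \<open>e\<close> lies in all other maximal ideals, and the prime ideal \<open>m\<close> does not
    contain it.\<close>
  have rad_iff: "a \<otimes> e \<in> rad \<longleftrightarrow> a \<in> m" if a: "a \<in> carrier R" for a
  proof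
    assume "a \<otimes> e \<in> rad"
    then have "a \<otimes> e \<in> m" using max by (auto simp: rad_def jacobson_radical_def)
    then show "a \<in> m" using primeideal.I_prime[OF maximalideal_prime[OF max] a e(1)] e(2) by blast
  next
    assume am: "a \<in> m"
    have "a \<otimes> e \<in> n" if n: "maximalideal n R" for n
    proof (cases "n = m")
      case True
      then show ?thesis using ideal.I_r_closed[OF mI am e(1)] by simp
    next
      case False
      interpret n: maximalideal n R by (rule n)
      show ?thesis using n.I_l_closed[OF e(3)[OF n False] a] .
    qed
    then show "a \<otimes> e \<in> rad" using a e(1) by (auto simp: rad_def jacobson_radical_def)
  qed
  define Q where "Q = quot_module (regular_module R) rad"
  have Q: "left_module R Q" unfolding Q_def by (rule quot_left_module[OF reg rad_sub])
  define p where "p = (\<lambda>x\<in>carrier (regular_module R). rad +>\<^bsub>regular_module R\<^esub> x)"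
  have p: "p \<in> module_hom R (regular_module R) Q" "ker_module (regular_module R) Q p = rad"
    unfolding p_def Q_def by (rule quot_proj[OF reg rad_sub], rule quot_proj_ker[OF reg rad_sub])
  have io: "\<iota> \<in> module_hom R Q J" "inj_on \<iota> (carrier Q)"
    using envelope by (simp_all add: injective_envelope_def Q_def rad_def)
  have mul: "(\<lambda>a\<in>carrier R. a \<otimes> e) \<in> module_hom R (regular_module R) (regular_module R)"
    using hom_from_regular[OF reg] e(1) by simp
  \<comment> \<open>The composition R -> R -> R/rad -> J, starting with multiplication by
    \<open>e\<close>, has kernel exactly \<open>m\<close>. As \<open>m\<close> is the annihilator of
    \<open>y\<close>, it factors through \<open>H\<close>, the module generated by
    \<open>y\<close>.\<close>
  define g where "g = (\<lambda>a\<in>carrier R. \<iota> (p (a \<otimes> e)))"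
  have g: "g \<in> module_hom R (regular_module R) J"
    using hom_comp[OF reg hom_comp[OF reg mul p(1)] io(1)] by (simp add: g_def cong: restrict_cong)
  have g_zero: "g a = \<zero>\<^bsub>J\<^esub> \<longleftrightarrow> a \<in> m" if a: "a \<in> carrier R" for a
  proof -
    have ae: "a \<otimes> e \<in> carrier R" using a e by simp
    have "g a = \<zero>\<^bsub>J\<^esub> \<longleftrightarrow> p (a \<otimes> e) \<in> ker_module Q J \<iota>"
      using a ae hom_closed[OF p(1)] by (simp add: g_def ker_module_def)
    also have "\<dots> \<longleftrightarrow> a \<otimes> e \<in> ker_module (regular_module R) Q p"
      using hom_inj_iff[OF Q J_left_module io(1)] io(2) ae by (simp add: ker_module_def)
    finally show ?thesis using p(2) rad_iff[OF a] by simp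
  qed
  have H_lm: "left_module R (X\<lparr>carrier := H\<rparr>)" by (rule submodule_left_module[OF lmX H(1)])
  define q where "q = (\<lambda>a\<in>carrier R. a \<odot>\<^bsub>X\<^esub> y)"
  have q_surj: "q ` carrier (regular_module R) = carrier (X\<lparr>carrier := H\<rparr>)"
    using gen[OF y] by (simp add: q_def C_def)
  have q: "q \<in> module_hom R (regular_module R) (X\<lparr>carrier := H\<rparr>)"
    unfolding q_def by (rule hom_codom[OF hom_from_regular[OF lmX yX]]) (use gen[OF y] in \<open>simp add: C_def\<close>)
  have "ker_module (regular_module R) (X\<lparr>carrier := H\<rparr>) q \<subseteq> ker_module (regular_module R) J g"
    using g_zero by (auto simp: ker_module_def q_def m_def)
  then obtain h0 where h0: "h0 \<in> module_hom R (X\<lparr>carrier := H\<rparr>) J"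
    "\<And>a. a \<in> carrier R \<Longrightarrow> h0 (q a) = g a"
    using factor_surj[OF reg H_lm J_left_module q q_surj g] by auto
  have "fg_module R (X\<lparr>carrier := H\<rparr>)" by (rule fg_surj[OF regular_fg[OF ring_axioms] H_lm q q_surj])
  then obtain h where h: "h \<in> module_hom R X J" "\<And>z. z \<in> H \<Longrightarrow> h z = h0 z"
    using injective_extend[OF J_injective _ X hom_incl[OF lmX H(1)] _ h0(1)] by (auto simp: inj_on_def)
  have "\<one> \<notin> m" using yX y(2) by (simp add: m_def)
  then have "h y \<noteq> \<zero>\<^bsub>J\<^esub>"
    using h(2)[OF y(1)] h0(2)[OF one_closed] g_zero[OF one_closed] yX by (simp add: q_def)
  \<comment> \<open>The element \<open>y\<close> is a multiple of \<open>x\<close>, so a map that is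
    nonzero at \<open>y\<close> cannot vanish at \<open>x\<close>.\<close>
  moreover obtain r where r: "r \<in> carrier R" "y = r \<odot>\<^bsub>X\<^esub> x" using y(1) H(2) memC by blast
  ultimately have "h x \<noteq> \<zero>\<^bsub>J\<^esub>" using hom_smult[OF h(1) r(1) x(1)] by (auto simp: J.smult_zero_right)
  then show thesis using h(1) that by blast
qed

text \<open>
  By \<open>J_cogenerator\<close>, annihilation in \<^term>\<open>J\<close> reverses strict inclusions of ideals, so the descending
  chain condition for \<^term>\<open>J\<close> gives the ascending one for the ring.
\<close>

lemma finite_length: "finite_length_ring R"
proof
  fix up
  note reg = regular_left_module[OF ring_axioms]
  interpret reg: left_module R "regular_module R" by (rule reg)
  interpret J: left_module R J by (rule J_left_module)
  note dcc = artinian_descending_chain[OF artinian]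
  define F where "F I = {j \<in> carrier J. \<forall>r\<in>I. r \<odot>\<^bsub>J\<^esub> j = \<zero>\<^bsub>J\<^esub>}" for I
  have F: "submodule (F I) R J" if I: "submodule I R (regular_module R)" for I
  proof (rule submodule_intro[OF J_left_module])
    have I': "r \<in> carrier R" if "r \<in> I" for r using submodule_subset[OF I] that by auto
    show "x \<oplus>\<^bsub>J\<^esub> y \<in> F I" if "x \<in> F I" "y \<in> F I" for x y
      using that I' by (simp add: F_def J.smult_r_distr)
    show "a \<odot>\<^bsub>J\<^esub> x \<in> F I" if "a \<in> carrier R" "x \<in> F I" for a x
      using that I' by (simp add: F_def J.smult_assoc1[symmetric] m_comm[of _ a])
        (simp add: J.smult_assoc1 J.smult_zero_right)
  qed (auto simp: F_def J.smult_zero_right dest: submodule_subset[OF I, THEN subsetD])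
  have strict: "F I' \<subset> F I"
    if I: "submodule I R (regular_module R)" and I': "submodule I' R (regular_module R)" and less: "I \<subset> I'" for I I'
  proof -
    obtain r where r: "r \<in> I'" "r \<notin> I" using less by blast
    have rR: "r \<in> carrier R" using r submodule_subset[OF I'] by auto
    let ?Q = "quot_module (regular_module R) I" and ?p = "\<lambda>x\<in>carrier (regular_module R). I +>\<^bsub>regular_module R\<^esub> x"
    note p = quot_proj[OF reg I] and Q = quot_left_module[OF reg I]
    have "fg_module R ?Q" by (rule fg_surj[OF regular_fg[OF ring_axioms] Q p quot_proj_surj[OF reg I]])
    moreover have p0: "?p a = \<zero>\<^bsub>?Q\<^esub> \<longleftrightarrow> a \<in> I" if "a \<in> carrier R" for a
    proof -
      have "a \<in> ker_module (regular_module R) ?Q ?p \<longleftrightarrow> ?p a = \<zero>\<^bsub>?Q\<^esub>"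
        using that by (simp add: ker_module_def)
      then show ?thesis unfolding quot_proj_ker[OF reg I] by blast
    qed
    \<comment> \<open>The cogenerator property supplies a map on R/I that is nonzero at the class of
      \<open>r\<close>. Its value at the class of 1 is annihilated by \<open>I\<close> but not by
      \<open>r\<close>, so it lies in \<open>F I\<close> and not in \<open>F I'\<close>.\<close>
    ultimately obtain h where h: "h \<in> module_hom R ?Q J" "h (?p r) \<noteq> \<zero>\<^bsub>J\<^esub>"
      using J_cogenerator[of ?Q "?p r"] hom_closed[OF p, of r] rR r(2) by auto
    have p1: "?p \<one> \<in> carrier ?Q" using hom_closed[OF p, of \<one>] by simp
    have hp: "h (?p a) = a \<odot>\<^bsub>J\<^esub> h (?p \<one>)" if "a \<in> carrier R" for a
      using hom_smult[OF p, of a \<one>] hom_smult[OF h(1) that p1] that by simp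
    have "h (?p \<one>) \<in> F I"
    proof -
      have "a \<odot>\<^bsub>J\<^esub> h (?p \<one>) = \<zero>\<^bsub>J\<^esub>" if a: "a \<in> I" for a
      proof -
        have aR: "a \<in> carrier R" using a submodule_subset[OF I] by auto
        then have "h (?p a) = \<zero>\<^bsub>J\<^esub>" using p0[OF aR] a hom_zero[OF Q J_left_module h(1)] by simp
        then show ?thesis using hp[OF aR] by simp
      qed
      then show ?thesis using hom_closed[OF h(1) p1] by (auto simp: F_def)
    qed
    moreover have "h (?p \<one>) \<notin> F I'" using h(2) hp[OF rR] r(1) by (auto simp: F_def)
    moreover have "F I' \<subseteq> F I" using less by (auto simp: F_def)
    ultimately show ?thesis by blast
  qed
  have "chain_condition True R (regular_module R)"
    unfolding chain_condition_def
  proof (rule wf_subset[OF wf_inv_image[OF chain_condition_fg[OF ring_axioms dcc injective_fg[OF J_injective],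
          unfolded chain_condition_def], of F]], rule subrelI)
    fix H H' assume "(H, H') \<in> {(H, H'). submodule H R (regular_module R) \<and> submodule H' R (regular_module R) \<and>
      strictly_below True H H'}"
    then show "(H, H') \<in> inv_image {(H, H'). submodule H R J \<and> submodule H' R J \<and> strictly_below False H H'} F"
      using F strict by (simp add: strictly_below_def)
  qed
  then show "chain_condition up R (regular_module R)" using dcc by (cases up) auto
qed

end

section \<open>Modules over an Artin algebra\<close>

text \<open>Shared by \<open>dual_regular\<close> and \<open>hom_scalars\<close>, which carry the
  same pointwise addition on different sets of homomorphisms.\<close>

lemma hom_abelian_groupI:
  assumes M: "left_module A M" and N: "left_module A N"
    and car: "carrier G = module_hom A M N"
    and add: "\<And>f g. f \<oplus>\<^bsub>G\<^esub> g = (\<lambda>x\<in>carrier M. f x \<oplus>\<^bsub>N\<^esub> g x)"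
    and zero: "\<zero>\<^bsub>G\<^esub> = (\<lambda>x\<in>carrier M. \<zero>\<^bsub>N\<^esub>)"
  shows "abelian_group G"
proof (rule abelian_groupI)
  interpret M: left_module A M by (rule M)
  interpret N: left_module A N by (rule N)
  note plus = hom_plus[OF M N] and const = hom_const_zero[OF M N]
  have cl: "f x \<in> carrier N" if "f \<in> module_hom A M N" "x \<in> carrier M" for f x using that by (rule hom_closed)
  show "\<zero>\<^bsub>G\<^esub> \<in> carrier G" using const by (simp add: car zero)
  show "f \<oplus>\<^bsub>G\<^esub> g \<in> carrier G" if "f \<in> carrier G" "g \<in> carrier G" for f g
    using plus that by (simp add: car add)
  show "f \<oplus>\<^bsub>G\<^esub> g \<oplus>\<^bsub>G\<^esub> h = f \<oplus>\<^bsub>G\<^esub> (g \<oplus>\<^bsub>G\<^esub> h)" if "f \<in> carrier G" "g \<in> carrier G" "h \<in> carrier G" for f g h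
    unfolding add using that by (intro restrict_ext) (simp add: car cl N.a_assoc)
  show "f \<oplus>\<^bsub>G\<^esub> g = g \<oplus>\<^bsub>G\<^esub> f" if "f \<in> carrier G" "g \<in> carrier G" for f g
    unfolding add using that by (intro restrict_ext) (simp add: car cl N.a_comm)
  fix f assume "f \<in> carrier G"
  then have f: "f \<in> module_hom A M N" by (simp add: car)
  show "\<zero>\<^bsub>G\<^esub> \<oplus>\<^bsub>G\<^esub> f = f"
    unfolding add zero using hom_closed[OF f] by (intro hom_eqI[OF plus[OF const f] f]) simp
  show "\<exists>g\<in>carrier G. g \<oplus>\<^bsub>G\<^esub> f = \<zero>\<^bsub>G\<^esub>"
  proof
    show "(\<lambda>x\<in>carrier M. (\<lambda>x\<in>carrier M. \<zero>\<^bsub>N\<^esub>) x \<ominus>\<^bsub>N\<^esub> f x) \<in> carrier G"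
      unfolding car by (rule hom_minus_hom[OF M N const f])
    show "(\<lambda>x\<in>carrier M. (\<lambda>x\<in>carrier M. \<zero>\<^bsub>N\<^esub>) x \<ominus>\<^bsub>N\<^esub> f x) \<oplus>\<^bsub>G\<^esub> f = \<zero>\<^bsub>G\<^esub>"
      unfolding add zero using hom_closed[OF f] by (intro restrict_ext) (simp add: N.diff_add_cancel)
  qed
qed

text \<open>The ground ring acts through the multiples of the unit of the algebra. Both
  \<open>J\<close> and the known chain condition live over the ground ring, so arguments about
  modules over the algebra are brought there.\<close>

definition restrict_scalars ::
    "('r, 'x) ring_scheme \<Rightarrow> ('r, 'a) module \<Rightarrow> ('a, 'm) module \<Rightarrow> ('r, 'm) module" where
  "restrict_scalars R A X = \<lparr>carrier = carrier X, mult = undefined, one = undefined,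
     zero = zero X, add = add X, smult = (\<lambda>r x. (r \<odot>\<^bsub>A\<^esub> \<one>\<^bsub>A\<^esub>) \<odot>\<^bsub>X\<^esub> x)\<rparr>"

lemma restrict_scalars_simps [simp]:
  "carrier (restrict_scalars R A X) = carrier X" "\<zero>\<^bsub>restrict_scalars R A X\<^esub> = \<zero>\<^bsub>X\<^esub>"
  "x \<oplus>\<^bsub>restrict_scalars R A X\<^esub> y = x \<oplus>\<^bsub>X\<^esub> y" "r \<odot>\<^bsub>restrict_scalars R A X\<^esub> x = (r \<odot>\<^bsub>A\<^esub> \<one>\<^bsub>A\<^esub>) \<odot>\<^bsub>X\<^esub> x"
  by (auto simp: restrict_scalars_def)

text \<open>Hom(X, A) as a module over the ground ring. Scaling the values keeps a map linear over
  the algebra because the multiples of the unit are central.\<close>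

definition hom_scalars ::
    "('r, 'x) ring_scheme \<Rightarrow> ('r, 'a) module \<Rightarrow> ('a, 'm) module \<Rightarrow> ('r, 'm \<Rightarrow> 'a) module" where
  "hom_scalars R A X = \<lparr>carrier = module_hom A X (regular_module A), mult = undefined, one = undefined,
     zero = (\<lambda>x\<in>carrier X. \<zero>\<^bsub>A\<^esub>), add = (\<lambda>f g. \<lambda>x\<in>carrier X. f x \<oplus>\<^bsub>A\<^esub> g x),
     smult = (\<lambda>r f. \<lambda>x\<in>carrier X. r \<odot>\<^bsub>A\<^esub> f x)\<rparr>"

lemma hom_scalars_simps [simp]:
  "carrier (hom_scalars R A X) = module_hom A X (regular_module A)"
  "\<zero>\<^bsub>hom_scalars R A X\<^esub> = (\<lambda>x\<in>carrier X. \<zero>\<^bsub>A\<^esub>)"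
  "f \<oplus>\<^bsub>hom_scalars R A X\<^esub> g = (\<lambda>x\<in>carrier X. f x \<oplus>\<^bsub>A\<^esub> g x)"
  "r \<odot>\<^bsub>hom_scalars R A X\<^esub> f = (\<lambda>x\<in>carrier X. r \<odot>\<^bsub>A\<^esub> f x)"
  by (auto simp: hom_scalars_def)

lemma dual_regular_simps [simp]:
  "carrier (dual_regular R A J) = module_hom R A J"
  "\<zero>\<^bsub>dual_regular R A J\<^esub> = (\<lambda>x\<in>carrier A. \<zero>\<^bsub>J\<^esub>)"
  "f \<oplus>\<^bsub>dual_regular R A J\<^esub> g = (\<lambda>x\<in>carrier A. f x \<oplus>\<^bsub>J\<^esub> g x)"
  "a \<odot>\<^bsub>dual_regular R A J\<^esub> f = (\<lambda>x\<in>carrier A. f (x \<otimes>\<^bsub>A\<^esub> a))"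
  by (auto simp: dual_regular_def)

text \<open>As for direct sums, a submodule is compared through its trace on the kernel of
  \<open>f\<close> and its image under \<open>f\<close>.\<close>

lemma chain_condition_extension:
  assumes M: "left_module A M" and N: "left_module A N" and f: "f \<in> module_hom A M N"
    and ker: "chain_condition up A (M\<lparr>carrier := ker_module M N f\<rparr>)" and chain: "chain_condition up A N"
  shows "chain_condition up A M"
proof (rule chain_condition_map_pair[OF ker chain])
  interpret M: left_module A M by (rule M)
  interpret N: left_module A N by (rule N)
  note K = ker_submodule[OF M N f]
  show "submodule (H \<inter> ker_module M N f) A (M\<lparr>carrier := ker_module M N f\<rparr>)" if "submodule H A M" for H
    using inter_submodule[OF M that K] by (simp add: submodule_of_submodule[OF M K])
  show "submodule (f ` H) A N" if "submodule H A M" for H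
    by (rule image_submodule[OF M N f that])
  show "H = H'" if H: "submodule H A M" and H': "submodule H' A M" and sub: "H \<subseteq> H'"
    and F: "H \<inter> ker_module M N f = H' \<inter> ker_module M N f" and G: "f ` H = f ` H'" for H H'
  proof (rule equalityI[OF sub], rule subsetI)
    fix x assume x: "x \<in> H'"
    then have "f x \<in> f ` H" unfolding G by blast
    then obtain y where y: "y \<in> H" "f x = f y" by auto
    have c: "x \<in> carrier M" "y \<in> carrier M"
      using x y submodule_subset[OF H] submodule_subset[OF H'] by auto
    have "f (x \<ominus>\<^bsub>M\<^esub> y) = \<zero>\<^bsub>N\<^esub>" using c hom_closed[OF f] y(2) by (simp add: hom_diff[OF M N f])
    moreover have "x \<ominus>\<^bsub>M\<^esub> y \<in> H'" using submodule_diff[OF H' x] y(1) sub by blast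
    ultimately have "x \<ominus>\<^bsub>M\<^esub> y \<in> H' \<inter> ker_module M N f" using c by (simp add: ker_module_def)
    then have "x \<ominus>\<^bsub>M\<^esub> y \<in> H" unfolding F[symmetric] by blast
    then have "(x \<ominus>\<^bsub>M\<^esub> y) \<oplus>\<^bsub>M\<^esub> y \<in> H" using submodule_add[OF H] y(1) by blast
    then show "x \<in> H" using c by (simp add: M.diff_add_cancel)
  qed
qed auto

section \<open>The algebra over its ground ring, and restriction of scalars\<close>

locale artin_duality = artin_algebra R A for R :: "('r, 'x) ring_scheme" and A :: "('r, 'a) module" +
  fixes J :: "('r, 'j) module" and \<iota> :: "'r set \<Rightarrow> 'j"
  assumes envelope: "injective_envelope R (quot_module (regular_module R) (jacobson_radical R)) J \<iota>"
begin

lemma cogenerator: "artinian_cogenerator R J \<iota>"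
  using artinian envelope by (simp add: artinian_cogenerator_def artinian_cogenerator_axioms_def artinian_cring_def)

sublocale cogenerator: artinian_cogenerator R J \<iota> by (rule cogenerator)

sublocale scalars: finite_length_ring R by (rule cogenerator.finite_length)

lemma ring_A: "ring A" ..

lemma A_left_module: "left_module R A"
  using finitely_generated by (rule fg_left_module)

lemma scalar_closed: "r \<in> carrier R \<Longrightarrow> r \<odot>\<^bsub>A\<^esub> \<one>\<^bsub>A\<^esub> \<in> carrier A"
  by simp

lemma scalar_mult: "r \<in> carrier R \<Longrightarrow> a \<in> carrier A \<Longrightarrow> (r \<odot>\<^bsub>A\<^esub> \<one>\<^bsub>A\<^esub>) \<otimes>\<^bsub>A\<^esub> a = r \<odot>\<^bsub>A\<^esub> a"
  by (simp add: smult_mult_left)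

lemma restrict_scalars_left_module:
  assumes X: "left_module A X" shows "left_module R (restrict_scalars R A X)"
proof -
  interpret X: left_module A X by (rule X)
  interpret AR: left_module R A by (rule A_left_module)
  interpret N: abelian_group "restrict_scalars R A X"
  proof (rule abelian_groupI)
    fix x assume "x \<in> carrier (restrict_scalars R A X)"
    then show "\<exists>y\<in>carrier (restrict_scalars R A X). y \<oplus>\<^bsub>restrict_scalars R A X\<^esub> x = \<zero>\<^bsub>restrict_scalars R A X\<^esub>"
      by (intro bexI[of _ "\<ominus>\<^bsub>X\<^esub> x"]) (auto simp: X.M.l_neg)
  qed (auto simp: X.M.a_ac)
  show ?thesis
  proof
    fix a b x assume "a \<in> carrier R" "b \<in> carrier R" "x \<in> carrier (restrict_scalars R A X)"
    then show "(a \<otimes>\<^bsub>R\<^esub> b) \<odot>\<^bsub>restrict_scalars R A X\<^esub> x = a \<odot>\<^bsub>restrict_scalars R A X\<^esub> (b \<odot>\<^bsub>restrict_scalars R A X\<^esub> x)"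
      using X.smult_assoc1[of "a \<odot>\<^bsub>A\<^esub> \<one>\<^bsub>A\<^esub>" "b \<odot>\<^bsub>A\<^esub> \<one>\<^bsub>A\<^esub>" x] by (simp add: scalar_mult AR.smult_assoc1)
  qed (auto simp: X.smult_r_distr AR.smult_l_distr X.smult_l_distr)
qed

lemma submodule_restrict_scalars:
  assumes X: "left_module A X" and H: "submodule H A X"
  shows "submodule H R (restrict_scalars R A X)"
  using submodule_subset[OF H] submodule_zero[OF H] submodule_add[OF H] submodule_smult[OF H]
  by (intro submodule_intro[OF restrict_scalars_left_module[OF X]]) auto

lemma hom_restrict_scalars:
  "f \<in> module_hom A X Y \<Longrightarrow> f \<in> module_hom R (restrict_scalars R A X) (restrict_scalars R A Y)"
  by (simp add: module_hom_def)

lemma hom_into_restrict_scalars: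
  assumes X: "left_module A X" and x: "x \<in> carrier X"
  shows "(\<lambda>a\<in>carrier A. a \<odot>\<^bsub>X\<^esub> x) \<in> module_hom R A (restrict_scalars R A X)"
proof -
  interpret X: left_module A X by (rule X)
  show ?thesis
    using A_left_module x by (intro hom_restrictI) (auto simp: X.smult_l_distr X.smult_assoc1[symmetric] scalar_mult)
qed

text \<open>The products of generators of the algebra over \<open>R\<close> with generators of
  \<open>X\<close> over the algebra generate \<open>X\<close> over \<open>R\<close>.\<close>

lemma fg_restrict_scalars:
  assumes X: "fg_module A X" shows "fg_module R (restrict_scalars R A X)"
proof -
  note lm = fg_left_module[OF X]
  interpret X: left_module A X by (rule lm)
  note lmR = restrict_scalars_left_module[OF lm]
  obtain S where S: "finite S" "S \<subseteq> carrier X" "\<And>H. submodule H A X \<Longrightarrow> S \<subseteq> H \<Longrightarrow> H = carrier X"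
    using X by (auto simp: fg_module_def)
  obtain T where T: "finite T" "T \<subseteq> carrier A" "\<And>H. submodule H R A \<Longrightarrow> T \<subseteq> H \<Longrightarrow> H = carrier A"
    using finitely_generated by (auto simp: fg_module_def)
  have gen: "H = carrier X"
    if H: "submodule H R (restrict_scalars R A X)" and sub: "(\<lambda>(t, s). t \<odot>\<^bsub>X\<^esub> s) ` (T \<times> S) \<subseteq> H" for H
  proof -
    have Hc: "x \<in> carrier X" if "x \<in> H" for x using that submodule_subset[OF H] by auto
    have mem: "a \<odot>\<^bsub>X\<^esub> s \<in> H" if s: "s \<in> S" and a: "a \<in> carrier A" for a s
    proof -
      have sX: "s \<in> carrier X" using s S(2) by blast
      have "{x \<in> carrier A. (\<lambda>a\<in>carrier A. a \<odot>\<^bsub>X\<^esub> s) x \<in> H} = carrier A"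
        using vimage_submodule[OF A_left_module lmR hom_into_restrict_scalars[OF lm sX] H] T(2) sub s
        by (intro T(3)) auto
      then have "a \<in> {x \<in> carrier A. (\<lambda>a\<in>carrier A. a \<odot>\<^bsub>X\<^esub> s) x \<in> H}" using a by simp
      then show ?thesis using a by simp
    qed
    \<comment> \<open>\<open>H\<close> is stable under \<open>R\<close> only. The elements all of
      whose \<open>A\<close>-multiples lie in \<open>H\<close> form an \<open>A\<close>-submodule,
      to which the generators of \<open>X\<close> apply.\<close>
    have "{x \<in> carrier X. \<forall>a\<in>carrier A. a \<odot>\<^bsub>X\<^esub> x \<in> H} = carrier X"
    proof (rule S(3))
      show "S \<subseteq> {x \<in> carrier X. \<forall>a\<in>carrier A. a \<odot>\<^bsub>X\<^esub> x \<in> H}" using mem S(2) by auto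
      show "submodule {x \<in> carrier X. \<forall>a\<in>carrier A. a \<odot>\<^bsub>X\<^esub> x \<in> H} A X"
        using submodule_zero[OF H] submodule_add[OF H]
        by (intro submodule_intro[OF lm]) (auto simp: X.smult_zero_right X.smult_r_distr X.smult_assoc1[symmetric])
    qed
    then have "\<one>\<^bsub>A\<^esub> \<odot>\<^bsub>X\<^esub> x \<in> H" if "x \<in> carrier X" for x using that one_closed by blast
    then have "x \<in> H" if "x \<in> carrier X" for x using that X.smult_one by metis
    then show ?thesis using Hc by blast
  qed
  have "finite ((\<lambda>(t, s). t \<odot>\<^bsub>X\<^esub> s) ` (T \<times> S))" "(\<lambda>(t, s). t \<odot>\<^bsub>X\<^esub> s) ` (T \<times> S) \<subseteq> carrier X"
    using S(1,2) T(1,2) by auto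
  then show ?thesis
    using lmR gen unfolding fg_module_def restrict_scalars_simps
    by (intro conjI exI[of _ "(\<lambda>(t, s). t \<odot>\<^bsub>X\<^esub> s) ` (T \<times> S)"] allI impI) simp_all
qed

text \<open>Left ideals are in particular \<open>R\<close>-submodules of the algebra, which is
  finitely generated over a ring with both chain conditions.\<close>

sublocale algebra: finite_length_ring A
proof
  fix up
  note reg = regular_left_module[OF ring_A]
  show "chain_condition up A (regular_module A)"
    using submodule_restrict_scalars[OF reg]
    by (intro chain_condition_map[OF scalars.chain_fg[OF fg_restrict_scalars[OF regular_fg[OF ring_A]]], where F = "\<lambda>H. H"])
      auto
qed

section \<open>The dual of the regular module as an injective cogenerator\<close>

lemma dual_regular_left_module: "left_module A (dual_regular R A J)"
proof -
  interpret AR: left_module R A by (rule A_left_module)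
  note J = cogenerator.J_left_module
  interpret J: left_module R J by (rule J)
  interpret N: abelian_group "dual_regular R A J"
    by (rule hom_abelian_groupI[OF A_left_module J]) auto
  have cl: "(\<lambda>x\<in>carrier A. f (x \<otimes>\<^bsub>A\<^esub> a)) \<in> module_hom R A J" if f: "f \<in> module_hom R A J" and a: "a \<in> carrier A" for f a
    using A_left_module a by (intro hom_restrictI)
      (auto simp: hom_closed[OF f] hom_add[OF f] hom_smult[OF f] l_distr smult_mult_left)
  show ?thesis
  proof
    fix a b f assume *: "a \<in> carrier A" "b \<in> carrier A" "f \<in> carrier (dual_regular R A J)"
    then have f: "f \<in> module_hom R A J" by simp
    show "(a \<oplus>\<^bsub>A\<^esub> b) \<odot>\<^bsub>dual_regular R A J\<^esub> f = a \<odot>\<^bsub>dual_regular R A J\<^esub> f \<oplus>\<^bsub>dual_regular R A J\<^esub> b \<odot>\<^bsub>dual_regular R A J\<^esub> f"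
      using * by (auto simp: r_distr hom_add[OF f] intro!: restrict_ext)
    show "(a \<otimes>\<^bsub>A\<^esub> b) \<odot>\<^bsub>dual_regular R A J\<^esub> f = a \<odot>\<^bsub>dual_regular R A J\<^esub> (b \<odot>\<^bsub>dual_regular R A J\<^esub> f)"
      using * by (auto simp: m_assoc intro!: restrict_ext)
  next
    fix a f g assume *: "a \<in> carrier A" "f \<in> carrier (dual_regular R A J)" "g \<in> carrier (dual_regular R A J)"
    show "a \<odot>\<^bsub>dual_regular R A J\<^esub> (f \<oplus>\<^bsub>dual_regular R A J\<^esub> g)
        = a \<odot>\<^bsub>dual_regular R A J\<^esub> f \<oplus>\<^bsub>dual_regular R A J\<^esub> a \<odot>\<^bsub>dual_regular R A J\<^esub> g"
      using * by (auto intro!: restrict_ext)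
  next
    fix a f assume "a \<in> carrier A" "f \<in> carrier (dual_regular R A J)"
    then show "a \<odot>\<^bsub>dual_regular R A J\<^esub> f \<in> carrier (dual_regular R A J)" using cl by simp
  next
    fix f assume "f \<in> carrier (dual_regular R A J)"
    then have f: "f \<in> module_hom R A J" by simp
    show "\<one>\<^bsub>A\<^esub> \<odot>\<^bsub>dual_regular R A J\<^esub> f = f"
      using hom_eqI[OF cl[OF f one_closed] f] by simp
  qed
qed

text \<open>One direction of the adjunction between Hom_R(X, J) and Hom_A(X, Hom_R(A, J)).\<close>

lemma hom_dual_regular:
  assumes X: "left_module A X" and h: "h \<in> module_hom R (restrict_scalars R A X) J"
  shows "(\<lambda>x\<in>carrier X. \<lambda>a\<in>carrier A. h (a \<odot>\<^bsub>X\<^esub> x)) \<in> module_hom A X (dual_regular R A J)"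
proof -
  interpret X: left_module A X by (rule X)
  note h_add = hom_add[OF h, simplified]
  show ?thesis
  proof (rule hom_restrictI[OF X])
    fix x assume x: "x \<in> carrier X"
    show "(\<lambda>a\<in>carrier A. h (a \<odot>\<^bsub>X\<^esub> x)) \<in> carrier (dual_regular R A J)"
      using hom_comp[OF A_left_module hom_into_restrict_scalars[OF X x] h] by (simp cong: restrict_cong)
  next
    fix x y assume "x \<in> carrier X" "y \<in> carrier X"
    then show "(\<lambda>a\<in>carrier A. h (a \<odot>\<^bsub>X\<^esub> (x \<oplus>\<^bsub>X\<^esub> y))) =
        (\<lambda>a\<in>carrier A. h (a \<odot>\<^bsub>X\<^esub> x)) \<oplus>\<^bsub>dual_regular R A J\<^esub> (\<lambda>a\<in>carrier A. h (a \<odot>\<^bsub>X\<^esub> y))"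
      by (auto simp: X.smult_r_distr h_add intro!: restrict_ext)
  next
    fix b x assume "b \<in> carrier A" "x \<in> carrier X"
    then show "(\<lambda>a\<in>carrier A. h (a \<odot>\<^bsub>X\<^esub> (b \<odot>\<^bsub>X\<^esub> x))) =
        b \<odot>\<^bsub>dual_regular R A J\<^esub> (\<lambda>a\<in>carrier A. h (a \<odot>\<^bsub>X\<^esub> x))"
      by (auto simp: X.smult_assoc1 intro!: restrict_ext)
  qed
qed

text \<open>The other direction of the adjunction, evaluation at 1. It loses nothing, since
  \<open>h x a\<close> is the value at 1 of \<open>h\<close> applied to the
  \<open>a\<close>-multiple of \<open>x\<close>.\<close>

lemma hom_dual_regular_eval:
  assumes X: "left_module A X" and h: "h \<in> module_hom A X (dual_regular R A J)"
  shows "(\<lambda>x\<in>carrier X. h x \<one>\<^bsub>A\<^esub>) \<in> module_hom R (restrict_scalars R A X) J"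
proof -
  interpret X: left_module A X by (rule X)
  have hx: "h x \<in> module_hom R A J" if "x \<in> carrier X" for x using hom_closed[OF h that] by simp
  have smult: "h ((r \<odot>\<^bsub>A\<^esub> \<one>\<^bsub>A\<^esub>) \<odot>\<^bsub>X\<^esub> x) \<one>\<^bsub>A\<^esub> = r \<odot>\<^bsub>J\<^esub> h x \<one>\<^bsub>A\<^esub>" if r: "r \<in> carrier R" and x: "x \<in> carrier X" for r x
    using hom_smult[OF hx[OF x] r, of "\<one>\<^bsub>A\<^esub>"] r hom_smult[OF h scalar_closed[OF r] x] by simp
  show ?thesis
    using hom_restrictI[OF restrict_scalars_left_module[OF X], of "\<lambda>x. h x \<one>\<^bsub>A\<^esub>" J] smult hom_closed[OF hx]
    by (simp add: hom_add[OF h])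
qed

text \<open>The adjunction turns an extension problem over the algebra into one over
  \<open>R\<close>, where \<open>J\<close> is injective.\<close>

lemma dual_regular_extend:
  assumes X: "fg_module A X" and Y: "fg_module A Y" and g: "g \<in> module_hom A X Y"
    and inj: "inj_on g (carrier X)" and h: "h \<in> module_hom A X (dual_regular R A J)"
  obtains k where "k \<in> module_hom A Y (dual_regular R A J)" "\<And>x. x \<in> carrier X \<Longrightarrow> k (g x) = h x"
proof -
  note lm = fg_left_module[OF X] fg_left_module[OF Y]
  interpret X: left_module A X by (rule lm)
  have hx: "h x \<in> module_hom R A J" if "x \<in> carrier X" for x using hom_closed[OF h that] by simp
  obtain k where k: "k \<in> module_hom R (restrict_scalars R A Y) J"
    "\<And>x. x \<in> carrier X \<Longrightarrow> k (g x) = h x \<one>\<^bsub>A\<^esub>"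
    using injective_extend[OF cogenerator.J_injective fg_restrict_scalars[OF X] fg_restrict_scalars[OF Y]
      hom_restrict_scalars[OF g] _ hom_dual_regular_eval[OF lm(1) h]] inj by auto
  note K = hom_dual_regular[OF lm(2) k(1)]
  have "(\<lambda>x\<in>carrier Y. \<lambda>a\<in>carrier A. k (a \<odot>\<^bsub>Y\<^esub> x)) (g x) = h x" if x: "x \<in> carrier X" for x
  proof (rule hom_eqI[OF _ hx[OF x]])
    show "(\<lambda>x\<in>carrier Y. \<lambda>a\<in>carrier A. k (a \<odot>\<^bsub>Y\<^esub> x)) (g x) \<in> module_hom R A J"
      using hom_closed[OF K hom_closed[OF g x]] by simp
    fix a assume a: "a \<in> carrier A"
    then show "(\<lambda>x\<in>carrier Y. \<lambda>a\<in>carrier A. k (a \<odot>\<^bsub>Y\<^esub> x)) (g x) a = h x a"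
      using x hom_closed[OF g x] k(2)[of "a \<odot>\<^bsub>X\<^esub> x"] by (simp add: hom_smult[OF g] hom_smult[OF h])
  qed
  then show thesis using K that by blast
qed

text \<open>Under the adjunction, a map to \<open>J\<close> that is nonzero at \<open>x\<close>
  becomes a map whose value at \<open>x\<close> is nonzero at 1.\<close>

lemma dual_regular_cogenerator:
  assumes X: "fg_module A X" and x: "x \<in> carrier X" "x \<noteq> \<zero>\<^bsub>X\<^esub>"
  obtains h where "h \<in> module_hom A X (dual_regular R A J)" "h x \<noteq> \<zero>\<^bsub>dual_regular R A J\<^esub>"
proof -
  note lm = fg_left_module[OF X]
  interpret X: left_module A X by (rule lm)
  obtain h where h: "h \<in> module_hom R (restrict_scalars R A X) J" "h x \<noteq> \<zero>\<^bsub>J\<^esub>"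
    using cogenerator.J_cogenerator[OF fg_restrict_scalars[OF X], of x] x by auto
  have "(\<lambda>x\<in>carrier X. \<lambda>a\<in>carrier A. h (a \<odot>\<^bsub>X\<^esub> x)) x \<one>\<^bsub>A\<^esub> \<noteq> \<zero>\<^bsub>dual_regular R A J\<^esub> \<one>\<^bsub>A\<^esub>"
    using x h(2) by simp
  then show thesis using that[OF hom_dual_regular[OF lm h(1)]] by metis
qed

lemma dual_injective:
  assumes K: "fg_module A K" and iso: "module_iso A (dual_regular R A J) K"
  shows "injective_module A K"
  unfolding injective_module_def
proof (intro conjI ballI impI)
  show "fg_module A K" by (rule K)
  note D = dual_regular_left_module
  obtain f where f: "f \<in> module_hom A (dual_regular R A J) K" "bij_betw f (carrier (dual_regular R A J)) (carrier K)"
    using iso by (auto simp: module_iso_def)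
  obtain f' where f': "f' \<in> module_hom A K (dual_regular R A J)" "\<And>y. y \<in> carrier K \<Longrightarrow> f (f' y) = y"
    using iso_inverse[OF D fg_left_module[OF K] f] by metis
  fix X Y g h assume *: "X \<in> mod_cat A" "Y \<in> mod_cat A" "g \<in> module_hom A X Y" "h \<in> module_hom A X K"
    "inj_on g (carrier X)"
  obtain k where k: "k \<in> module_hom A Y (dual_regular R A J)" "\<And>x. x \<in> carrier X \<Longrightarrow> k (g x) = f' (h x)"
    using dual_regular_extend[OF mod_catD(1)[OF *(1)] mod_catD(1)[OF *(2)] *(3,5)
      hom_comp[OF mod_catD(2)[OF *(1)] *(4) f'(1)]] by auto
  show "\<exists>k\<in>module_hom A Y K. \<forall>x\<in>carrier X. k (g x) = h x"
    using hom_comp[OF mod_catD(2)[OF *(2)] k(1) f(1)] k(2) hom_closed[OF *(3)] hom_closed[OF *(4)] f'(2)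
    by (intro bexI) auto
qed

lemma dual_cogenerator:
  assumes K: "left_module A K" and iso: "module_iso A (dual_regular R A J) K"
    and X: "fg_module A X" and x: "x \<in> carrier X" "x \<noteq> \<zero>\<^bsub>X\<^esub>"
  obtains h where "h \<in> module_hom A X K" "h x \<noteq> \<zero>\<^bsub>K\<^esub>"
proof -
  note D = dual_regular_left_module
  obtain f where f: "f \<in> module_hom A (dual_regular R A J) K" "bij_betw f (carrier (dual_regular R A J)) (carrier K)"
    using iso by (auto simp: module_iso_def)
  obtain h where h: "h \<in> module_hom A X (dual_regular R A J)" "h x \<noteq> \<zero>\<^bsub>dual_regular R A J\<^esub>"
    using dual_regular_cogenerator[OF X x] .
  have "f (h x) \<noteq> \<zero>\<^bsub>K\<^esub>"
  proof
    assume "f (h x) = \<zero>\<^bsub>K\<^esub>"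
    then have "h x \<in> ker_module (dual_regular R A J) K f"
      using hom_closed[OF h(1) x(1)] by (simp add: ker_module_def)
    then show False
      using h(2) hom_inj_iff[OF D K f(1)] f(2) by (simp add: bij_betw_def)
  qed
  then show thesis using that[OF hom_comp[OF fg_left_module[OF X] h(1) f(1)]] x(1) by simp
qed

section \<open>Chain conditions on Hom(X, A), approximations and embeddings into projectives\<close>

lemma hom_scalars_left_module:
  assumes X: "left_module A X" shows "left_module R (hom_scalars R A X)"
proof -
  interpret X: left_module A X by (rule X)
  interpret AR: left_module R A by (rule A_left_module)
  note reg = regular_left_module[OF ring_A]
  interpret N: abelian_group "hom_scalars R A X"
    by (rule hom_abelian_groupI[OF X reg]) auto
  have car: "f x \<in> carrier A" if "f \<in> module_hom A X (regular_module A)" "x \<in> carrier X" for f x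
    using hom_closed[OF that] by simp
  have cl: "(\<lambda>x\<in>carrier X. r \<odot>\<^bsub>A\<^esub> f x) \<in> module_hom A X (regular_module A)"
    if f: "f \<in> module_hom A X (regular_module A)" and r: "r \<in> carrier R" for f r
    using X r by (intro hom_restrictI)
      (auto simp: car[OF f] hom_add[OF f] hom_smult[OF f] AR.smult_r_distr smult_mult_right)
  show ?thesis
  proof
    fix r s f assume *: "r \<in> carrier R" "s \<in> carrier R" "f \<in> carrier (hom_scalars R A X)"
    then have f: "f \<in> module_hom A X (regular_module A)" by simp
    show "(r \<oplus>\<^bsub>R\<^esub> s) \<odot>\<^bsub>hom_scalars R A X\<^esub> f = r \<odot>\<^bsub>hom_scalars R A X\<^esub> f \<oplus>\<^bsub>hom_scalars R A X\<^esub> s \<odot>\<^bsub>hom_scalars R A X\<^esub> f"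
      using * by (auto simp: AR.smult_l_distr car[OF f] intro!: restrict_ext)
    show "(r \<otimes>\<^bsub>R\<^esub> s) \<odot>\<^bsub>hom_scalars R A X\<^esub> f = r \<odot>\<^bsub>hom_scalars R A X\<^esub> (s \<odot>\<^bsub>hom_scalars R A X\<^esub> f)"
      using * by (auto simp: AR.smult_assoc1 car[OF f] intro!: restrict_ext)
  next
    fix r f g assume *: "r \<in> carrier R" "f \<in> carrier (hom_scalars R A X)" "g \<in> carrier (hom_scalars R A X)"
    then have fg: "f \<in> module_hom A X (regular_module A)" "g \<in> module_hom A X (regular_module A)" by simp_all
    show "r \<odot>\<^bsub>hom_scalars R A X\<^esub> (f \<oplus>\<^bsub>hom_scalars R A X\<^esub> g)
        = r \<odot>\<^bsub>hom_scalars R A X\<^esub> f \<oplus>\<^bsub>hom_scalars R A X\<^esub> r \<odot>\<^bsub>hom_scalars R A X\<^esub> g"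
      using * by (auto simp: AR.smult_r_distr car[OF fg(1)] car[OF fg(2)] intro!: restrict_ext)
  next
    fix r f assume "r \<in> carrier R" "f \<in> carrier (hom_scalars R A X)"
    then show "r \<odot>\<^bsub>hom_scalars R A X\<^esub> f \<in> carrier (hom_scalars R A X)" using cl by simp
  next
    fix f assume "f \<in> carrier (hom_scalars R A X)"
    then have f: "f \<in> module_hom A X (regular_module A)" by simp
    show "\<one>\<^bsub>R\<^esub> \<odot>\<^bsub>hom_scalars R A X\<^esub> f = f"
    proof -
      have "\<one>\<^bsub>R\<^esub> \<in> carrier R" by simp
      from hom_eqI[OF cl[OF f this] f] show ?thesis using car[OF f] by simp
    qed
  qed
qed

text \<open>A homomorphism is determined by its values at finitely many generators. Evaluation at
  \<open>x\<close> maps \<open>N F\<close> to the algebra with kernel \<open>N (insert x F)\<close>,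
  so the chain condition climbs, one generator at a time, from the zero module \<open>N S\<close> to
  the whole of Hom(X, A).\<close>

lemma hom_scalars_chain:
  assumes X: "fg_module A X" shows "chain_condition up R (hom_scalars R A X)"
proof -
  note lm = fg_left_module[OF X] and reg = regular_left_module[OF ring_A]
  interpret X: left_module A X by (rule lm)
  interpret AR: left_module R A by (rule A_left_module)
  note H = hom_scalars_left_module[OF lm]
  let ?H = "hom_scalars R A X"
  define N where "N F = {f \<in> carrier ?H. \<forall>x\<in>F. f x = \<zero>\<^bsub>A\<^esub>}" for F
  obtain S where S: "finite S" "S \<subseteq> carrier X" "\<And>H. submodule H A X \<Longrightarrow> S \<subseteq> H \<Longrightarrow> H = carrier X"
    using X by (auto simp: fg_module_def)
  have eval: "(\<lambda>f\<in>carrier ?H. f x) \<in> module_hom R ?H A" if "x \<in> carrier X" for x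
    using H that hom_closed by (intro hom_restrictI) fastforce+
  have N: "submodule (N F) R ?H" if F: "F \<subseteq> carrier X" for F
  proof (rule submodule_intro[OF H])
    show "\<zero>\<^bsub>?H\<^esub> \<in> N F" using F hom_const_zero[OF lm reg] by (auto simp: N_def)
    show "f \<oplus>\<^bsub>?H\<^esub> g \<in> N F" if "f \<in> N F" "g \<in> N F" for f g
      using that F hom_plus[OF lm reg] by (auto simp: N_def subset_eq)
    show "r \<odot>\<^bsub>?H\<^esub> f \<in> N F" if "r \<in> carrier R" "f \<in> N F" for r f
      using that F left_module.smult_closed[OF H that(1), of f] by (auto simp: N_def AR.smult_zero_right subset_eq)
  qed (auto simp: N_def)
  have "N S = {\<zero>\<^bsub>?H\<^esub>}"
  proof (rule equalityI; rule subsetI)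
    fix f assume f: "f \<in> N S"
    then have f': "f \<in> module_hom A X (regular_module A)" by (simp add: N_def)
    have "ker_module X (regular_module A) f = carrier X"
      using f S(2) by (intro S(3) ker_submodule[OF lm reg f']) (auto simp: ker_module_def N_def)
    then have "f = (\<lambda>x\<in>carrier X. \<zero>\<^bsub>A\<^esub>)"
      using hom_eqI[OF f' hom_const_zero[OF lm reg]] by (auto simp: ker_module_def)
    then show "f \<in> {\<zero>\<^bsub>?H\<^esub>}" by simp
  qed (use submodule_zero[OF N[OF S(2)]] in auto)
  then have base: "chain_condition up R (?H\<lparr>carrier := N S\<rparr>)"
    by (intro chain_condition_zero submodule_left_module[OF H N[OF S(2)]]) simp
  have "chain_condition up R (?H\<lparr>carrier := N F\<rparr>) \<Longrightarrow> chain_condition up R (?H\<lparr>carrier := N {}\<rparr>)"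
    if "finite F" "F \<subseteq> carrier X" for F
    using that
  proof (induction F)
    case (insert x F)
    then have x: "x \<in> carrier X" and F: "F \<subseteq> carrier X" by auto
    note lmF = submodule_left_module[OF H N[OF F]]
    note ev = hom_restrict[OF H N[OF F] eval[OF x]]
    have NF: "f \<in> carrier ?H" if "f \<in> N F" for f using that by (simp add: N_def)
    have "ker_module (?H\<lparr>carrier := N F\<rparr>) A (\<lambda>f\<in>N F. (\<lambda>f\<in>carrier ?H. f x) f) = N (insert x F)"
      by (auto simp: ker_module_def N_def)
    then have "chain_condition up R (?H\<lparr>carrier := N F\<rparr>)"
      using insert.prems(1) scalars.chain_fg[OF finitely_generated]
      by (intro chain_condition_extension[OF lmF A_left_module ev]) simp_all
    then show ?case using insert.IH F by blast
  qed
  from this[OF S(1,2) base] show ?thesis by (simp add: N_def hom_scalars_def)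
qed

text \<open>
  An approximation is a map \<^term>\<open>f\<close> for which the homomorphisms to the regular module that factor
  through \<^term>\<open>f\<close> form a maximal submodule.
\<close>

lemma ex_approximation:
  assumes X: "fg_module A X"
  obtains Q f where "Q \<in> mod_cat A" "projective_module A Q" "f \<in> module_hom A X Q"
    "extends_along A X Q f (regular_module A)"
proof -
  note lm = fg_left_module[OF X] and reg = regular_left_module[OF ring_A]
  interpret X: left_module A X by (rule lm)
  interpret AR: left_module R A by (rule A_left_module)
  define G where "G Q f = {(\<lambda>x\<in>carrier X. h (f x)) | h. h \<in> module_hom A Q (regular_module A)}"
    for Q :: "('a, 'a univ) module" and f
  let ?\<G> = "{G Q f | Q f. Q \<in> mod_cat A \<and> projective_module A Q \<and> f \<in> module_hom A X Q}"
  have G: "submodule (G Q f) R (hom_scalars R A X)" if Q: "left_module A Q" and f: "f \<in> module_hom A X Q" for Q f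
  proof (rule submodule_intro[OF hom_scalars_left_module[OF lm]])
    show "G Q f \<subseteq> carrier (hom_scalars R A X)" using hom_comp[OF lm f] by (auto simp: G_def)
    show "\<zero>\<^bsub>hom_scalars R A X\<^esub> \<in> G Q f"
      unfolding G_def mem_Collect_eq using hom_const_zero[OF Q reg] hom_closed[OF f]
      by (intro exI[of _ "\<lambda>x\<in>carrier Q. \<zero>\<^bsub>A\<^esub>"]) (auto intro!: restrict_ext)
    show "g \<oplus>\<^bsub>hom_scalars R A X\<^esub> g' \<in> G Q f" if g: "g \<in> G Q f" "g' \<in> G Q f" for g g'
    proof -
      obtain h h' where h: "h \<in> module_hom A Q (regular_module A)" "g = (\<lambda>x\<in>carrier X. h (f x))"
        "h' \<in> module_hom A Q (regular_module A)" "g' = (\<lambda>x\<in>carrier X. h' (f x))"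
        using g by (auto simp: G_def)
      show ?thesis
        unfolding G_def mem_Collect_eq using hom_plus[OF Q reg h(1,3)] h(2,4) hom_closed[OF f]
        by (intro exI[of _ "\<lambda>x\<in>carrier Q. h x \<oplus>\<^bsub>A\<^esub> h' x"]) (auto intro!: restrict_ext)
    qed
    show "r \<odot>\<^bsub>hom_scalars R A X\<^esub> g \<in> G Q f" if r: "r \<in> carrier R" and g: "g \<in> G Q f" for r g
    proof -
      obtain h where h: "h \<in> module_hom A Q (regular_module A)" "g = (\<lambda>x\<in>carrier X. h (f x))"
        using g by (auto simp: G_def)
      show ?thesis
        unfolding G_def mem_Collect_eq
        using left_module.smult_closed[OF hom_scalars_left_module[OF Q] r, of h] h hom_closed[OF f]
        by (intro exI[of _ "\<lambda>x\<in>carrier Q. r \<odot>\<^bsub>A\<^esub> h x"]) (auto intro!: restrict_ext)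
    qed
  qed
  obtain Q0 i i' where Q0: "Q0 \<in> mod_cat A" "i \<in> module_hom A (regular_module A) Q0"
    "i' \<in> module_hom A Q0 (regular_module A)"
    "\<And>x. x \<in> carrier (regular_module A) \<Longrightarrow> i' (i x) = x" "\<And>y. y \<in> carrier Q0 \<Longrightarrow> i (i' y) = y"
    using mod_cat_copy[OF regular_fg[OF ring_A]] by metis
  have "projective_module A Q0"
    by (rule projective_retract[OF projective_regular[OF ring_A] mod_catD(2)[OF Q0(1)] Q0(2,3,5)])
  \<comment> \<open>The zero map into a copy of the regular module shows that the family is not
    empty.\<close>
  then have 0: "G Q0 (\<lambda>x\<in>carrier X. \<zero>\<^bsub>Q0\<^esub>) \<in> ?\<G>"
    using Q0(1) hom_const_zero[OF lm mod_catD(2)[OF Q0(1)]] by blast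
  have sub: "submodule U R (hom_scalars R A X)" if "U \<in> ?\<G>" for U
    using that G mod_catD(2) by blast
  have "\<exists>U\<in>?\<G>. \<forall>V\<in>?\<G>. U \<subseteq> V \<longrightarrow> V = U"
    by (rule chain_condition_maximal[OF hom_scalars_chain[OF X] 0 sub])
  then obtain U where UG: "U \<in> ?\<G>" and max: "\<forall>V\<in>?\<G>. U \<subseteq> V \<longrightarrow> V = U" ..
  from UG obtain Q f where U: "U = G Q f" and Q: "Q \<in> mod_cat A" "projective_module A Q"
    and f: "f \<in> module_hom A X Q" by blast
  note lmQ = mod_catD(2)[OF Q(1)]
  interpret Q: left_module A Q by (rule lmQ)
  have "\<exists>h\<in>module_hom A Q (regular_module A). \<forall>x\<in>carrier X. h (f x) = g x"
    if g: "g \<in> module_hom A X (regular_module A)" for g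
  proof -
    let ?D = "direct_sum_module Q (regular_module A)"
    note D = direct_sum_left_module[OF lmQ reg]
    obtain Q' j j' where Q': "Q' \<in> mod_cat A" "j \<in> module_hom A ?D Q'" "j' \<in> module_hom A Q' ?D"
      "\<And>x. x \<in> carrier ?D \<Longrightarrow> j' (j x) = x" "\<And>y. y \<in> carrier Q' \<Longrightarrow> j (j' y) = y"
      using mod_cat_copy[OF fg_direct_sum[OF mod_catD(1)[OF Q(1)] regular_fg[OF ring_A]]] by metis
    note lmQ' = mod_catD(2)[OF Q'(1)]
    have P: "projective_module A Q'"
      by (rule projective_retract[OF projective_direct_sum[OF Q(2) projective_regular[OF ring_A]] lmQ' Q'(2,3,5)])
    \<comment> \<open>\<open>g\<close> is adjoined as a second component. Whatever factors through
      \<open>f\<close> factors through \<open>f'\<close>, and so does \<open>g\<close>; by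
      maximality \<open>g\<close> then factors through \<open>f\<close>.\<close>
    define f' where "f' = (\<lambda>x\<in>carrier X. j ((\<lambda>x\<in>carrier X. (f x, g x)) x))"
    have f': "f' \<in> module_hom A X Q'"
      unfolding f'_def by (rule hom_comp[OF lm hom_pair[OF lmQ reg lm f g] Q'(2)])
    have j'f': "j' (f' x) = (f x, g x)" if "x \<in> carrier X" for x
      using that Q'(4)[of "(f x, g x)"] hom_closed[OF f] hom_closed[OF g] by (simp add: f'_def)
    have "G Q f \<subseteq> G Q' f'"
    proof
      fix u assume "u \<in> G Q f"
      then obtain h where h: "h \<in> module_hom A Q (regular_module A)" "u = (\<lambda>x\<in>carrier X. h (f x))"
        by (auto simp: G_def)
      note k = hom_comp[OF lmQ' hom_comp[OF lmQ' Q'(3) hom_fst[OF lmQ reg]] h(1)]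
      show "u \<in> G Q' f'"
        unfolding G_def h(2) mem_Collect_eq using k hom_closed[OF f'] j'f' hom_closed[OF f] hom_closed[OF g]
        by (intro exI conjI[OF _ k]) (auto intro!: restrict_ext)
    qed
    moreover have "G Q' f' \<in> ?\<G>" using Q'(1) P f' by blast
    ultimately have "G Q' f' = G Q f" using max[unfolded U, rule_format] by simp
    moreover have "g \<in> G Q' f'"
    proof -
      note k = hom_comp[OF lmQ' Q'(3) hom_snd[OF lmQ reg]]
      have "g = (\<lambda>x\<in>carrier X. (\<lambda>x\<in>carrier Q'. (\<lambda>x\<in>carrier Q \<times> carrier (regular_module A). snd x) (j' x)) (f' x))"
        by (rule hom_eqI[OF g hom_comp[OF lm f' k]])
          (use hom_closed[OF f'] j'f' hom_closed[OF f] hom_closed[OF g] in simp)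
      then show ?thesis unfolding G_def using k by blast
    qed
    ultimately obtain h where "h \<in> module_hom A Q (regular_module A)" "g = (\<lambda>x\<in>carrier X. h (f x))"
      by (auto simp: G_def)
    then show ?thesis by auto
  qed
  then show thesis using that[OF Q f] by (auto simp: extends_along_def)
qed

text \<open>Take a map \<open>f\<close> to a projective module with minimal kernel. If the kernel
  contained a nonzero \<open>x\<close>, a map to \<open>K\<close> that is nonzero at
  \<open>x\<close> would lift to a map \<open>g\<close> to \<open>P\<close>, and the pair of
  \<open>f\<close> and \<open>g\<close> would have a strictly smaller kernel.\<close>

lemma torsionless_if_lift:
  assumes K: "left_module A K" and iso: "module_iso A (dual_regular R A J) K"
    and P: "P \<in> mod_cat A" "projective_module A P" and p: "p \<in> module_hom A P K"
    and M: "fg_module A M"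
    and lift: "\<And>h. h \<in> module_hom A M K \<Longrightarrow> \<exists>k\<in>module_hom A M P. \<forall>x\<in>carrier M. p (k x) = h x"
  shows "torsionless A M"
proof -
  note lm = fg_left_module[OF M] and lmP = mod_catD(2)[OF P(1)]
  interpret M: left_module A M by (rule lm)
  let ?S = "{ker_module M Q f | Q f. Q \<in> mod_cat A \<and> projective_module A Q \<and> f \<in> module_hom A M Q}"
  have sub: "submodule U A M" if "U \<in> ?S" for U using that ker_submodule[OF lm] mod_catD(2) by blast
  have 0: "ker_module M P (\<lambda>x\<in>carrier M. \<zero>\<^bsub>P\<^esub>) \<in> ?S" using P hom_const_zero[OF lm lmP] by blast
  have "\<exists>U\<in>?S. \<forall>V\<in>?S. V \<subseteq> U \<longrightarrow> V = U"
    by (rule chain_condition_minimal[OF algebra.chain_fg[OF M] 0 sub])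
  then obtain U where US: "U \<in> ?S" and min: "\<forall>V\<in>?S. V \<subseteq> U \<longrightarrow> V = U" ..
  from US obtain Q :: "('a, 'a univ) module" and f where U: "U = ker_module M Q f"
    and Q: "Q \<in> mod_cat A" "projective_module A Q" and f: "f \<in> module_hom A M Q" by blast
  note lmQ = mod_catD(2)[OF Q(1)]
  have "x = \<zero>\<^bsub>M\<^esub>" if x: "x \<in> ker_module M Q f" for x
  proof (rule ccontr)
    assume nz: "x \<noteq> \<zero>\<^bsub>M\<^esub>"
    have xM: "x \<in> carrier M" using x by (simp add: ker_module_def)
    obtain h where h: "h \<in> module_hom A M K" "h x \<noteq> \<zero>\<^bsub>K\<^esub>" using dual_cogenerator[OF K iso M xM nz] .
    obtain g where g: "g \<in> module_hom A M P" "\<And>x. x \<in> carrier M \<Longrightarrow> p (g x) = h x"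
      using lift[OF h(1)] by blast
    have gx: "g x \<noteq> \<zero>\<^bsub>P\<^esub>" using g(2)[OF xM] h(2) hom_zero[OF lmP K p] by auto
    let ?D = "direct_sum_module Q P"
    note D = direct_sum_left_module[OF lmQ lmP]
    obtain Q' j j' where Q': "Q' \<in> mod_cat A" "j \<in> module_hom A ?D Q'" "j' \<in> module_hom A Q' ?D"
      "\<And>x. x \<in> carrier ?D \<Longrightarrow> j' (j x) = x" "\<And>y. y \<in> carrier Q' \<Longrightarrow> j (j' y) = y"
      using mod_cat_copy[OF fg_direct_sum[OF mod_catD(1)[OF Q(1)] mod_catD(1)[OF P(1)]]] by metis
    note lmQ' = mod_catD(2)[OF Q'(1)]
    have PQ': "projective_module A Q'"
      by (rule projective_retract[OF projective_direct_sum[OF Q(2) P(2)] lmQ' Q'(2,3,5)])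
    define f' where "f' = (\<lambda>x\<in>carrier M. j ((\<lambda>x\<in>carrier M. (f x, g x)) x))"
    have f': "f' \<in> module_hom A M Q'"
      unfolding f'_def by (rule hom_comp[OF lm hom_pair[OF lmQ lmP lm f g(1)] Q'(2)])
    have zero: "f y = \<zero>\<^bsub>Q\<^esub> \<and> g y = \<zero>\<^bsub>P\<^esub>" if y: "y \<in> ker_module M Q' f'" for y
    proof -
      have yM: "y \<in> carrier M" "f' y = \<zero>\<^bsub>Q'\<^esub>" using y by (auto simp: ker_module_def)
      have "(f y, g y) = j' (f' y)"
        using yM(1) Q'(4)[of "(f y, g y)"] hom_closed[OF f] hom_closed[OF g(1)] by (simp add: f'_def)
      also have "\<dots> = (\<zero>\<^bsub>Q\<^esub>, \<zero>\<^bsub>P\<^esub>)" using yM(2) hom_zero[OF lmQ' D Q'(3)] by simp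
      finally show ?thesis by simp
    qed
    have "y \<in> ker_module M Q f" if "y \<in> ker_module M Q' f'" for y
      using zero[OF that] that by (simp add: ker_module_def)
    then have "ker_module M Q' f' \<subseteq> ker_module M Q f" by blast
    moreover have "ker_module M Q' f' \<in> ?S" using Q'(1) PQ' f' by blast
    ultimately have "ker_module M Q' f' = ker_module M Q f" using min[unfolded U, rule_format] by simp
    then have "x \<in> ker_module M Q' f'" using x by blast
    then show False using zero gx by blast
  qed
  then have "ker_module M Q f = {\<zero>\<^bsub>M\<^esub>}"
    using submodule_zero[OF ker_submodule[OF lm lmQ f]] by blast
  then have "inj_on f (carrier M)" using hom_inj_iff[OF lm lmQ f] by simp
  then show ?thesis unfolding torsionless_def using Q f by blast
qed

end

section \<open>Minimal approximations and covers\<close>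

text \<open>Phrased by summands, minimality can be read off from a minimal element of a family of
  submodules. \<open>left_minimal_bij\<close> leads from it to the condition on endomorphisms that
  defines a minimal approximation.\<close>

definition left_minimal ::
    "('a, 'r) ring_scheme \<Rightarrow> ('a, 'k) module \<Rightarrow> ('a, 'p) module \<Rightarrow> ('k \<Rightarrow> 'p) \<Rightarrow> bool" where
  "left_minimal A X Q f \<longleftrightarrow> (\<forall>H U. internal_sum A Q H U \<longrightarrow> f ` carrier X \<subseteq> H \<longrightarrow> U = {\<zero>\<^bsub>Q\<^esub>})"

text \<open>The dual notion: for a surjection from a projective module it describes a projective
  cover in terms of summands.\<close>

definition right_minimal ::
    "('a, 'r) ring_scheme \<Rightarrow> ('a, 'p) module \<Rightarrow> ('a, 'm) module \<Rightarrow> ('p \<Rightarrow> 'm) \<Rightarrow> bool" where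
  "right_minimal A Q Y e \<longleftrightarrow> (\<forall>H U. internal_sum A Q H U \<longrightarrow> U \<subseteq> ker_module Q Y e \<longrightarrow> U = {\<zero>\<^bsub>Q\<^esub>})"

lemma internal_sum_trivial:
  assumes Q: "left_module A Q" shows "internal_sum A Q (carrier Q) {\<zero>\<^bsub>Q\<^esub>}"
proof -
  interpret left_module A Q by (rule Q)
  show ?thesis
  proof (rule internal_sumI[OF Q carrier_submodule[OF Q] zero_submodule[OF Q]])
    fix x assume "x \<in> carrier Q"
    then show "\<exists>h\<in>carrier Q. \<exists>u\<in>{\<zero>\<^bsub>Q\<^esub>}. x = h \<oplus>\<^bsub>Q\<^esub> u" by (intro bexI[of _ x] bexI[of _ "\<zero>\<^bsub>Q\<^esub>"]) auto
  qed auto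
qed

lemma internal_sum_zero_right:
  assumes Q: "left_module A Q" and sum: "internal_sum A Q H {\<zero>\<^bsub>Q\<^esub>}" shows "H = carrier Q"
proof -
  interpret left_module A Q by (rule Q)
  note D = internal_sumD[OF sum]
  have "x \<in> H" if "x \<in> carrier Q" for x
    using that
  proof (rule internal_sum_decompose[OF sum])
    fix h u assume "h \<in> H" "u \<in> {\<zero>\<^bsub>Q\<^esub>}" "x = h \<oplus>\<^bsub>Q\<^esub> u"
    then show "x \<in> H" using submodule_subset[OF D(1)] by auto
  qed
  then show ?thesis using submodule_subset[OF D(1)] by blast
qed

lemma internal_sum_eq_zero:
  assumes "internal_sum A (Q\<lparr>carrier := H\<rparr>) H U" shows "U = {\<zero>\<^bsub>Q\<^esub>}"
  using internal_sumD(2,3)[OF assms] submodule_subset[OF internal_sumD(2)[OF assms]] by auto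

context finite_length_ring
begin

text \<open>\<open>Q\<close> is a minimal summand of \<open>Q0\<close> containing the image of
  \<open>f\<close>. Extensions to \<open>Q0\<close> restrict to \<open>Q\<close>, and a proper
  summand of \<open>Q\<close> containing the image would be a smaller choice.\<close>

lemma ex_left_minimal:
  assumes X: "left_module A X" and Q0: "Q0 \<in> mod_cat A" "projective_module A Q0"
    and f: "f \<in> module_hom A X Q0" and ext: "extends_along A X Q0 f (regular_module A)"
  obtains Q where "Q \<in> mod_cat A" "projective_module A Q" "f \<in> module_hom A X Q"
    "extends_along A X Q f (regular_module A)" "left_minimal A X Q f"
proof -
  note lm = mod_catD(2)[OF Q0(1)]
  let ?S = "{H. (\<exists>U. internal_sum A Q0 H U) \<and> f ` carrier X \<subseteq> H}"
  have S: "carrier Q0 \<in> ?S" using internal_sum_trivial[OF lm] hom_closed[OF f] by blast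
  have sub: "submodule U A Q0" if "U \<in> ?S" for U using that internal_sumD(1) by blast
  have "\<exists>U\<in>?S. \<forall>V\<in>?S. V \<subseteq> U \<longrightarrow> V = U"
    by (rule chain_condition_minimal[OF chain_fg[OF mod_catD(1)[OF Q0(1)]] S sub])
  then obtain H where HS: "H \<in> ?S" and min: "\<forall>V\<in>?S. V \<subseteq> H \<longrightarrow> V = H" ..
  from HS obtain U where sum: "internal_sum A Q0 H U" and fH: "f ` carrier X \<subseteq> H" by blast
  note H = internal_sumD(1)[OF sum]
  let ?Q = "Q0\<lparr>carrier := H\<rparr>"
  have proj: "projective_module A ?Q" by (rule summand_projective[OF Q0(2) sum])
  have cat: "?Q \<in> mod_cat A" using projective_fg[OF proj] by (simp add: mod_cat_def)
  have f': "f \<in> module_hom A X ?Q" by (rule hom_codom[OF f fH])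
  have ext': "extends_along A X ?Q f (regular_module A)"
    unfolding extends_along_def
  proof
    fix g assume "g \<in> module_hom A X (regular_module A)"
    then obtain h where h: "h \<in> module_hom A Q0 (regular_module A)" "\<And>x. x \<in> carrier X \<Longrightarrow> h (f x) = g x"
      using extends_alongE[OF ext] by metis
    show "\<exists>h\<in>module_hom A ?Q (regular_module A). \<forall>x\<in>carrier X. h (f x) = g x"
      using hom_restrict[OF lm H h(1)] h(2) fH by (intro bexI) auto
  qed
  have "left_minimal A X ?Q f"
    unfolding left_minimal_def
  proof (intro allI impI)
    fix V W assume VW: "internal_sum A ?Q V W" "f ` carrier X \<subseteq> V"
    have "V \<in> ?S" using internal_sum_refine[OF lm sum VW(1)] VW(2) by blast
    moreover have "V \<subseteq> H" using submodule_subset[OF internal_sumD(1)[OF VW(1)]] by simp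
    ultimately have "V = H" using min by blast
    then show "W = {\<zero>\<^bsub>?Q\<^esub>}" using internal_sum_eq_zero[OF VW(1)[unfolded \<open>V = H\<close>]] by simp
  qed
  then show thesis using that cat proj f' ext' by blast
qed

text \<open>Of a free cover, a minimal summand with a complement inside the kernel is kept. It still
  covers \<open>M\<close> because the complement is killed.\<close>

lemma ex_right_minimal:
  assumes M: "fg_module A M"
  obtains Q e where "Q \<in> mod_cat A" "projective_module A Q" "e \<in> module_hom A Q M"
    "e ` carrier Q = carrier M" "right_minimal A Q M e"
proof -
  note lmM = fg_left_module[OF M]
  interpret M: left_module A M by (rule lmM)
  obtain F e where F: "free_module A F" "e \<in> module_hom A F M" "e ` carrier F = carrier M"
    using free_cover[OF M] by blast
  note proj0 = free_projective[OF F(1)]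
  note lm = projective_left_module[OF proj0]
  note ker = ker_submodule[OF lm lmM F(2)]
  let ?S = "{H. \<exists>U. internal_sum A F H U \<and> U \<subseteq> ker_module F M e}"
  have S: "carrier F \<in> ?S" using internal_sum_trivial[OF lm] submodule_zero[OF ker] by blast
  have sub: "submodule U A F" if "U \<in> ?S" for U using that internal_sumD(1) by blast
  have "\<exists>U\<in>?S. \<forall>V\<in>?S. V \<subseteq> U \<longrightarrow> V = U"
    by (rule chain_condition_minimal[OF chain_fg[OF free_fg[OF F(1)]] S sub])
  then obtain H where HS: "H \<in> ?S" and min: "\<forall>V\<in>?S. V \<subseteq> H \<longrightarrow> V = H" ..
  from HS obtain U where sum: "internal_sum A F H U" and U: "U \<subseteq> ker_module F M e" by blast
  note H = internal_sumD(1)[OF sum]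
  have Hc: "x \<in> carrier F" if "x \<in> H" for x using that submodule_subset[OF H] by blast
  let ?Q = "F\<lparr>carrier := H\<rparr>"
  define e' where "e' = (\<lambda>x\<in>H. e x)"
  have proj: "projective_module A ?Q" by (rule summand_projective[OF proj0 sum])
  have cat: "?Q \<in> mod_cat A" using projective_fg[OF proj] by (simp add: mod_cat_def)
  have e': "e' \<in> module_hom A ?Q M" unfolding e'_def by (rule hom_restrict[OF lm H F(2)])
  have surj: "e' ` carrier ?Q = carrier M"
  proof (rule equalityI)
    show "carrier M \<subseteq> e' ` carrier ?Q"
    proof
      fix y assume "y \<in> carrier M"
      then obtain x where x: "x \<in> carrier F" "y = e x" unfolding F(3)[symmetric] by blast
      obtain h u where hu: "h \<in> H" "u \<in> U" "x = h \<oplus>\<^bsub>F\<^esub> u" using x(1) by (rule internal_sum_decompose[OF sum])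
      have "u \<in> carrier F" "e u = \<zero>\<^bsub>M\<^esub>" using hu(2) U by (auto simp: ker_module_def)
      then have "y = e' h" using x hu Hc[OF hu(1)] hom_closed[OF F(2) Hc[OF hu(1)]] by (simp add: e'_def hom_add[OF F(2)])
      then show "y \<in> e' ` carrier ?Q" using hu(1) by simp
    qed
  qed (use hom_closed[OF e'] in blast)
  have "right_minimal A ?Q M e'"
    unfolding right_minimal_def
  proof (intro allI impI)
    fix V W assume VW: "internal_sum A ?Q V W" "W \<subseteq> ker_module ?Q M e'"
    have "W \<subseteq> ker_module F M e" using VW(2) Hc by (auto simp: ker_module_def e'_def)
    \<comment> \<open>The enlarged complement of \<open>V\<close> lies in the kernel as well, so
      \<open>V\<close> belongs to the family in which \<open>H\<close> is minimal.\<close>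
    then have "W <+>\<^bsub>F\<^esub> U \<subseteq> ker_module F M e" using U submodule_add[OF ker] unfolding mem_set_add subset_iff by blast
    then have "V \<in> ?S" using internal_sum_refine[OF lm sum VW(1)] by blast
    moreover have "V \<subseteq> H" using submodule_subset[OF internal_sumD(1)[OF VW(1)]] by simp
    ultimately have "V = H" using min by blast
    then show "W = {\<zero>\<^bsub>?Q\<^esub>}" using internal_sum_eq_zero[OF VW(1)[unfolded \<open>V = H\<close>]] by simp
  qed
  then show thesis using that cat proj e' surj by blast
qed

text \<open>By Fitting's lemma, \<open>Q\<close> is the sum of the image and the kernel of a power
  of \<open>t\<close>. The power fixes the image of \<open>f\<close>, so left minimality makes its
  kernel zero; the power is then bijective, and \<open>t\<close> with it.\<close>

lemma left_minimal_bij: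
  assumes Q: "fg_module A Q" and f: "f \<in> module_hom A X Q" and min: "left_minimal A X Q f"
    and t: "t \<in> module_hom A Q Q" and tf: "\<And>x. x \<in> carrier X \<Longrightarrow> t (f x) = f x"
  shows "bij_betw t (carrier Q) (carrier Q)"
proof -
  note lm = fg_left_module[OF Q]
  obtain n where sum: "internal_sum A Q ((t ^^ Suc n) ` carrier Q) {x \<in> carrier Q. (t ^^ Suc n) x = \<zero>\<^bsub>Q\<^esub>}"
    using fitting[OF Q t] .
  have cl: "(t ^^ k) x \<in> carrier Q" if "x \<in> carrier Q" for k x
    using that by (induction k) (auto simp: hom_closed[OF t])
  have "(t ^^ k) (f x) = f x" if "x \<in> carrier X" for k x using that by (induction k) (auto simp: tf)
  then have "f ` carrier X \<subseteq> (t ^^ Suc n) ` carrier Q" using hom_closed[OF f] by (metis image_eqI image_subsetI)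
  then have N: "{x \<in> carrier Q. (t ^^ Suc n) x = \<zero>\<^bsub>Q\<^esub>} = {\<zero>\<^bsub>Q\<^esub>}" using min sum unfolding left_minimal_def by blast
  have I: "(t ^^ Suc n) ` carrier Q = carrier Q" using internal_sum_zero_right[OF lm sum[unfolded N]] .
  have zero: "(t ^^ k) \<zero>\<^bsub>Q\<^esub> = \<zero>\<^bsub>Q\<^esub>" for k by (induction k) (auto simp: hom_zero[OF lm lm t])
  have "x = \<zero>\<^bsub>Q\<^esub>" if "x \<in> carrier Q" "t x = \<zero>\<^bsub>Q\<^esub>" for x
  proof -
    have "(t ^^ Suc n) x = \<zero>\<^bsub>Q\<^esub>" using that zero by (simp add: funpow_swap1)
    then show ?thesis using N that by blast
  qed
  then have "ker_module Q Q t \<subseteq> {\<zero>\<^bsub>Q\<^esub>}" unfolding ker_module_def by blast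
  then have "ker_module Q Q t = {\<zero>\<^bsub>Q\<^esub>}" using submodule_zero[OF ker_submodule[OF lm lm t]] by blast
  then have "inj_on t (carrier Q)" using hom_inj_iff[OF lm lm t] by simp
  moreover have "carrier Q \<subseteq> t ` carrier Q"
  proof
    fix y assume "y \<in> carrier Q"
    then have "y \<in> (t ^^ Suc n) ` carrier Q" by (simp only: I)
    then obtain x where "x \<in> carrier Q" "y = t ((t ^^ n) x)" by auto
    then show "y \<in> t ` carrier Q" using cl by blast
  qed
  ultimately show ?thesis using hom_closed[OF t] by (auto simp: bij_betw_def)
qed

text \<open>If the difference of \<open>h\<close> and \<open>u\<close> lies in the image of
  \<open>f\<close>, it is a sum of \<open>f a\<close> in \<open>H\<close> and \<open>f b\<close> in
  \<open>U\<close>. Comparing components gives \<open>h = f a\<close>, which \<open>e\<close> kills;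
  so the images of \<open>H\<close> and \<open>U\<close> meet in zero.\<close>

lemma internal_sum_quotient:
  assumes ex: "short_exact A X Q Y f e" and sum: "internal_sum A Q H U"
    and split: "\<And>x. x \<in> carrier X \<Longrightarrow> \<exists>a\<in>carrier X. \<exists>b\<in>carrier X. f a \<in> H \<and> f b \<in> U \<and> f x = f a \<oplus>\<^bsub>Q\<^esub> f b"
  shows "internal_sum A Y (e ` H) (e ` U)"
proof -
  note S = short_exactD[OF ex] and D = internal_sumD[OF sum]
  interpret Q: left_module A Q by (rule S)
  interpret Y: left_module A Y by (rule S)
  have c: "x \<in> carrier Q" if "x \<in> H \<or> x \<in> U" for x
    using that submodule_subset[OF D(1)] submodule_subset[OF D(2)] by blast
  show ?thesis
  proof (rule internal_sumI[OF S(3) image_submodule[OF S(2,3,5) D(1)] image_submodule[OF S(2,3,5) D(2)]])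
    fix y assume "y \<in> e ` H" "y \<in> e ` U"
    then obtain h u where hu: "h \<in> H" "u \<in> U" "y = e h" "e h = e u" by auto
    have cc: "h \<in> carrier Q" "u \<in> carrier Q" using hu c by auto
    have "h \<ominus>\<^bsub>Q\<^esub> u \<in> ker_module Q Y e"
      using cc hu(4) hom_closed[OF S(5)] by (simp add: ker_module_def hom_diff[OF S(2,3,5)])
    then obtain x where x: "x \<in> carrier X" "h \<ominus>\<^bsub>Q\<^esub> u = f x" unfolding S(8)[symmetric] by blast
    obtain a b where ab: "a \<in> carrier X" "b \<in> carrier X" "f a \<in> H" "f b \<in> U" "f x = f a \<oplus>\<^bsub>Q\<^esub> f b"
      using split[OF x(1)] by blast
    have cf: "f a \<in> carrier Q" "f b \<in> carrier Q" using ab c by auto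
    have "h = (f a \<oplus>\<^bsub>Q\<^esub> f b) \<oplus>\<^bsub>Q\<^esub> u" using x(2) ab(5) cc Q.diff_add_cancel(1)[of h u] by simp
    also have "\<dots> = (f b \<oplus>\<^bsub>Q\<^esub> u) \<oplus>\<^bsub>Q\<^esub> f a" using cc cf by (simp add: Q.M.a_ac)
    finally have "h \<ominus>\<^bsub>Q\<^esub> f a = f b \<oplus>\<^bsub>Q\<^esub> u" using cc cf by (simp add: Q.diff_add_cancel)
    moreover have "h \<ominus>\<^bsub>Q\<^esub> f a \<in> H" using submodule_diff[OF D(1) hu(1) ab(3)] .
    moreover have "f b \<oplus>\<^bsub>Q\<^esub> u \<in> U" using submodule_add[OF D(2) ab(4) hu(2)] .
    ultimately have "h \<ominus>\<^bsub>Q\<^esub> f a \<in> H \<inter> U" by simp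
    then have "h = f a" using D(3) cc cf by simp
    then show "y = \<zero>\<^bsub>Y\<^esub>" using hu(3) short_exact_comp_zero[OF ex ab(1)] by simp
  next
    fix y assume "y \<in> carrier Y"
    then obtain x where x: "x \<in> carrier Q" "y = e x" unfolding S(7)[symmetric] by blast
    obtain h u where "h \<in> H" "u \<in> U" "x = h \<oplus>\<^bsub>Q\<^esub> u" using x(1) by (rule internal_sum_decompose[OF sum])
    then show "\<exists>h\<in>e ` H. \<exists>u\<in>e ` U. y = h \<oplus>\<^bsub>Y\<^esub> u" using x c hom_add[OF S(5)] by blast
  qed
qed

lemma short_exact_zero_kernel:
  assumes ex: "short_exact A X Q Y f e" and zero: "f ` carrier X \<subseteq> {\<zero>\<^bsub>Q\<^esub>}" and Q: "projective_module A Q"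
  shows "projective_module A Y"
proof -
  note S = short_exactD[OF ex]
  have "ker_module Q Y e = {\<zero>\<^bsub>Q\<^esub>}"
    using zero submodule_zero[OF ker_submodule[OF S(2,3,5)]] unfolding S(8) by blast
  then have "bij_betw e (carrier Q) (carrier Y)" using hom_inj_iff[OF S(2,3,5)] S(7) by (simp add: bij_betw_def)
  then show ?thesis using projective_iso[OF Q S(3)] S(5) by (auto simp: module_iso_def)
qed

text \<open>
  A projection of \<^term>\<open>X\<close> extends to an endomorphism of \<^term>\<open>Q\<close>, to which Fitting's lemma applies; in
  \<open>cosyzygy_indecomposable\<close>, a projection of \<^term>\<open>Y\<close> is lifted instead.
\<close>

lemma syzygy_indecomposable:
  assumes ex: "short_exact A X Q Y f e" and Q: "projective_module A Q"
    and ext: "extends_along A X Q f (regular_module A)" and min: "right_minimal A Q Y e"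
    and ind: "indecomposable_module A Y" and nonproj: "\<not> projective_module A Y"
  shows "indecomposable_module A X" "\<not> projective_module A X" "left_minimal A X Q f"
proof -
  note S = short_exactD[OF ex]
  interpret X: left_module A X by (rule S)
  interpret Q: left_module A Q by (rule S)
  \<comment> \<open>By right minimality, a summand that \<open>e\<close> kills is zero.\<close>
  have ker: "H = {\<zero>\<^bsub>Q\<^esub>}" if sum: "internal_sum A Q H U" and "e ` H = {\<zero>\<^bsub>Y\<^esub>} \<or> H \<subseteq> ker_module Q Y e" for H U
  proof -
    have "H \<subseteq> ker_module Q Y e"
      using that(2) submodule_subset[OF internal_sumD(1)[OF sum]] by (auto simp: ker_module_def)
    then show ?thesis using min internal_sum_sym[OF S(2) sum] unfolding right_minimal_def by blast
  qed
  have cases: "e ` H = {\<zero>\<^bsub>Y\<^esub>} \<or> e ` U = {\<zero>\<^bsub>Y\<^esub>}" if "internal_sum A Y (e ` H) (e ` U)" for H U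
    using ind that unfolding indecomposable_iff by blast
  show "left_minimal A X Q f"
    unfolding left_minimal_def
  proof (intro allI impI)
    fix H U assume sum: "internal_sum A Q H U" and fH: "f ` carrier X \<subseteq> H"
    note D = internal_sumD[OF sum]
    have "internal_sum A Y (e ` H) (e ` U)"
    proof (rule internal_sum_quotient[OF ex sum])
      fix x assume x: "x \<in> carrier X"
      have "f x \<in> H" using x fH by blast
      moreover have "f \<zero>\<^bsub>X\<^esub> = \<zero>\<^bsub>Q\<^esub>" by (rule hom_zero[OF S(1,2,4)])
      ultimately show "\<exists>a\<in>carrier X. \<exists>b\<in>carrier X. f a \<in> H \<and> f b \<in> U \<and> f x = f a \<oplus>\<^bsub>Q\<^esub> f b"
        using x submodule_zero[OF D(2)] hom_closed[OF S(4) x]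
        by (intro bexI[OF _ x] bexI[OF _ X.zero_closed]) simp
    qed
    then show "U = {\<zero>\<^bsub>Q\<^esub>}"
    proof (rule cases[THEN disjE])
      assume "e ` H = {\<zero>\<^bsub>Y\<^esub>}"
      then have "H = {\<zero>\<^bsub>Q\<^esub>}" using ker[OF sum] by blast
      \<comment> \<open>If \<open>H\<close> were zero, so would be \<open>f\<close>, and
        \<open>Y\<close> would be isomorphic to the projective module \<open>Q\<close>.\<close>
      then show ?thesis using short_exact_zero_kernel[OF ex _ Q] fH nonproj by blast
    next
      assume "e ` U = {\<zero>\<^bsub>Y\<^esub>}"
      then show ?thesis using ker[OF internal_sum_sym[OF S(2) sum]] by blast
    qed
  qed
  show nonprojX: "\<not> projective_module A X"
  proof
    \<comment> \<open>The identity of \<open>X\<close> would extend along \<open>f\<close>. The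
      resulting retraction makes the image of \<open>f\<close> a summand inside the kernel of
      \<open>e\<close>, hence zero, and \<open>Y\<close> would be projective.\<close>
    assume "projective_module A X"
    then have "extends_along A X Q f X" by (rule extends_along_projective[OF S(1,2,4) ext])
    then obtain r where r: "r \<in> module_hom A Q X" "\<And>x. x \<in> carrier X \<Longrightarrow> r (f x) = x"
      using extends_alongE[OF _ hom_id[OF S(1)]] by (metis restrict_apply')
    define p where "p = (\<lambda>q\<in>carrier Q. f (r q))"
    have p: "p \<in> module_hom A Q Q" unfolding p_def by (rule hom_comp[OF S(2) r(1) S(4)])
    have sum: "internal_sum A Q (p ` carrier Q) (ker_module Q Q p)"
      using r(2) hom_closed[OF r(1)] hom_closed[OF S(4)] by (intro internal_sum_idempotent[OF S(2) p]) (simp add: p_def)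
    have "p ` carrier Q \<subseteq> f ` carrier X" using hom_closed[OF r(1)] by (auto simp: p_def)
    then have "p ` carrier Q = {\<zero>\<^bsub>Q\<^esub>}" using ker[OF sum] unfolding S(8) by blast
    moreover have "f ` carrier X \<subseteq> p ` carrier Q"
    proof
      fix y assume "y \<in> f ` carrier X"
      then obtain x where x: "x \<in> carrier X" "y = f x" by blast
      then have "y = p (f x)" using r(2) hom_closed[OF S(4)] by (simp add: p_def)
      then show "y \<in> p ` carrier Q" using hom_closed[OF S(4) x(1)] by blast
    qed
    ultimately show False using short_exact_zero_kernel[OF ex _ Q] nonproj by simp
  qed
  have "X1 = {\<zero>\<^bsub>X\<^esub>} \<or> X2 = {\<zero>\<^bsub>X\<^esub>}" if sumX: "internal_sum A X X1 X2" for X1 X2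
  proof -
    note DX = internal_sumD[OF sumX]
    have cX: "x \<in> carrier X" if "x \<in> X1 \<or> x \<in> X2" for x
      using that submodule_subset[OF DX(1)] submodule_subset[OF DX(2)] by blast
    obtain p where p: "p \<in> module_hom A X X" "\<And>x. x \<in> X1 \<Longrightarrow> p x = x" "\<And>x. x \<in> X2 \<Longrightarrow> p x = \<zero>\<^bsub>X\<^esub>"
      using internal_sum_projection[OF S(1) sumX] by metis
    obtain t where t: "t \<in> module_hom A Q Q" "\<And>x. x \<in> carrier X \<Longrightarrow> t (f x) = f (p x)"
      using extends_alongE[OF extends_along_projective[OF S(1,2,4) ext Q] hom_comp[OF S(1) p(1) S(4)]] by auto
    obtain n where sum: "internal_sum A Q ((t ^^ Suc n) ` carrier Q) {x \<in> carrier Q. (t ^^ Suc n) x = \<zero>\<^bsub>Q\<^esub>}"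
      using fitting[OF projective_fg[OF Q] t(1)] .
    let ?I = "(t ^^ Suc n) ` carrier Q" and ?N = "{x \<in> carrier Q. (t ^^ Suc n) x = \<zero>\<^bsub>Q\<^esub>}"
    \<comment> \<open>Powers of \<open>t\<close> fix the image of \<open>X1\<close>, and positive
      powers kill that of \<open>X2\<close>. The two Fitting parts therefore split the image of
      \<open>f\<close>, and the decomposition descends to \<open>Y\<close>.\<close>
    have t1: "(t ^^ k) (f x) = f x" if "x \<in> X1" for k x
      using that by (induction k) (auto simp: t(2)[OF cX] p(2))
    have t0: "(t ^^ k) \<zero>\<^bsub>Q\<^esub> = \<zero>\<^bsub>Q\<^esub>" for k by (induction k) (auto simp: hom_zero[OF S(2,2) t(1)])
    have t2: "(t ^^ Suc k) (f x) = \<zero>\<^bsub>Q\<^esub>" if "x \<in> X2" for k x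
      using t(2)[OF cX] that p(3) t0 hom_zero[OF S(1,2,4)] by (simp add: funpow_swap1)
    have I: "f x \<in> ?I" if "x \<in> X1" for x
      using t1[OF that, of "Suc n"] hom_closed[OF S(4) cX] that by (metis image_eqI)
    have N: "f x \<in> ?N" if "x \<in> X2" for x using t2[OF that, of n] hom_closed[OF S(4) cX] that by blast
    have "internal_sum A Y (e ` ?I) (e ` ?N)"
    proof (rule internal_sum_quotient[OF ex sum])
      fix x assume "x \<in> carrier X"
      then obtain a b where "a \<in> X1" "b \<in> X2" "x = a \<oplus>\<^bsub>X\<^esub> b" by (rule internal_sum_decompose[OF sumX])
      then show "\<exists>a\<in>carrier X. \<exists>b\<in>carrier X. f a \<in> ?I \<and> f b \<in> ?N \<and> f x = f a \<oplus>\<^bsub>Q\<^esub> f b"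
        using I N cX hom_add[OF S(4)] by blast
    qed
    \<comment> \<open>As \<open>Y\<close> is indecomposable, \<open>e\<close> kills one of the
      parts. That part is zero by right minimality, and with it \<open>X1\<close> or
      \<open>X2\<close>.\<close>
    then have "?I = {\<zero>\<^bsub>Q\<^esub>} \<or> ?N = {\<zero>\<^bsub>Q\<^esub>}"
      using cases[of ?I ?N] ker[OF sum] ker[OF internal_sum_sym[OF S(2) sum]] by blast
    moreover have "V = {\<zero>\<^bsub>X\<^esub>}" if V: "V = X1 \<or> V = X2" and fV: "f ` V \<subseteq> {\<zero>\<^bsub>Q\<^esub>}" for V
    proof -
      have "x = \<zero>\<^bsub>X\<^esub>" if "x \<in> V" for x
      proof (rule inj_onD[OF S(6)])
        show "f x = f \<zero>\<^bsub>X\<^esub>" using fV that hom_zero[OF S(1,2,4)] by auto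
      qed (use that V cX X.zero_closed in blast)+
      then show ?thesis using V submodule_zero[OF DX(1)] submodule_zero[OF DX(2)] by blast
    qed
    ultimately show ?thesis using I N by (metis (no_types, lifting) image_subsetI)
  qed
  moreover have "carrier X \<noteq> {\<zero>\<^bsub>X\<^esub>}" using zero_projective[OF S(1)] nonprojX by blast
  ultimately show "indecomposable_module A X" by (simp add: indecomposable_iff)
qed

lemma cosyzygy_indecomposable:
  assumes ex: "short_exact A X Q Y f e" and Q: "projective_module A Q"
    and min: "left_minimal A X Q f"
    and ind: "indecomposable_module A X" and nonproj: "\<not> projective_module A X"
  shows "indecomposable_module A Y" "\<not> projective_module A Y"
proof -
  note S = short_exactD[OF ex]
  interpret X: left_module A X by (rule S)
  interpret Q: left_module A Q by (rule S)
  interpret Y: left_module A Y by (rule S)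
  have fgY: "fg_module A Y" by (rule fg_surj[OF projective_fg[OF Q] S(3,5,7)])
  show nonprojY: "\<not> projective_module A Y"
  proof
    \<comment> \<open>If \<open>Y\<close> were projective, \<open>e\<close> would be split by some
      \<open>s\<close>. Subtracting \<open>s (e x)\<close> from \<open>x\<close> lands in the image
      of \<open>f\<close>, which gives a retraction of \<open>Q\<close> onto \<open>X\<close> and
      makes \<open>X\<close> projective.\<close>
    assume Y: "projective_module A Y"
    obtain s where s: "s \<in> module_hom A Y Q" "\<And>y. y \<in> carrier Y \<Longrightarrow> e (s y) = y"
      using projective_lift[OF Y projective_fg[OF Q] fgY S(5,7) hom_id[OF S(3)]] by auto
    have w: "(\<lambda>x\<in>carrier Q. x \<ominus>\<^bsub>Q\<^esub> s (e x)) \<in> module_hom A Q Q"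
      using hom_minus_hom[OF S(2,2) hom_id[OF S(2)] hom_comp[OF S(2,5) s(1)]] by (simp cong: restrict_cong)
    obtain r where r: "r \<in> module_hom A Q X" "\<And>x. x \<in> carrier Q \<Longrightarrow> f (r x) = x \<ominus>\<^bsub>Q\<^esub> s (e x)"
    proof (rule short_exact_factor[OF ex S(2) w])
      show "e ((\<lambda>x\<in>carrier Q. x \<ominus>\<^bsub>Q\<^esub> s (e x)) x) = \<zero>\<^bsub>Y\<^esub>" if "x \<in> carrier Q" for x
        using that s(2) hom_closed[OF s(1)] hom_closed[OF S(5)] by (simp add: hom_diff[OF S(2,3,5)])
    qed auto
    have "r (f x) = x" if x: "x \<in> carrier X" for x
    proof (rule inj_onD[OF S(6)])
      show "f (r (f x)) = f x"
        using r(2)[OF hom_closed[OF S(4) x]] short_exact_comp_zero[OF ex x] hom_zero[OF S(3,2) s(1)]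
          hom_closed[OF S(4) x] Q.diff_add_cancel(1)[of "f x" "\<zero>\<^bsub>Q\<^esub>"] by simp
    qed (use x hom_closed[OF r(1)] hom_closed[OF S(4)] in auto)
    then show False using projective_retract[OF Q S(1) r(1) S(4)] nonproj by blast
  qed
  have "Y1 = {\<zero>\<^bsub>Y\<^esub>} \<or> Y2 = {\<zero>\<^bsub>Y\<^esub>}" if sumY: "internal_sum A Y Y1 Y2" for Y1 Y2
  proof -
    note DY = internal_sumD[OF sumY]
    obtain p where p: "p \<in> module_hom A Y Y" "\<And>x. x \<in> Y1 \<Longrightarrow> p x = x" "p ` carrier Y = Y1"
      "\<And>x. x \<in> carrier Y \<Longrightarrow> p x = \<zero>\<^bsub>Y\<^esub> \<Longrightarrow> x \<in> Y2"
      using internal_sum_projection[OF S(3) sumY] by metis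
    obtain t where t: "t \<in> module_hom A Q Q" "\<And>x. x \<in> carrier Q \<Longrightarrow> e (t x) = p (e x)"
      using projective_lift[OF Q projective_fg[OF Q] fgY S(5,7) hom_comp[OF S(2,5) p(1)]] by auto
    obtain n where sum: "internal_sum A Q ((t ^^ Suc n) ` carrier Q) {x \<in> carrier Q. (t ^^ Suc n) x = \<zero>\<^bsub>Q\<^esub>}"
      using fitting[OF projective_fg[OF Q] t(1)] .
    let ?I = "(t ^^ Suc n) ` carrier Q" and ?N = "{x \<in> carrier Q. (t ^^ Suc n) x = \<zero>\<^bsub>Q\<^esub>}"
    note D = internal_sumD[OF sum]
    have tc: "(t ^^ k) x \<in> carrier Q" if "x \<in> carrier Q" for k x
      using that by (induction k) (auto simp: hom_closed[OF t(1)])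
    have pY: "p y \<in> Y1" if "y \<in> carrier Y" for y using p(3) that by blast
    \<comment> \<open>Every positive power of \<open>t\<close> still induces \<open>p\<close> on
      \<open>Y\<close>, because \<open>p\<close> is idempotent.\<close>
    have et: "e ((t ^^ Suc k) x) = p (e x)" if x: "x \<in> carrier Q" for k x
    proof (induction k)
      case 0
      then show ?case using t(2)[OF x] by simp
    next
      case (Suc k)
      then show ?case using t(2)[OF tc[OF x, of "Suc k"]] p(2)[OF pY[OF hom_closed[OF S(5) x]]] by simp
    qed
    have I: "e x \<in> Y1" if "x \<in> ?I" for x using that et pY hom_closed[OF S(5)] by auto
    have N: "e x \<in> Y2" if "x \<in> ?N" for x
    proof -
      have x: "x \<in> carrier Q" "(t ^^ Suc n) x = \<zero>\<^bsub>Q\<^esub>" using that by auto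
      then have "p (e x) = \<zero>\<^bsub>Y\<^esub>" using et[OF x(1), of n] hom_zero[OF S(2,3,5)] by simp
      then show ?thesis using p(4) hom_closed[OF S(5) x(1)] by blast
    qed
    define XI where "XI = {x \<in> carrier X. f x \<in> ?I}"
    define XN where "XN = {x \<in> carrier X. f x \<in> ?N}"
    have sumX: "internal_sum A X XI XN"
      unfolding XI_def XN_def
    proof (rule internal_sumI[OF S(1) vimage_submodule[OF S(1,2,4) D(1)] vimage_submodule[OF S(1,2,4) D(2)]])
      fix x assume "x \<in> {x \<in> carrier X. f x \<in> ?I}" "x \<in> {x \<in> carrier X. f x \<in> ?N}"
      then have "x \<in> carrier X" "f x \<in> ?I \<inter> ?N" by blast+
      then have x: "x \<in> carrier X" "f x = \<zero>\<^bsub>Q\<^esub>" unfolding D(3) by auto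
      show "x = \<zero>\<^bsub>X\<^esub>" by (rule inj_onD[OF S(6) _ x(1) X.zero_closed]) (simp add: x(2) hom_zero[OF S(1,2,4)])
    next
      fix x assume x: "x \<in> carrier X"
      obtain i u where iu: "i \<in> ?I" "u \<in> ?N" "f x = i \<oplus>\<^bsub>Q\<^esub> u"
        by (rule internal_sum_decompose[OF sum hom_closed[OF S(4) x]])
      have c: "i \<in> carrier Q" "u \<in> carrier Q" using iu submodule_subset[OF D(1)] by blast+
      \<comment> \<open>Each of the components \<open>i\<close> and \<open>u\<close> of
        \<open>f x\<close> lies in the image of \<open>f\<close>: the element \<open>e i\<close>,
        the negative of \<open>e u\<close>, belongs to both \<open>Y1\<close> and \<open>Y2\<close>,
        so it vanishes.\<close>
      have "e i \<oplus>\<^bsub>Y\<^esub> e u = \<zero>\<^bsub>Y\<^esub>"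
        using short_exact_comp_zero[OF ex x] c unfolding iu(3) by (simp add: hom_add[OF S(5)])
      then have "e i = \<ominus>\<^bsub>Y\<^esub> e u" using hom_closed[OF S(5) c(1)] hom_closed[OF S(5) c(2)] by (simp add: Y.M.minus_equality)
      then have "e i \<in> Y1 \<inter> Y2" using I[OF iu(1)] submodule_minus[OF DY(2) N[OF iu(2)]] by simp
      then have ei: "e i = \<zero>\<^bsub>Y\<^esub>" unfolding DY(3) by blast
      then have eu: "e u = \<zero>\<^bsub>Y\<^esub>" using \<open>e i \<oplus>\<^bsub>Y\<^esub> e u = \<zero>\<^bsub>Y\<^esub>\<close> hom_closed[OF S(5) c(2)] by simp
      have "i \<in> f ` carrier X" "u \<in> f ` carrier X" unfolding S(8) using c ei eu by (auto simp: ker_module_def)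
      then obtain a b where ab: "a \<in> carrier X" "i = f a" "b \<in> carrier X" "u = f b" by blast
      have "x = a \<oplus>\<^bsub>X\<^esub> b"
        by (rule inj_onD[OF S(6) _ x]) (use ab iu(3) in \<open>simp_all add: hom_add[OF S(4)]\<close>)
      then show "\<exists>h\<in>{x \<in> carrier X. f x \<in> ?I}. \<exists>u\<in>{x \<in> carrier X. f x \<in> ?N}. x = h \<oplus>\<^bsub>X\<^esub> u"
        using ab iu by blast
    qed
    have Ysum: "carrier Y \<subseteq> e ` V" if "carrier Q = V" for V using S(7) that by blast
    \<comment> \<open>One trace on \<open>X\<close> is zero, so the image of \<open>f\<close> lies
      in a single Fitting part. By left minimality \<open>Q\<close> equals that part, and then
      \<open>Y\<close> is contained in \<open>Y1\<close> or in \<open>Y2\<close>.\<close>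
    have "XI = {\<zero>\<^bsub>X\<^esub>} \<or> XN = {\<zero>\<^bsub>X\<^esub>}" using ind sumX unfolding indecomposable_iff by blast
    then show ?thesis
    proof
      assume "XN = {\<zero>\<^bsub>X\<^esub>}"
      then have "XI = carrier X" using internal_sum_zero_right[OF S(1)] sumX by simp
      then have "f ` carrier X \<subseteq> ?I" unfolding XI_def by blast
      then have N0: "?N = {\<zero>\<^bsub>Q\<^esub>}" using min sum unfolding left_minimal_def by blast
      have "carrier Q = ?I" by (rule sym, rule internal_sum_zero_right[OF S(2) sum[unfolded N0]])
      then have "carrier Y \<subseteq> Y1" using Ysum I by blast
      then have "Y2 \<subseteq> Y1" using submodule_subset[OF DY(2)] by blast
      then show ?thesis using DY(3) by blast
    next
      assume "XI = {\<zero>\<^bsub>X\<^esub>}"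
      then have "XN = carrier X" using internal_sum_zero_right[OF S(1)] internal_sum_sym[OF S(1) sumX] by simp
      then have "f ` carrier X \<subseteq> ?N" unfolding XN_def by blast
      then have I0: "?I = {\<zero>\<^bsub>Q\<^esub>}" using min internal_sum_sym[OF S(2) sum] unfolding left_minimal_def by blast
      have "carrier Q = ?N"
        by (rule sym, rule internal_sum_zero_right[OF S(2) internal_sum_sym[OF S(2) sum, unfolded I0]])
      then have "carrier Y \<subseteq> Y2" using Ysum N by blast
      then have "Y1 \<subseteq> Y2" using submodule_subset[OF DY(1)] by blast
      then show ?thesis using DY(3) by blast
    qed
  qed
  moreover have "carrier Y \<noteq> {\<zero>\<^bsub>Y\<^esub>}" using zero_projective[OF S(3)] nonprojY by blast
  ultimately show "indecomposable_module A Y" by (simp add: indecomposable_iff)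
qed

lemma minimal_left_proj_approxI:
  assumes X: "left_module A X" and Q: "projective_module A Q" and f: "f \<in> module_hom A X Q"
    and ext: "extends_along A X Q f (regular_module A)" and min: "left_minimal A X Q f"
  shows "minimal_left_proj_approx A X Q f"
  unfolding minimal_left_proj_approx_def left_proj_approx_def
proof (intro conjI ballI impI)
  show "bij_betw t (carrier Q) (carrier Q)" if "t \<in> module_hom A Q Q" "\<forall>x\<in>carrier X. t (f x) = f x" for t
    using left_minimal_bij[OF projective_fg[OF Q] f min that(1)] that(2) by blast
  fix P :: "('a, 'a univ) module" and g assume "projective_module A P" "g \<in> module_hom A X P"
  then show "\<exists>h\<in>module_hom A Q P. \<forall>x\<in>carrier X. g x = h (f x)"
    using extends_along_projective[OF X projective_left_module[OF Q] f ext, of P]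
    unfolding extends_along_def by metis
qed (use Q f in auto)

end

text \<open>Approximations are tested on projectives in \<open>mod_cat A\<close>, and a copy of the
  regular module is one of them.\<close>

lemma left_proj_approx_extends:
  assumes X: "left_module A X" and f: "left_proj_approx A X Q f"
  shows "extends_along A X Q f (regular_module A)"
proof -
  have ring: "ring A" using X by (simp add: left_module_def)
  obtain F i i' where F: "F \<in> mod_cat A" "i \<in> module_hom A (regular_module A) F"
    "i' \<in> module_hom A F (regular_module A)"
    "\<And>x. x \<in> carrier (regular_module A) \<Longrightarrow> i' (i x) = x" "\<And>y. y \<in> carrier F \<Longrightarrow> i (i' y) = y"
    using mod_cat_copy[OF regular_fg[OF ring]] by metis
  have "projective_module A F"
    by (rule projective_retract[OF projective_regular[OF ring] mod_catD(2)[OF F(1)] F(2,3,5)])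
  then have "extends_along A X Q f F"
    using f F(1) unfolding left_proj_approx_def extends_along_def by metis
  moreover have "projective_module A Q" "f \<in> module_hom A X Q" using f by (auto simp: left_proj_approx_def)
  ultimately show ?thesis
    using extends_along_retract[OF X projective_left_module _ _ F(3,2,4)] by metis
qed

lemma short_exact_cokernel_unique:
  assumes ex: "short_exact A K P M f e" and ex': "short_exact A K P N f e'"
  shows "module_iso A M N"
proof -
  note S = short_exactD[OF ex] and T = short_exactD[OF ex']
  obtain h where h: "h \<in> module_hom A M N" "\<And>x. x \<in> carrier P \<Longrightarrow> h (e x) = e' x"
    using short_exact_cofactor[OF ex T(3,5)] short_exact_comp_zero[OF ex'] by blast
  obtain k where k: "k \<in> module_hom A N M" "\<And>x. x \<in> carrier P \<Longrightarrow> k (e' x) = e x"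
    using short_exact_cofactor[OF ex' S(3,5)] short_exact_comp_zero[OF ex] by blast
  have "k (h y) = y" if "y \<in> carrier M" for y
    using that h(2) k(2) unfolding S(7)[symmetric] by auto
  moreover have "h (k y) = y" if "y \<in> carrier N" for y
    using that h(2) k(2) unfolding T(7)[symmetric] by auto
  ultimately have "bij_betw h (carrier M) (carrier N)"
    using hom_closed[OF h(1)] hom_closed[OF k(1)] by (intro bij_betw_byWitness[where f' = k]) auto
  then show ?thesis using h(1) by (auto simp: module_iso_def)
qed

section \<open>Arrows of the quiver\<close>

text \<open>Consecutive arrows of a path may describe their common vertex by different modules.
  Vanishing conditions are stated for representatives and carried from one to another.\<close>

definition represents :: "('a, 'r) ring_scheme \<Rightarrow> ('a, 'a univ) module set \<Rightarrow> ('a, 'a univ) module \<Rightarrow> bool" where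
  "represents A v M \<longleftrightarrow> M \<in> mod_cat A \<and> indecomposable_module A M \<and> \<not> projective_module A M \<and> v = iso_class A M"

lemma represents_iso:
  assumes "represents A v M" "represents A v N" shows "module_iso A M N"
proof -
  have "N \<in> iso_class A N" using assms(2) module_iso_refl[of A N] by (auto simp: represents_def iso_class_def mod_catD)
  then have "N \<in> iso_class A M" using assms by (simp add: represents_def)
  then show ?thesis by (simp add: iso_class_def)
qed

lemma represents_Ext1_zero:
  assumes "represents A v M" "represents A v N" "left_module A X"
  shows "Ext1_zero A M X \<longleftrightarrow> Ext1_zero A N X"
proof -
  have "fg_module A M" "fg_module A N" using assms by (auto simp: represents_def mod_catD)
  then show ?thesis
    using Ext1_zero_iso_left represents_iso[OF assms(1,2)] represents_iso[OF assms(2,1)] assms(3) fg_left_module by metis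
qed

lemma torsionless_iso:
  assumes M: "left_module A M" "left_module A N" "module_iso A M N" and tl: "torsionless A M"
  shows "torsionless A N"
proof -
  obtain g where g: "g \<in> module_hom A N M" "bij_betw g (carrier N) (carrier M)"
    using module_iso_sym[OF M] by (auto simp: module_iso_def)
  obtain P f where P: "P \<in> mod_cat A" "projective_module A P" "f \<in> module_hom A M P" "inj_on f (carrier M)"
    using tl by (auto simp: torsionless_def)
  have "inj_on (\<lambda>x\<in>carrier N. f (g x)) (carrier N)"
  proof (rule inj_onI)
    fix x y assume xy: "x \<in> carrier N" "y \<in> carrier N"
      "(\<lambda>x\<in>carrier N. f (g x)) x = (\<lambda>x\<in>carrier N. f (g x)) y"
    then have "g x = g y" using inj_onD[OF P(4)] hom_closed[OF g(1)] by simp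
    then show "x = y" using inj_onD[OF bij_betw_imp_inj_on[OF g(2)]] xy by blast
  qed
  then show ?thesis using P hom_comp[OF M(2) g(1) P(3)] unfolding torsionless_def by blast
qed

text \<open>An embedding of the torsionless module \<open>M\<close> into a projective module factors
  through the approximation \<open>f\<close>, which is therefore injective. Its cokernel completes
  it to a short exact sequence ending in \<open>N\<close>.\<close>

lemma arrowD:
  fixes A :: "('a, 'r) ring_scheme"
  assumes "(u, v) \<in> mho_arrows A"
  obtains N M and Q :: "('a, 'a univ) module" and f e where "represents A u N" "represents A v M" "torsionless A M"
    "short_exact A M Q N f e" "projective_module A Q" "extends_along A M Q f (regular_module A)"
proof -
  obtain N M where NM: "represents A u N" "represents A v M" "torsionless A M" "is_mho A M N"
    using assms by (auto simp: mho_arrows_def represents_def)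
  have lm: "left_module A N" "left_module A M" using NM by (auto simp: represents_def mod_catD)
  obtain Q f where Q: "Q \<in> mod_cat A" "minimal_left_proj_approx A M Q f" "module_iso A N (coker_module M Q f)"
    using NM(4) by (auto simp: is_mho_def)
  then have approx: "left_proj_approx A M Q f" by (simp add: minimal_left_proj_approx_def)
  then have f: "projective_module A Q" "f \<in> module_hom A M Q" by (auto simp: left_proj_approx_def)
  obtain P j where P: "P \<in> mod_cat A" "projective_module A P" "j \<in> module_hom A M P" "inj_on j (carrier M)"
    using NM(3) by (auto simp: torsionless_def)
  have "\<exists>h\<in>module_hom A Q P. \<forall>x\<in>carrier M. j x = h (f x)"
    using approx P(1-3) unfolding left_proj_approx_def by simp
  then obtain h where "\<forall>x\<in>carrier M. j x = h (f x)" ..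
  then have "inj_on f (carrier M)" using P(4) by (metis inj_on_def)
  then have ex: "short_exact A M Q (coker_module M Q f) f (\<lambda>x\<in>carrier Q. (f ` carrier M) +>\<^bsub>Q\<^esub> x)"
    by (rule short_exact_coker[OF lm(2) projective_left_module[OF f(1)] f(2)])
  obtain i where i: "i \<in> module_hom A (coker_module M Q f) N"
    "bij_betw i (carrier (coker_module M Q f)) (carrier N)"
    using module_iso_sym[OF lm(1) short_exactD(3)[OF ex] Q(3)] by (auto simp: module_iso_def)
  show thesis
    using that[OF NM(1-3) short_exact_iso_right[OF ex lm(1) i] f(1) left_proj_approx_extends[OF lm(2) approx]] .
qed

text \<open>The arrow ends at the kernel of a right minimal surjection from a projective module onto
  \<open>M\<close>. The vanishing of Ext^1 makes the inclusion of the kernel an approximation, and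
  its cokernel is \<open>M\<close>.\<close>

lemma (in finite_length_ring) ex_arrow_from:
  assumes M: "represents A v M" and ext: "Ext1_zero A M (regular_module A)"
  shows "\<exists>w. (v, w) \<in> mho_arrows A"
proof -
  note reg = regular_left_module[OF ring_axioms]
  have cat: "M \<in> mod_cat A" and ind: "indecomposable_module A M" and np: "\<not> projective_module A M"
    and v: "v = iso_class A M"
    using M by (auto simp: represents_def)
  obtain Q e where Q: "Q \<in> mod_cat A" "projective_module A Q" "e \<in> module_hom A Q M"
    "e ` carrier Q = carrier M" "right_minimal A Q M e"
    using ex_right_minimal[OF mod_catD(1)[OF cat]] by metis
  note lmQ = mod_catD(2)[OF Q(1)] and lmM = mod_catD(2)[OF cat]
  let ?K = "Q\<lparr>carrier := ker_module Q M e\<rparr>" and ?f = "\<lambda>x\<in>ker_module Q M e. x"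
  have ex: "short_exact A ?K Q M ?f e" by (rule short_exact_ker[OF lmQ lmM Q(3,4)])
  note S = short_exactD[OF ex]
  have K: "?K \<in> mod_cat A"
    using fg_submodule[OF mod_catD(1)[OF Q(1)] ker_submodule[OF lmQ lmM Q(3)]] by (simp add: mod_cat_def)
  have ext': "extends_along A ?K Q ?f (regular_module A)" using ext Ext1_zero_iff[OF ex Q(2) reg] by simp
  note syz = syzygy_indecomposable[OF ex Q(2) ext' Q(5) ind np]
  have "torsionless A ?K" unfolding torsionless_def using Q(1,2) S(4,6) by blast
  moreover have "is_mho A ?K M"
    unfolding is_mho_def
    using Q(1) minimal_left_proj_approxI[OF S(1) Q(2) S(4) ext' syz(3)]
      short_exact_cokernel_unique[OF ex short_exact_coker[OF S(1,2,4,6)]] by blast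
  ultimately have "(v, iso_class A ?K) \<in> mho_arrows A"
    unfolding mho_arrows_def v using cat ind np K syz(1,2) by blast
  then show ?thesis ..
qed

text \<open>The arrow starts at the cokernel of a minimal approximation of \<open>M\<close>, which
  is injective because \<open>M\<close> embeds in a projective module.\<close>

lemma (in artin_duality) ex_arrow_to:
  assumes M: "represents A v M" and tl: "torsionless A M"
  shows "\<exists>u. (u, v) \<in> mho_arrows A"
proof -
  have cat: "M \<in> mod_cat A" and ind: "indecomposable_module A M" and np: "\<not> projective_module A M"
    and v: "v = iso_class A M"
    using M by (auto simp: represents_def)
  note lmM = mod_catD(2)[OF cat]
  obtain Q0 f where Q0: "Q0 \<in> mod_cat A" "projective_module A Q0" "f \<in> module_hom A M Q0"
    "extends_along A M Q0 f (regular_module A)"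
    using ex_approximation[OF mod_catD(1)[OF cat]] by metis
  obtain Q where Q: "Q \<in> mod_cat A" "projective_module A Q" "f \<in> module_hom A M Q"
    "extends_along A M Q f (regular_module A)" "left_minimal A M Q f"
    using algebra.ex_left_minimal[OF lmM Q0] by metis
  note lmQ = mod_catD(2)[OF Q(1)]
  obtain P j where P: "P \<in> mod_cat A" "projective_module A P" "j \<in> module_hom A M P" "inj_on j (carrier M)"
    using tl by (auto simp: torsionless_def)
  obtain h where "\<And>x. x \<in> carrier M \<Longrightarrow> h (f x) = j x"
    using extends_alongE[OF extends_along_projective[OF lmM lmQ Q(3,4) P(2)] P(3)] by metis
  then have "inj_on f (carrier M)" using P(4) by (metis inj_on_def)
  then have ex: "short_exact A M Q (coker_module M Q f) f (\<lambda>x\<in>carrier Q. (f ` carrier M) +>\<^bsub>Q\<^esub> x)"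
    by (rule short_exact_coker[OF lmM lmQ Q(3)])
  note S = short_exactD[OF ex]
  have "fg_module A (coker_module M Q f)" by (rule fg_surj[OF projective_fg[OF Q(2)] S(3,5,7)])
  then obtain N where N: "N \<in> mod_cat A" "module_iso A (coker_module M Q f) N"
    using ex_iso_in_mod_cat by blast
  note lmN = mod_catD(2)[OF N(1)]
  obtain i where i: "i \<in> module_hom A (coker_module M Q f) N"
    "bij_betw i (carrier (coker_module M Q f)) (carrier N)"
    using N(2) by (auto simp: module_iso_def)
  note cos = algebra.cosyzygy_indecomposable[OF short_exact_iso_right[OF ex lmN i] Q(2,5) ind np]
  have "is_mho A M N"
    unfolding is_mho_def
    using Q(1) algebra.minimal_left_proj_approxI[OF lmM Q(2-5)] module_iso_sym[OF S(3) lmN N(2)] by blast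
  then have "(iso_class A N, v) \<in> mho_arrows A"
    unfolding mho_arrows_def v using cat ind np N(1) cos tl by blast
  then show ?thesis ..
qed

section \<open>Projective resolutions\<close>

text \<open>\<open>Ext1\<close> picks a resolution by choice, which is meaningful once one exists.
  Covers and kernels alternate; the kernels stay finitely generated by the ascending chain
  condition.\<close>

lemma (in finite_length_ring) ex_projective_resolution:
  fixes Z :: "('a, 'm) module"
  assumes Z: "fg_module A Z"
  shows "\<exists>P e d. projective_resolution A Z P e d"
proof -
  note lmZ = fg_left_module[OF Z]
  obtain P0 e where P0: "free_module A P0" "e \<in> module_hom A P0 Z" "e ` carrier P0 = carrier Z"
    using free_cover[OF Z] by blast
  note fgP0 = free_fg[OF P0(1)]
  note lmP0 = fg_left_module[OF fgP0]
  define K0 where "K0 = P0\<lparr>carrier := ker_module P0 Z e\<rparr>"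
  have K0: "fg_module A K0" unfolding K0_def by (rule fg_submodule[OF fgP0 ker_submodule[OF lmP0 lmZ P0(2)]])
  \<comment> \<open>A state \<open>(Q, f, C)\<close> is a cover \<open>f\<close> of the current
    syzygy \<open>C\<close>, and \<open>step\<close> takes the kernel of \<open>f\<close> as the
    next syzygy. The clause for index 0 ties the sequence to the kernel of \<open>e\<close>.\<close>
  define good where "good = (\<lambda>(n :: nat) (Q :: ('a, 'a univ) module, f, C). fg_module A C \<and> projective_module A Q \<and>
    f \<in> module_hom A Q C \<and> f ` carrier Q = carrier C \<and> (n = 0 \<longrightarrow> C = K0))"
  define step where "step = (\<lambda>(n :: nat) (Q :: ('a, 'a univ) module, f :: 'a univ \<Rightarrow> 'a univ, C :: ('a, 'a univ) module)
      (Q' :: ('a, 'a univ) module, f' :: 'a univ \<Rightarrow> 'a univ, C').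
    C' = Q\<lparr>carrier := ker_module Q C f\<rparr>)"
  have "\<exists>s. \<forall>n. good n (s n) \<and> step n (s n) (s (Suc n))"
  proof (rule dependent_nat_choice)
    obtain F f where "free_module A F" "f \<in> module_hom A F K0" "f ` carrier F = carrier K0"
      using free_cover[OF K0] by blast
    then have "good 0 (F, f, K0)" using K0 free_projective by (auto simp: good_def)
    then show "\<exists>s. good 0 s" ..
  next
    fix s n assume "good n s"
    then obtain Q f C where s: "s = (Q, f, C)" and Q: "fg_module A C" "projective_module A Q" "f \<in> module_hom A Q C"
      by (cases s) (auto simp: good_def)
    let ?C = "Q\<lparr>carrier := ker_module Q C f\<rparr>"
    have C: "fg_module A ?C"
      by (rule fg_submodule[OF projective_fg[OF Q(2)] ker_submodule[OF projective_left_module[OF Q(2)] fg_left_module[OF Q(1)] Q(3)]])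
    obtain F g where "free_module A F" "g \<in> module_hom A F ?C" "g ` carrier F = carrier ?C"
      using free_cover[OF C] by blast
    then have "good (Suc n) (F, g, ?C)" using C free_projective by (auto simp: good_def)
    moreover have "step n s (F, g, ?C)" by (simp add: step_def s)
    ultimately show "\<exists>s'. good (Suc n) s' \<and> step n s s'" by blast
  qed
  then obtain s where s: "\<And>n. good n (s n)" "\<And>n. step n (s n) (s (Suc n))" by blast
  define Q where "Q n = fst (s n)" for n
  define f where "f n = fst (snd (s n))" for n
  define C where "C n = snd (snd (s n))" for n
  have sn: "s n = (Q n, f n, C n)" for n by (simp add: Q_def f_def C_def)
  have Q: "fg_module A (C n)" "projective_module A (Q n)" "f n \<in> module_hom A (Q n) (C n)"
    "f n ` carrier (Q n) = carrier (C n)" for n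
    using s(1)[of n] by (auto simp: good_def sn)
  have C0: "C 0 = K0" using s(1)[of 0] by (simp add: good_def sn)
  have CSuc: "C (Suc n) = Q n\<lparr>carrier := ker_module (Q n) (C n) (f n)\<rparr>" for n
    using s(2)[of n] by (simp add: step_def sn)
  \<comment> \<open>The covers are shifted by one, with \<open>P0\<close> put in front and a dummy
    value for \<open>d 0\<close>.\<close>
  define P where "P n = (case n of 0 \<Rightarrow> P0 | Suc n \<Rightarrow> Q n)" for n
  define d where "d n = (case n of 0 \<Rightarrow> undefined | Suc n \<Rightarrow> f n)" for n
  \<comment> \<open>Each syzygy is a submodule of \<open>P n\<close> with the same zero, so
    \<open>f n\<close> has the same kernel for either codomain.\<close>
  have zero: "\<zero>\<^bsub>C n\<^esub> = \<zero>\<^bsub>P n\<^esub>" for n by (cases n) (auto simp: P_def C0 K0_def CSuc)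
  have dom: "f n \<in> module_hom A (Q n) (P n)" for n
  proof (cases n)
    case 0
    have "f 0 \<in> module_hom A (Q 0) (P0\<lparr>carrier := ker_module P0 Z e\<rparr>)" using Q(3)[of 0] by (simp add: C0 K0_def)
    from hom_codomD[OF this submodule_subset[OF ker_submodule[OF lmP0 lmZ P0(2)]]] show ?thesis
      by (simp add: P_def 0)
  next
    case (Suc k)
    have "f n \<in> module_hom A (Q n) (Q k\<lparr>carrier := ker_module (Q k) (C k) (f k)\<rparr>)"
      using Q(3)[of n] by (simp add: CSuc Suc)
    moreover have "ker_module (Q k) (C k) (f k) \<subseteq> carrier (Q k)" by (auto simp: ker_module_def)
    ultimately have "f n \<in> module_hom A (Q n) (Q k)" by (rule hom_codomD)
    then show ?thesis by (simp add: P_def Suc)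
  qed
  have ker: "ker_module (Q n) (C n) (f n) = ker_module (Q n) (P n) (f n)" for n by (simp add: ker_module_def zero)
  have "projective_resolution A Z P e d"
    unfolding projective_resolution_def
  proof (intro conjI allI)
    show "projective_module A (P i)" for i using Q(2) free_projective[OF P0(1)] by (cases i) (auto simp: P_def)
    show "e \<in> module_hom A (P 0) Z" "e ` carrier (P 0) = carrier Z" using P0 by (auto simp: P_def)
    show "d (Suc i) \<in> module_hom A (P (Suc i)) (P i)" for i using dom[of i] by (simp add: d_def P_def)
    show "d 1 ` carrier (P 1) = ker_module (P 0) Z e" using Q(4)[of 0] by (simp add: d_def P_def C0 K0_def)
    show "d (Suc (Suc i)) ` carrier (P (Suc (Suc i))) = ker_module (P (Suc i)) (P i) (d (Suc i))" for i
      using Q(4)[of "Suc i"] ker[of i] by (simp add: d_def P_def[of "Suc _"] CSuc)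
  qed
  then show ?thesis by blast
qed

text \<open>The coset of \<open>f\<close> is \<open>H\<close> exactly when \<open>f\<close> lies in
  \<open>H\<close>. The assumptions list what this comparison takes, so that they can be checked
  directly on cocycles and coboundaries.\<close>

lemma FactGroup_trivial_iff:
  assumes car: "\<And>f. f \<in> H \<Longrightarrow> f \<in> carrier G"
    and one: "\<one>\<^bsub>G\<^esub> \<in> H" and l_one: "\<And>f. f \<in> carrier G \<Longrightarrow> \<one>\<^bsub>G\<^esub> \<otimes>\<^bsub>G\<^esub> f = f"
    and mult: "\<And>f g. f \<in> H \<Longrightarrow> g \<in> H \<Longrightarrow> f \<otimes>\<^bsub>G\<^esub> g \<in> H"
    and div: "\<And>f g. f \<in> H \<Longrightarrow> g \<in> H \<Longrightarrow> \<exists>h\<in>H. h \<otimes>\<^bsub>G\<^esub> g = f"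
  shows "carrier (G Mod H) = {\<one>\<^bsub>G Mod H\<^esub>} \<longleftrightarrow> carrier G \<subseteq> H"
proof
  assume triv: "carrier (G Mod H) = {\<one>\<^bsub>G Mod H\<^esub>}"
  show "carrier G \<subseteq> H"
  proof
    fix f assume f: "f \<in> carrier G"
    then have "H #>\<^bsub>G\<^esub> f \<in> carrier (G Mod H)" by (auto simp: FactGroup_def RCOSETS_def)
    then have "H #>\<^bsub>G\<^esub> f = H" using triv by (simp add: FactGroup_def)
    moreover have "\<one>\<^bsub>G\<^esub> \<otimes>\<^bsub>G\<^esub> f \<in> H #>\<^bsub>G\<^esub> f" using one by (auto simp: r_coset_def)
    ultimately show "f \<in> H" using l_one[OF f] by simp
  qed
next
  assume sub: "carrier G \<subseteq> H"
  have "H #>\<^bsub>G\<^esub> f = H" if f: "f \<in> carrier G" for f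
  proof (rule equalityI; rule subsetI)
    fix x assume "x \<in> H #>\<^bsub>G\<^esub> f"
    then show "x \<in> H" using mult f sub by (auto simp: r_coset_def)
  next
    fix x assume "x \<in> H"
    then obtain h where "h \<in> H" "h \<otimes>\<^bsub>G\<^esub> f = x" using div f sub by blast
    then show "x \<in> H #>\<^bsub>G\<^esub> f" by (auto simp: r_coset_def)
  qed
  moreover have "\<one>\<^bsub>G\<^esub> \<in> carrier G" using car one by blast
  ultimately show "carrier (G Mod H) = {\<one>\<^bsub>G Mod H\<^esub>}" by (auto simp: FactGroup_def RCOSETS_def)
qed

text \<open>A cocycle on \<open>P 1\<close> kills the kernel of \<open>d 1\<close>, so it amounts to
  a map on the image of \<open>d 1\<close>, which is the first syzygy. It is a coboundary exactly
  when that map extends to \<open>P 0\<close>.\<close>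

lemma Ext1_via_trivial_iff:
  assumes res: "projective_resolution A Z P e d" and Z: "left_module A Z" and X: "left_module A X"
  shows "carrier (Ext1_via A P d X) = {\<one>\<^bsub>Ext1_via A P d X\<^esub>} \<longleftrightarrow> Ext1_zero A Z X"
proof -
  interpret X: left_module A X by (rule X)
  have P: "projective_module A (P i)" for i using res by (simp add: projective_resolution_def)
  note lm = projective_left_module[OF P]
  have e: "e \<in> module_hom A (P 0) Z" "e ` carrier (P 0) = carrier Z"
    and d1: "d 1 \<in> module_hom A (P 1) (P 0)" and im1: "d 1 ` carrier (P 1) = ker_module (P 0) Z e"
    and d2: "d 2 \<in> module_hom A (P 2) (P 1)" and im2: "d 2 ` carrier (P 2) = ker_module (P 1) (P 0) (d 1)"
    using res unfolding projective_resolution_def numeral_2_eq_2 One_nat_def by auto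
  define K where "K = (P 0)\<lparr>carrier := ker_module (P 0) Z e\<rparr>"
  define i where "i = (\<lambda>x\<in>ker_module (P 0) Z e. x)"
  have ex: "short_exact A K (P 0) Z i e" unfolding K_def i_def by (rule short_exact_ker[OF lm Z e])
  note lmK = short_exactD(1)[OF ex]
  have d1K: "d 1 \<in> module_hom A (P 1) K" unfolding K_def by (rule hom_codom[OF d1]) (simp only: im1 order.refl)
  have d1K_surj: "d 1 ` carrier (P 1) = carrier K" using im1 by (simp add: K_def)
  have idK: "i (d 1 x) = d 1 x" if "x \<in> carrier (P 1)" for x using im1 that by (auto simp: i_def)
  have d12: "d 1 (d 2 x) = \<zero>\<^bsub>P 0\<^esub>" if "x \<in> carrier (P 2)" for x
    using im2 that by (auto simp: ker_module_def)
  define Z1 where "Z1 = {f \<in> module_hom A (P 1) X. \<forall>x\<in>carrier (P 2). f (d 2 x) = \<zero>\<^bsub>X\<^esub>}"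
  define B1 where "B1 = {compose (carrier (P 1)) g (d 1) | g. g \<in> module_hom A (P 0) X}"
  let ?G = "(hom_group A (P 1) X)\<lparr>carrier := Z1\<rparr>"
  have comp: "compose (carrier (P 1)) g (d 1) \<in> module_hom A (P 1) X" if "g \<in> module_hom A (P 0) X" for g
    using hom_comp[OF lm d1 that] by (simp add: compose_def)
  have "carrier (Ext1_via A P d X) = {\<one>\<^bsub>Ext1_via A P d X\<^esub>} \<longleftrightarrow> carrier ?G \<subseteq> B1"
    unfolding Ext1_via_def B1_def[symmetric] Z1_def[symmetric]
  proof (rule FactGroup_trivial_iff)
    show "f \<in> carrier ?G" if "f \<in> B1" for f
    proof -
      obtain g where g: "g \<in> module_hom A (P 0) X" "f = compose (carrier (P 1)) g (d 1)" using \<open>f \<in> B1\<close> by (auto simp: B1_def)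
      have "f (d 2 x) = \<zero>\<^bsub>X\<^esub>" if "x \<in> carrier (P 2)" for x
        using that d12[OF that] hom_closed[OF d2 that] hom_zero[OF lm X g(1)] by (simp add: g(2) compose_def)
      then show ?thesis using comp[OF g(1)] g(2) by (simp add: Z1_def)
    qed
    have "\<one>\<^bsub>?G\<^esub> = compose (carrier (P 1)) (\<lambda>x\<in>carrier (P 0). \<zero>\<^bsub>X\<^esub>) (d 1)"
      using hom_closed[OF d1] by (auto simp: hom_group_def compose_def intro!: restrict_ext)
    then show "\<one>\<^bsub>?G\<^esub> \<in> B1" using hom_const_zero[OF lm X] by (auto simp: B1_def)
    show "\<one>\<^bsub>?G\<^esub> \<otimes>\<^bsub>?G\<^esub> f = f" if "f \<in> carrier ?G" for f
    proof -
      have f: "f \<in> module_hom A (P 1) X" using that by (simp add: Z1_def)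
      show ?thesis
        using hom_eqI[OF hom_plus[OF lm X hom_const_zero[OF lm X] f] f] hom_closed[OF f] by (simp add: hom_group_def)
    qed
    show "f \<otimes>\<^bsub>?G\<^esub> g \<in> B1" if fg: "f \<in> B1" "g \<in> B1" for f g
    proof -
      obtain f' g' where *: "f' \<in> module_hom A (P 0) X" "f = compose (carrier (P 1)) f' (d 1)"
        "g' \<in> module_hom A (P 0) X" "g = compose (carrier (P 1)) g' (d 1)"
        using fg by (auto simp: B1_def)
      have "f \<otimes>\<^bsub>?G\<^esub> g = compose (carrier (P 1)) (\<lambda>x\<in>carrier (P 0). f' x \<oplus>\<^bsub>X\<^esub> g' x) (d 1)"
        using hom_closed[OF d1] by (auto simp: hom_group_def compose_def *(2,4) intro!: restrict_ext)
      then show ?thesis using hom_plus[OF lm X *(1,3)] by (auto simp: B1_def)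
    qed
    show "\<exists>h\<in>B1. h \<otimes>\<^bsub>?G\<^esub> g = f" if fg: "f \<in> B1" "g \<in> B1" for f g
    proof -
      obtain f' g' where *: "f' \<in> module_hom A (P 0) X" "f = compose (carrier (P 1)) f' (d 1)"
        "g' \<in> module_hom A (P 0) X" "g = compose (carrier (P 1)) g' (d 1)"
        using fg by (auto simp: B1_def)
      let ?h = "compose (carrier (P 1)) (\<lambda>x\<in>carrier (P 0). f' x \<ominus>\<^bsub>X\<^esub> g' x) (d 1)"
      have "?h \<otimes>\<^bsub>?G\<^esub> g = f"
        using hom_closed[OF d1] hom_closed[OF *(1)] hom_closed[OF *(3)]
        by (auto simp: hom_group_def compose_def *(2,4) X.diff_add_cancel intro!: restrict_ext)
      then show ?thesis using hom_minus_hom[OF lm X *(1,3)] by (auto simp: B1_def)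
    qed
  qed
  also have "carrier ?G \<subseteq> B1 \<longleftrightarrow> extends_along A K (P 0) i X"
  proof
    assume sub: "carrier ?G \<subseteq> B1"
    show "extends_along A K (P 0) i X"
      unfolding extends_along_def
    proof
      fix h assume h: "h \<in> module_hom A K X"
      have hd: "(\<lambda>x\<in>carrier (P 1). h (d 1 x)) \<in> module_hom A (P 1) X" by (rule hom_comp[OF lm d1K h])
      have "h (\<zero>\<^bsub>P 0\<^esub>) = \<zero>\<^bsub>X\<^esub>" using hom_zero[OF lmK X h] by (simp add: K_def)
      then have "(\<lambda>x\<in>carrier (P 1). h (d 1 x)) \<in> Z1"
        using hd d12 hom_closed[OF d2] by (simp add: Z1_def)
      then have "(\<lambda>x\<in>carrier (P 1). h (d 1 x)) \<in> B1" using sub by auto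
      then obtain g where g: "g \<in> module_hom A (P 0) X"
        "(\<lambda>x\<in>carrier (P 1). h (d 1 x)) = compose (carrier (P 1)) g (d 1)" by (auto simp: B1_def)
      have "g (i y) = h y" if "y \<in> carrier K" for y
      proof -
        obtain x where x: "x \<in> carrier (P 1)" "y = d 1 x" using \<open>y \<in> carrier K\<close> unfolding d1K_surj[symmetric] by blast
        show ?thesis using fun_cong[OF g(2), of x] x idK by (simp add: compose_def)
      qed
      then show "\<exists>g\<in>module_hom A (P 0) X. \<forall>x\<in>carrier K. g (i x) = h x" using g(1) by blast
    qed
  next
    assume ext: "extends_along A K (P 0) i X"
    show "carrier ?G \<subseteq> B1"
    proof
      fix f assume "f \<in> carrier ?G"
      then have f: "f \<in> module_hom A (P 1) X" "\<And>x. x \<in> carrier (P 2) \<Longrightarrow> f (d 2 x) = \<zero>\<^bsub>X\<^esub>" by (auto simp: Z1_def)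
      have "ker_module (P 1) K (d 1) = ker_module (P 1) (P 0) (d 1)" by (simp add: ker_module_def K_def)
      then have "ker_module (P 1) K (d 1) \<subseteq> ker_module (P 1) X f"
        unfolding im2[symmetric] using f(2) hom_closed[OF d2] by (auto simp: ker_module_def)
      then obtain h where h: "h \<in> module_hom A K X" "\<And>x. x \<in> carrier (P 1) \<Longrightarrow> h (d 1 x) = f x"
        using factor_surj[OF lm lmK X d1K d1K_surj f(1)] by blast
      obtain g where g: "g \<in> module_hom A (P 0) X" "\<And>x. x \<in> carrier K \<Longrightarrow> g (i x) = h x"
        using extends_alongE[OF ext h(1)] by blast
      have "g (d 1 x) = f x" if "x \<in> carrier (P 1)" for x
        using g(2)[OF hom_closed[OF d1K that]] h(2)[OF that] idK[OF that] by simp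
      then have "f = compose (carrier (P 1)) g (d 1)"
        by (intro hom_eqI[OF f(1) comp[OF g(1)]]) (simp add: compose_def)
      then show "f \<in> B1" using g(1) by (auto simp: B1_def)
    qed
  qed
  also have "\<dots> \<longleftrightarrow> Ext1_zero A Z X" by (rule Ext1_zero_iff[OF ex P X, symmetric])
  finally show ?thesis .
qed

text \<open>Whichever resolution is chosen, it decides the vanishing in the same way.\<close>

lemma (in finite_length_ring) Ext1_trivial_iff:
  assumes Z: "fg_module A Z" and X: "left_module A X"
  shows "carrier (Ext1 A Z X) = {\<one>\<^bsub>Ext1 A Z X\<^esub>} \<longleftrightarrow> Ext1_zero A Z X"
proof -
  obtain P d where Pd: "(SOME (P, d). \<exists>e. projective_resolution A Z P e d) = (P, d)" by fastforce
  have "\<exists>Pd. case Pd of (P, d) \<Rightarrow> \<exists>e. projective_resolution A Z P e d"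
    using ex_projective_resolution[OF Z] by auto
  from someI_ex[OF this] obtain e where "projective_resolution A Z P e d" unfolding Pd by auto
  then show ?thesis
    using Ext1_via_trivial_iff fg_left_module[OF Z] X by (simp add: Ext1_def Pd)
qed

lemma (in finite_length_ring) perp1_iff:
  assumes "fg_module A Z" and "\<And>X. X \<in> \<X> \<Longrightarrow> left_module A X"
  shows "Z \<in> perp1 A \<X> \<longleftrightarrow> (\<forall>X\<in>\<X>. Ext1_zero A Z X)"
  using assms(1) Ext1_trivial_iff[OF assms(1) assms(2)] by (simp add: perp1_def)

section \<open>Paths of the quiver\<close>

text \<open>Dependent choice treats finite and infinite lengths together: once \<open>t\<close> is
  reached, the choice of the next vertex is free.\<close>

lemma ex_path:
  fixes t :: enat
  assumes start: "Inv 0 v" and step: "\<And>i w. enat i < t \<Longrightarrow> Inv i w \<Longrightarrow> \<exists>w'. R w w' \<and> Inv (Suc i) w'"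
  shows "\<exists>p. p 0 = v \<and> (\<forall>i. enat i < t \<longrightarrow> R (p i) (p (Suc i)))"
proof -
  \<comment> \<open>The invariant is kept up to the index \<open>t\<close> itself, where the last
    arrow of a finite path ends.\<close>
  define good where "good i w \<longleftrightarrow> (i = 0 \<longrightarrow> w = v) \<and> (enat i \<le> t \<longrightarrow> Inv i w)" for i w
  have "\<exists>p. \<forall>i. good i (p i) \<and> (enat i < t \<longrightarrow> R (p i) (p (Suc i)))"
  proof (rule dependent_nat_choice)
    show "\<exists>w. good 0 w" using start by (auto simp: good_def)
    fix w i assume w: "good i w"
    show "\<exists>w'. good (Suc i) w' \<and> (enat i < t \<longrightarrow> R w w')"
    proof (cases "enat i < t")
      case True
      then obtain w' where "R w w'" "Inv (Suc i) w'" using step[OF True, of w] w by (auto simp: good_def)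
      then show ?thesis by (auto simp: good_def)
    next
      case False
      then have "\<not> enat (Suc i) \<le> t" by (simp add: Suc_ile_eq)
      then show ?thesis using False by (auto simp: good_def)
    qed
  qed
  then obtain p where "\<forall>i. good i (p i) \<and> (enat i < t \<longrightarrow> R (p i) (p (Suc i)))" ..
  then show ?thesis by (intro exI[of _ p]) (auto simp: good_def)
qed

lemma image_submodule_hom:
  assumes "left_module A M" "left_module A N" "f \<in> module_hom A M N"
  shows "left_module A (image_module M N f)" "f \<in> module_hom A M (image_module M N f)"
  using submodule_left_module[OF assms(2) image_submodule[OF assms carrier_submodule[OF assms(1)]]]
    hom_codom[OF assms(3) subset_refl] by (simp_all add: image_module_def)

lemma Ext1_zero_iso_iff:
  assumes "fg_module A M" "fg_module A N" "module_iso A M N" "left_module A X"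
  shows "Ext1_zero A N X \<longleftrightarrow> Ext1_zero A M X"
  using assms Ext1_zero_iso_left module_iso_sym fg_left_module by metis

section \<open>Syzygies, cosyzygies and paths for fixed resolutions\<close>

locale mho_setup = artin_duality R A J \<iota>
  for R :: "('r, 'x) ring_scheme" and A :: "('r, 'a) module" and J :: "('r, 'j) module" and \<iota> :: "'r set \<Rightarrow> 'j" +
  fixes P I K L :: "nat \<Rightarrow> ('a, 'a univ) module" and \<epsilon> \<eta> :: "'a univ \<Rightarrow> 'a univ"
    and d \<delta> :: "nat \<Rightarrow> 'a univ \<Rightarrow> 'a univ"
  assumes K0: "K 0 \<in> mod_cat A" "module_iso A (dual_regular R A J) (K 0)"
    and resolution: "projective_resolution A (K 0) P \<epsilon> d"
    and K_Suc: "\<And>i. K (Suc i) = image_module (P (Suc i)) (P i) (d (Suc i))"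
    and L0: "L 0 \<in> mod_cat A" "module_iso A (regular_module A) (L 0)"
    and coresolution: "injective_coresolution A (L 0) I \<eta> \<delta>"
    and L_Suc: "\<And>i. L (Suc i) = image_module (I i) (I (Suc i)) (\<delta> (Suc i))"
begin

lemma K_exact: "\<exists>i p. short_exact A (K (Suc n)) (P n) (K n) i p"
proof -
  have P: "projective_module A (P i)" and d: "d (Suc i) \<in> module_hom A (P (Suc i)) (P i)" for i
    using resolution by (auto simp: projective_resolution_def)
  note lm = projective_left_module[OF P]
  show ?thesis
  proof (cases n)
    case 0
    have e: "\<epsilon> \<in> module_hom A (P 0) (K 0)" "\<epsilon> ` carrier (P 0) = carrier (K 0)"
      and im: "d 1 ` carrier (P 1) = ker_module (P 0) (K 0) \<epsilon>"
      using resolution by (auto simp: projective_resolution_def)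
    show ?thesis using short_exact_ker[OF lm mod_catD(2)[OF K0(1)] e] im 0 by (auto simp: K_Suc image_module_def)
  next
    case (Suc k)
    have im: "d (Suc n) ` carrier (P (Suc n)) = ker_module (P n) (P k) (d n)"
      using resolution Suc by (auto simp: projective_resolution_def)
    note img = image_submodule_hom[OF lm lm d[of k]]
    \<comment> \<open>\<open>K n\<close> is a submodule of \<open>P k\<close> with the same zero, so
      both codomains give the same kernel.\<close>
    have "ker_module (P n) (P k) (d n) = ker_module (P n) (K n) (d n)"
      by (simp add: ker_module_def K_Suc Suc image_module_def)
    moreover have "d n ` carrier (P n) = carrier (K n)" by (simp add: K_Suc Suc image_module_def)
    ultimately show ?thesis
      using short_exact_ker[OF lm, of "K n" "d n" n] img im by (auto simp: K_Suc image_module_def Suc)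
  qed
qed

lemma L_exact: "\<exists>i p. short_exact A (L n) (I n) (L (Suc n)) i p"
proof -
  have I: "injective_module A (I i)" and d: "\<delta> (Suc i) \<in> module_hom A (I i) (I (Suc i))" for i
    using coresolution by (auto simp: injective_coresolution_def)
  note lm = injective_left_module[OF I]
  note img = image_submodule_hom[OF lm lm d]
  have surj: "\<delta> (Suc n) ` carrier (I n) = carrier (L (Suc n))" by (simp add: L_Suc image_module_def)
  have ker: "ker_module (I n) (L (Suc n)) (\<delta> (Suc n)) = ker_module (I n) (I (Suc n)) (\<delta> (Suc n))"
    by (simp add: ker_module_def L_Suc image_module_def)
  have p: "left_module A (L (Suc n))" "\<delta> (Suc n) \<in> module_hom A (I n) (L (Suc n))"
    using img[of n] by (simp_all add: L_Suc)
  show ?thesis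
  proof (cases n)
    case 0
    have "\<eta> \<in> module_hom A (L 0) (I 0)" "inj_on \<eta> (carrier (L 0))" "\<eta> ` carrier (L 0) = ker_module (I 0) (I 1) (\<delta> 1)"
      using coresolution by (auto simp: injective_coresolution_def)
    then have "short_exact A (L n) (I n) (L (Suc n)) \<eta> (\<delta> (Suc n))"
      unfolding short_exact_def using lm p surj ker mod_catD(2)[OF L0(1)] by (simp add: 0)
    then show ?thesis by blast
  next
    case (Suc k)
    have "\<delta> (Suc k) ` carrier (I k) = ker_module (I (Suc k)) (I (Suc (Suc k))) (\<delta> (Suc (Suc k)))"
      using coresolution by (auto simp: injective_coresolution_def)
    \<comment> \<open>\<open>L n\<close> is defined as an image; exactness of the coresolution makes
      it a kernel in \<open>I n\<close>, so the inclusion can serve as the first map.\<close>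
    then have "L n = (I n)\<lparr>carrier := ker_module (I n) (L (Suc n)) (\<delta> (Suc n))\<rparr>"
      using ker by (simp add: Suc L_Suc[of k] image_module_def)
    then show ?thesis using short_exact_ker[OF lm p surj] by metis
  qed
qed

lemma P_projective: "projective_module A (P i)" and I_injective: "injective_module A (I i)"
  using resolution coresolution by (auto simp: projective_resolution_def injective_coresolution_def)

lemma K_left_module: "left_module A (K n)"
  using K_exact[of n] by (auto simp: short_exact_def)

lemma L_left_module: "left_module A (L n)"
  using L_exact[of n] by (auto simp: short_exact_def)

lemma regular_lm: "left_module A (regular_module A)"
  by (rule regular_left_module[OF ring_A])

lemma Ext1_zero_L0:
  assumes "fg_module A M" shows "Ext1_zero A M (L 0) \<longleftrightarrow> Ext1_zero A M (regular_module A)"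
  using Ext1_zero_iso_right[OF assms] L0(2) regular_lm L_left_module[of 0] module_iso_sym by metis

text \<open>Injectivity is tested on finitely generated modules, and the kernel of a free cover is
  finitely generated by the ascending chain condition.\<close>

lemma Ext1_zero_injective:
  assumes M: "fg_module A M" and X: "injective_module A X" shows "Ext1_zero A M X"
proof -
  obtain F e where F: "free_module A F" "e \<in> module_hom A F M" "e ` carrier F = carrier M"
    using free_cover[OF M] by blast
  note lm = fg_left_module[OF free_fg[OF F(1)]] fg_left_module[OF M]
  have ex: "short_exact A (F\<lparr>carrier := ker_module F M e\<rparr>) F M (\<lambda>x\<in>ker_module F M e. x) e"
    by (rule short_exact_ker[OF lm F(2,3)])
  note S = short_exactD[OF ex]
  have "fg_module A (F\<lparr>carrier := ker_module F M e\<rparr>)"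
    by (rule algebra.fg_submodule[OF free_fg[OF F(1)] ker_submodule[OF lm F(2)]])
  from extends_along_injective[OF X this free_fg[OF F(1)] S(4,6)] show ?thesis
    using Ext1_zero_iff[OF ex free_projective[OF F(1)] injective_left_module[OF X]] by simp
qed

lemma K0_injective: "injective_module A (K 0)"
  by (rule dual_injective[OF mod_catD(1)[OF K0(1)] K0(2)])

lemma Ext1_zero_K0: "fg_module A M \<Longrightarrow> Ext1_zero A M (K 0)"
  by (rule Ext1_zero_injective[OF _ K0_injective])

lemma torsionless_iff:
  assumes M: "fg_module A M" and ext: "Ext1_zero A M (regular_module A)"
  shows "torsionless A M \<longleftrightarrow> Ext1_zero A M (K 1)"
proof -
  obtain i p where ex: "short_exact A (K 1) (P 0) (K 0) i p" using K_exact[of 0] by auto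
  note S = short_exactD[OF ex] and P = P_projective[of 0]
  have P_cat: "P 0 \<in> mod_cat A" using projective_fg[OF P] by (simp add: mod_cat_def)
  have iff: "Ext1_zero A M (K 1) \<longleftrightarrow> (\<forall>h\<in>module_hom A M (K 0). \<exists>k\<in>module_hom A M (P 0). \<forall>x\<in>carrier M. p (k x) = h x)"
    by (rule Ext1_zero_iff_lift[OF M ex projective_fg[OF P] Ext1_zero_projective[OF M ext P]])
  show ?thesis
  proof
    assume "Ext1_zero A M (K 1)"
    then show "torsionless A M"
      using torsionless_if_lift[OF K_left_module K0(2) P_cat P S(5) M] unfolding iff by blast
  next
    assume "torsionless A M"
    then obtain Q :: "('a, 'a univ) module" and j where Q: "projective_module A Q" "j \<in> module_hom A M Q" "inj_on j (carrier M)"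
      unfolding torsionless_def by blast
    show "Ext1_zero A M (K 1)"
      unfolding iff
    proof
      \<comment> \<open>The map extends along the embedding \<open>j\<close> by injectivity of
        \<open>K 0\<close>, lifts to \<open>P 0\<close> because \<open>Q\<close> is projective, and
        then restricts to \<open>M\<close>.\<close>
      fix h assume "h \<in> module_hom A M (K 0)"
      then obtain g where g: "g \<in> module_hom A Q (K 0)" "\<And>x. x \<in> carrier M \<Longrightarrow> g (j x) = h x"
        using injective_extend[OF K0_injective M projective_fg[OF Q(1)] Q(2,3)] by metis
      obtain k where k: "k \<in> module_hom A Q (P 0)" "\<And>x. x \<in> carrier Q \<Longrightarrow> p (k x) = g x"
        using projective_lift[OF Q(1) projective_fg[OF P] mod_catD(1)[OF K0(1)] S(5,7) g(1)] by metis
      show "\<exists>k\<in>module_hom A M (P 0). \<forall>x\<in>carrier M. p (k x) = h x"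
        using hom_comp[OF fg_left_module[OF M] Q(2) k(1)] k(2) g(2) hom_closed[OF Q(2)] by (intro bexI) auto
    qed
  qed
qed

text \<open>The representatives come from one short exact sequence. The start of the arrow has no
  extensions by the regular module because the first map is an approximation; the shift for
  \<open>K\<close> asks the same of \<open>M\<close>, since both groups with values in
  \<open>P i\<close> have to vanish.\<close>

lemma arrow_shift:
  assumes arrow: "(u, v) \<in> mho_arrows A"
  obtains N M where "represents A u N" "represents A v M" "torsionless A M"
    "Ext1_zero A N (regular_module A)"
    "\<And>i. Ext1_zero A N (L (Suc i)) \<longleftrightarrow> Ext1_zero A M (L i)"
    "\<And>i. Ext1_zero A M (regular_module A) \<Longrightarrow> Ext1_zero A M (K (Suc i)) \<longleftrightarrow> Ext1_zero A N (K i)"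
proof -
  obtain N M and Q :: "('a, 'a univ) module" and f e where *: "represents A u N" "represents A v M" "torsionless A M"
    "short_exact A M Q N f e" "projective_module A Q" "extends_along A M Q f (regular_module A)"
    using arrowD[OF arrow] by metis
  have fg: "fg_module A M" "fg_module A N" using *(1,2) by (auto simp: represents_def mod_catD)
  have extN: "Ext1_zero A N (regular_module A)" using Ext1_zero_iff[OF *(4,5) regular_lm] *(6) by simp
  have "Ext1_zero A N (L (Suc i)) \<longleftrightarrow> Ext1_zero A M (L i)" for i
    using L_exact[of i] Ext1_zero_shift_cosyzygy[OF *(4,5) fg(1) _ I_injective Ext1_zero_injective[OF fg(1) I_injective]]
    by blast
  moreover have "Ext1_zero A M (K (Suc i)) \<longleftrightarrow> Ext1_zero A N (K i)" if "Ext1_zero A M (regular_module A)" for i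
    using K_exact[of i] Ext1_zero_shift_syzygy[OF *(4,5) fg(1) _ P_projective
      Ext1_zero_projective[OF fg(1) that P_projective] Ext1_zero_projective[OF fg(2) extN P_projective]] by blast
  ultimately show thesis using that[OF *(1-3) extN] by blast
qed

lemma arrow_from_iff:
  assumes M: "represents A v M"
  shows "(\<exists>w. (v, w) \<in> mho_arrows A) \<longleftrightarrow> Ext1_zero A M (regular_module A)"
proof
  assume "\<exists>w. (v, w) \<in> mho_arrows A"
  then show "Ext1_zero A M (regular_module A)"
    using arrow_shift represents_Ext1_zero[OF M _ regular_lm] by metis
qed (rule algebra.ex_arrow_from[OF M])

lemma arrow_to_iff:
  assumes M: "represents A v M" and ext: "Ext1_zero A M (regular_module A)"
  shows "(\<exists>u. (u, v) \<in> mho_arrows A) \<longleftrightarrow> Ext1_zero A M (K 1)"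
proof -
  have fg: "fg_module A M" using M by (simp add: represents_def mod_catD)
  have "(\<exists>u. (u, v) \<in> mho_arrows A) \<longleftrightarrow> torsionless A M"
  proof
    assume "\<exists>u. (u, v) \<in> mho_arrows A"
    then obtain M' where M': "represents A v M'" "torsionless A M'" using arrowD by metis
    show "torsionless A M"
      using torsionless_iso[OF _ _ represents_iso[OF M'(1) M] M'(2)] M M'(1) by (simp add: represents_def mod_catD)
  qed (rule ex_arrow_to[OF M])
  then show ?thesis using torsionless_iff[OF fg ext] by simp
qed

text \<open>Vanishing for \<open>L 0\<close> gives the first arrow, and each arrow lowers the index
  of \<open>L\<close> by one. So the condition on \<open>L k\<close> at the start is the condition
  for continuing after \<open>k\<close> arrows.\<close>

lemma path_from_iff:
  assumes M: "represents A v M"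
  shows "mho_path_from A v t \<longleftrightarrow> (\<forall>i. enat i < t \<longrightarrow> Ext1_zero A M (L i))"
proof
  have "Ext1_zero A M (L k)"
    if "represents A (p 0) M" "\<And>i. i \<le> k \<Longrightarrow> (p i, p (Suc i)) \<in> mho_arrows A" for k p M
    using that
  proof (induction k arbitrary: p M)
    case 0
    have "fg_module A M" using 0(1) by (simp add: represents_def mod_catD)
    then show ?case using arrow_from_iff[OF 0(1)] 0(2)[of 0] Ext1_zero_L0 by blast
  next
    case (Suc k)
    obtain N M' where *: "represents A (p 0) N" "represents A (p 1) M'"
      "\<And>i. Ext1_zero A N (L (Suc i)) \<longleftrightarrow> Ext1_zero A M' (L i)"
      using arrow_shift[of "p 0" "p 1"] Suc.prems(2)[of 0] by (metis One_nat_def zero_le)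
    have "Ext1_zero A M' (L k)"
      using *(2) Suc.prems(2) by (intro Suc.IH[of "\<lambda>i. p (Suc i)"]) auto
    then show ?case using *(3) represents_Ext1_zero[OF *(1) Suc.prems(1) L_left_module] by blast
  qed
  note * = this
  assume "mho_path_from A v t"
  then obtain p where p: "p 0 = v" "\<And>i. enat i < t \<Longrightarrow> (p i, p (Suc i)) \<in> mho_arrows A"
    by (auto simp: mho_path_from_def)
  show "\<forall>i. enat i < t \<longrightarrow> Ext1_zero A M (L i)"
  proof (intro allI impI)
    fix k assume k: "enat k < t"
    show "Ext1_zero A M (L k)"
    proof (rule *)
      show "represents A (p 0) M" using M p(1) by simp
      show "(p i, p (Suc i)) \<in> mho_arrows A" if "i \<le> k" for i
        by (rule p(2), rule order.strict_trans1[OF _ k]) (simp add: that)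
    qed
  qed
next
  assume ext: "\<forall>i. enat i < t \<longrightarrow> Ext1_zero A M (L i)"
  \<comment> \<open>After \<open>i\<close> arrows the vanishing remains for the indices
    \<open>j\<close> with \<open>i + j\<close> below \<open>t\<close>.\<close>
  define Inv where "Inv i w \<longleftrightarrow> (\<exists>M. represents A w M \<and> (\<forall>j. enat (i + j) < t \<longrightarrow> Ext1_zero A M (L j)))" for i w
  have "\<exists>p. p 0 = v \<and> (\<forall>i. enat i < t \<longrightarrow> (p i, p (Suc i)) \<in> mho_arrows A)"
  proof (rule ex_path[where Inv = Inv])
    show "Inv 0 v" using M ext by (auto simp: Inv_def)
    fix i w assume i: "enat i < t" and "Inv i w"
    then obtain M where M: "represents A w M" "\<And>j. enat (i + j) < t \<Longrightarrow> Ext1_zero A M (L j)"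
      by (auto simp: Inv_def)
    have "fg_module A M" using M(1) by (simp add: represents_def mod_catD)
    then have "Ext1_zero A M (regular_module A)" using M(2)[of 0] i Ext1_zero_L0[of M] by simp
    then obtain w' where w': "(w, w') \<in> mho_arrows A" using arrow_from_iff[OF M(1)] by blast
    obtain N M' where *: "represents A w N" "represents A w' M'"
      "\<And>i. Ext1_zero A N (L (Suc i)) \<longleftrightarrow> Ext1_zero A M' (L i)"
      using arrow_shift[OF w'] by metis
    have "Ext1_zero A M' (L j)" if "enat (Suc i + j) < t" for j
      using M(2)[of "Suc j"] that *(3) represents_Ext1_zero[OF *(1) M(1) L_left_module] by simp
    then show "\<exists>w'. (w, w') \<in> mho_arrows A \<and> Inv (Suc i) w'" using w' *(2) by (auto simp: Inv_def)
  qed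
  moreover have "v \<in> mho_vertices A" using M by (auto simp: mho_vertices_def represents_def)
  ultimately show "mho_path_from A v t" by (simp add: mho_path_from_def)
qed

text \<open>Each arrow, followed backwards, lowers the index of \<open>K\<close> by one. The
  condition for \<open>K 0\<close> is automatic since \<open>K 0\<close> is injective, so a path of
  length \<open>t\<close> corresponds to the indices up to \<open>t\<close> inclusively.\<close>

lemma path_to_iff:
  assumes M: "represents A v M" and reg: "Ext1_zero A M (regular_module A)"
  shows "mho_path_to A v t \<longleftrightarrow> (\<forall>i. enat i \<le> t \<longrightarrow> Ext1_zero A M (K i))"
proof
  have "Ext1_zero A M (K k)"
    if "represents A (p 0) M" "Ext1_zero A M (regular_module A)" "\<And>i. i < k \<Longrightarrow> (p (Suc i), p i) \<in> mho_arrows A" for k p M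
    using that
  proof (induction k arbitrary: p M)
    case 0
    have "fg_module A M" using 0(1) by (simp add: represents_def mod_catD)
    then show ?case by (rule Ext1_zero_K0)
  next
    case (Suc k)
    obtain N M' where *: "represents A (p 1) N" "represents A (p 0) M'" "Ext1_zero A N (regular_module A)"
      "\<And>i. Ext1_zero A M' (regular_module A) \<Longrightarrow> Ext1_zero A M' (K (Suc i)) \<longleftrightarrow> Ext1_zero A N (K i)"
      using arrow_shift[of "p 1" "p 0"] Suc.prems(3)[of 0] by (metis One_nat_def zero_less_Suc)
    have "Ext1_zero A N (K k)"
      using *(1,3) Suc.prems(3) by (intro Suc.IH[of "\<lambda>i. p (Suc i)"]) auto
    moreover have "Ext1_zero A M' (regular_module A)"
      using Suc.prems(2) represents_Ext1_zero[OF *(2) Suc.prems(1) regular_lm] by simp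
    ultimately have "Ext1_zero A M' (K (Suc k))" using *(4) by simp
    then show ?case using represents_Ext1_zero[OF *(2) Suc.prems(1) K_left_module] by simp
  qed
  note * = this
  assume "mho_path_to A v t"
  then obtain p where p: "p 0 = v" "\<And>i. enat i < t \<Longrightarrow> (p (Suc i), p i) \<in> mho_arrows A"
    by (auto simp: mho_path_to_def)
  show "\<forall>i. enat i \<le> t \<longrightarrow> Ext1_zero A M (K i)"
  proof (intro allI impI)
    fix k assume k: "enat k \<le> t"
    show "Ext1_zero A M (K k)"
    proof (rule *)
      show "represents A (p 0) M" using M p(1) by simp
      show "Ext1_zero A M (regular_module A)" by (rule reg)
      show "(p (Suc i), p i) \<in> mho_arrows A" if "i < k" for i
        by (rule p(2), rule order.strict_trans2[OF _ k]) (simp add: that)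
    qed
  qed
next
  assume ext: "\<forall>i. enat i \<le> t \<longrightarrow> Ext1_zero A M (K i)"
  \<comment> \<open>The vanishing for the regular module is part of the invariant: the criterion for
    an incoming arrow and the shift for \<open>K\<close> depend on it, and the preceding vertex has
    it as the start of an arrow.\<close>
  define Inv where "Inv i w \<longleftrightarrow> (\<exists>M. represents A w M \<and> Ext1_zero A M (regular_module A) \<and>
    (\<forall>j. enat (i + j) \<le> t \<longrightarrow> Ext1_zero A M (K j)))" for i w
  have "\<exists>p. p 0 = v \<and> (\<forall>i. enat i < t \<longrightarrow> (p (Suc i), p i) \<in> mho_arrows A)"
  proof (rule ex_path[where Inv = Inv])
    show "Inv 0 v" using M ext reg by (auto simp: Inv_def)
    fix i w assume i: "enat i < t" and "Inv i w"
    then obtain M where M: "represents A w M" "Ext1_zero A M (regular_module A)"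
      "\<And>j. enat (i + j) \<le> t \<Longrightarrow> Ext1_zero A M (K j)"
      by (auto simp: Inv_def)
    \<comment> \<open>From \<open>enat i < t\<close> follows that \<open>i + 1\<close> is at most
      \<open>t\<close>, so index 1 is still in range.\<close>
    have "Ext1_zero A M (K 1)" using M(3)[of 1] i by (simp add: Suc_ile_eq)
    then obtain w' where w': "(w', w) \<in> mho_arrows A" using arrow_to_iff[OF M(1,2)] by blast
    obtain N M' where *: "represents A w' N" "represents A w M'" "Ext1_zero A N (regular_module A)"
      "\<And>i. Ext1_zero A M' (regular_module A) \<Longrightarrow> Ext1_zero A M' (K (Suc i)) \<longleftrightarrow> Ext1_zero A N (K i)"
      using arrow_shift[OF w'] by metis
    have "Ext1_zero A M' (regular_module A)"
      using M(2) represents_Ext1_zero[OF *(2) M(1) regular_lm] by simp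
    then have "Ext1_zero A N (K j)" if "enat (Suc i + j) \<le> t" for j
      using M(3)[of "Suc j"] that *(4)[of j] represents_Ext1_zero[OF *(2) M(1) K_left_module[of "Suc j"]] by simp
    then show "\<exists>w'. (w', w) \<in> mho_arrows A \<and> Inv (Suc i) w'" using w' *(1,3) by (auto simp: Inv_def)
  qed
  moreover have "v \<in> mho_vertices A" using M by (auto simp: mho_vertices_def represents_def)
  ultimately show "mho_path_to A v t" by (simp add: mho_path_to_def)
qed

text \<open>The elements of \<open>M\<close> may have any type, whereas the vertices of the quiver
  consist of modules in \<open>mod_cat A\<close>.\<close>

lemma ex_representative:
  assumes M: "fg_module A M" and ind: "indecomposable_module A M" and np: "\<not> projective_module A M"
  obtains M' where "represents A (iso_class A M) M'" "fg_module A M'" "module_iso A M M'"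
proof -
  note lm = fg_left_module[OF M]
  obtain M' where M': "M' \<in> mod_cat A" "module_iso A M M'" using ex_iso_in_mod_cat[OF M] by blast
  note lm' = mod_catD(2)[OF M'(1)]
  have iso': "module_iso A M' M" by (rule module_iso_sym[OF lm lm' M'(2)])
  have "iso_class A M = iso_class A M'"
    using module_iso_trans[OF lm M'(2)] module_iso_trans[OF lm' iso'] unfolding iso_class_def by blast
  moreover have "\<not> projective_module A M'" using projective_iso[OF _ lm iso'] np by blast
  ultimately have "represents A (iso_class A M) M'"
    using M'(1) indecomposable_iso[OF lm lm' M'(2) ind] by (simp add: represents_def)
  then show thesis using that mod_catD(1)[OF M'(1)] M'(2) by blast
qed

lemma paths_iff:
  assumes M: "fg_module A M" and ind: "indecomposable_module A M" and np: "\<not> projective_module A M"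
    and m: "m \<noteq> 0"
  shows "mho_path_from A (iso_class A M) m \<and> mho_path_to A (iso_class A M) n \<longleftrightarrow>
    M \<in> perp1 A ({L i | i. enat i \<le> m - 1} \<union> {K i | i. enat i \<le> n})"
proof -
  obtain M' where M': "represents A (iso_class A M) M'" and iso: "fg_module A M'" "module_iso A M M'"
    using ex_representative[OF M ind np] by blast
  note ext = Ext1_zero_iso_iff[OF M iso]
  \<comment> \<open>As \<open>m\<close> is not zero, both bounds select the same natural numbers;
    for \<open>m = \<infinity>\<close> they select all.\<close>
  have less: "enat i \<le> m - 1 \<longleftrightarrow> enat i < m" for i
    using m by (cases m) (auto simp: one_enat_def zero_enat_def)
  have from_iff: "mho_path_from A (iso_class A M) m \<longleftrightarrow> (\<forall>i. enat i \<le> m - 1 \<longrightarrow> Ext1_zero A M (L i))"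
    unfolding path_from_iff[OF M'] less using ext[OF L_left_module] by simp
  have to_iff: "mho_path_to A (iso_class A M) n \<longleftrightarrow> (\<forall>i. enat i \<le> n \<longrightarrow> Ext1_zero A M (K i))"
    if "Ext1_zero A M (L 0)"
    using path_to_iff[OF M'] that Ext1_zero_L0[OF M] ext[OF K_left_module] ext[OF regular_lm] by simp
  \<comment> \<open>Index 0 therefore always occurs among the \<open>L i\<close>, which provides the
    assumption of \<open>to_iff\<close>.\<close>
  have "enat 0 \<le> m - 1" using m by (simp add: less zero_enat_def[symmetric])
  moreover have "M \<in> perp1 A ({L i | i. enat i \<le> m - 1} \<union> {K i | i. enat i \<le> n}) \<longleftrightarrow>
      (\<forall>i. enat i \<le> m - 1 \<longrightarrow> Ext1_zero A M (L i)) \<and> (\<forall>i. enat i \<le> n \<longrightarrow> Ext1_zero A M (K i))"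
    by (subst algebra.perp1_iff[OF M]) (use L_left_module K_left_module in auto)
  ultimately show ?thesis using from_iff to_iff by blast
qed

text \<open>Ext^1 with values in a direct sum vanishes exactly when it does for both summands. These
  give the criteria for the outgoing and for the incoming arrow, the second one presupposing the
  first.\<close>

lemma arrows_iff:
  assumes M: "fg_module A M" and ind: "indecomposable_module A M" and np: "\<not> projective_module A M"
  shows "(\<exists>v. (iso_class A M, v) \<in> mho_arrows A) \<and> (\<exists>v. (v, iso_class A M) \<in> mho_arrows A) \<longleftrightarrow>
    M \<in> perp1 A {direct_sum_module (regular_module A) (K 1)}"
proof -
  obtain M' where M': "represents A (iso_class A M) M'" and iso: "fg_module A M'" "module_iso A M M'"
    using ex_representative[OF M ind np] by blast
  note ext = Ext1_zero_iso_iff[OF M iso]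
  have "M \<in> perp1 A {direct_sum_module (regular_module A) (K 1)} \<longleftrightarrow>
      Ext1_zero A M (regular_module A) \<and> Ext1_zero A M (K 1)"
    using direct_sum_left_module[OF regular_lm K_left_module] Ext1_zero_direct_sum[OF M regular_lm K_left_module]
    by (subst algebra.perp1_iff[OF M]) auto
  then show ?thesis
    using arrow_from_iff[OF M'] arrow_to_iff[OF M'] ext[OF K_left_module] ext[OF regular_lm] by blast
qed

end

theorem theorem3p4:
  fixes R :: "('r, 'x) ring_scheme"
    and A :: "('r, 'a) module"
    and J :: "('r, 'j) module" and \<iota> :: "'r set \<Rightarrow> 'j"
    and P I K L :: "nat \<Rightarrow> ('a, 'a univ) module"
    and \<epsilon> \<eta> :: "'a univ \<Rightarrow> 'a univ"
    and d \<delta> :: "nat \<Rightarrow> 'a univ \<Rightarrow> 'a univ"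
    and M :: "('a, 'm) module"
  assumes "artin_algebra R A"
    and "injective_envelope R (quot_module (regular_module R) (jacobson_radical R)) J \<iota>"
    and "K 0 \<in> mod_cat A" and "module_iso A (dual_regular R A J) (K 0)"
    and "minimal_projective_resolution A (K 0) P \<epsilon> d"
    and "\<And>i. K (Suc i) = image_module (P (Suc i)) (P i) (d (Suc i))"
    and "L 0 \<in> mod_cat A" and "module_iso A (regular_module A) (L 0)"
    and "minimal_injective_coresolution A (L 0) I \<eta> \<delta>"
    and "\<And>i. L (Suc i) = image_module (I i) (I (Suc i)) (\<delta> (Suc i))"
    and "fg_module A M" and "indecomposable_module A M" and "\<not> projective_module A M"
  shows "(\<forall>m n :: enat. m \<noteq> 0 \<longrightarrow>
            (mho_path_from A (iso_class A M) m \<and> mho_path_to A (iso_class A M) n \<longleftrightarrow>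
             M \<in> perp1 A ({L i | i. enat i \<le> m - 1} \<union> {K i | i. enat i \<le> n}))) \<and>
         ((\<exists>v. (iso_class A M, v) \<in> mho_arrows A) \<and> (\<exists>v. (v, iso_class A M) \<in> mho_arrows A) \<longleftrightarrow>
          M \<in> perp1 A {direct_sum_module (regular_module A) (K 1)})"
proof -
  interpret mho_setup R A J \<iota> P I K L \<epsilon> \<eta> d \<delta>
    using assms(1-10)
    by (simp add: mho_setup_def mho_setup_axioms_def artin_duality_def artin_duality_axioms_def
        minimal_projective_resolution_def minimal_injective_coresolution_def)
  show ?thesis using paths_iff[OF assms(11-13)] arrows_iff[OF assms(11-13)] by blast
qed

end
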